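(* Let $2\leq p<3$, let $\mathbf X=(X,\mathbb X)$ be a Hölder weak geometric $p$-rough path over $\mathbb R^\ell$ on $[0,T]$, and let $h:[0,T]\to\mathbb R$ be an $\alpha$-Hölder path with $\alpha+\frac1p>1$. Let $V,V_1,\dots,V_\ell$ and $V^\lambda,V_1^\lambda,\dots,V_\ell^\lambda$ be path-dependent vector fields on $\mathbb R^d$ satisfying (H1): $V,V^\lambda$ are strongly Lipschitz and $\mathcal C^2_b$, and the $V_i,V_i^\lambda$ are strongly Lipschitz and have finite $(\!|\cdot|\!)$-norm. Suppose $V^\lambda$ converges to $V$ in $\mathcal C^2_b$ and the $V_i^\lambda$ converge to $V_i$ in $(\!|\cdot|\!)$-norm, as $\lambda$ tends to $\infty$. If $V(y_{[0,u]})$ and $V_i(y_{[0,u]})$ depend only on $y_u$, for all $0\le u\le T$, then the solution flow $\varphi^\lambda$ to the path-dependent rough differential equation $$d\varphi^\lambda=V^\lambda h(dt)+\mathrm F^\lambda\mathbf X(dt),\qquad \mathrm F^\lambda=(V^\lambda_1,\dots,V^\lambda_\ell),$$ converges uniformly to the solution flow $\varphi$ of the classical, "Markovian", rough differential equation on flows $$d\varphi=Vh(dt)+\mathrm F\mathbf X(dt),\qquad \mathrm F=(V_1,\dots,V_\ell).$$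
   Context: **Paths.** $[0,T]$ is a fixed time interval. $\mathcal P=\bigcup_{0\le a\le T}\mathcal C([0,a],\mathbb R^d)$, with $\mathcal C([0,0],\mathbb R^d)$ identified with $\mathbb R^d$; $y_{[0,a]}$ is a generic element of $\mathcal C([0,a],\mathbb R^d)$, and $\overline y_\bullet$ is the path on $[0,T]$ equal to $y_{[0,a]}$ on $[0,a]$ and constant, equal to $y_a$, on $[a,T]$. $\|\cdot\|_\infty$ is the supremum norm on $[0,T]$. $\mathcal P$ has the metric $\mathrm d(y_{[0,a]},z_{[0,b]})=|b-a|+\|\overline y_\bullet-\overline z_\bullet\|_\infty$. $\mathcal P^1=\bigcup_{0\le a\le T}\mathcal C^1([0,a],\mathbb R^d)$, with $\mathcal C^1([0,0],\mathbb R^d)$ identified with $\mathbb R^d\times\mathbb R^d$; $\dot y_\bullet$ is the derivative of a $\mathcal C^1$ path $y_\bullet$. **Path-dependent vector fields.** A path-dependent vector field on $\mathbb R^d$ is a map $V:\mathcal P\to\mathbb R^d$. It is strongly Lipschitz if, for some constant $\kappa>0$, $|V(y_{[0,a]})-V(z_{[0,b]})|\le\kappa\|\overline y_\bullet-\overline z_\bullet\|_\infty$ for all $y_{[0,a]},z_{[0,b]}\in\mathcal P$, $0\le a,b\le T$. It is of class $\mathcal C^k$ if its restriction to each space $\mathcal C([0,a],\mathbb R^d)$ is $\mathcal C^k$-Fréchet differentiable with respect to the supremum norm on $[0,a]$. If $F$ is bounded and $\mathcal C^k$ with bounded Fréchet derivatives $F^{(1)},\dots,F^{(k)}$, set $\|F\|_{\mathcal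 C^k}=\sum_{i=0}^k\|F^{(i)}\|$, with $F^{(0)}=F$ and uniform norms on the right; $\mathcal C^k_b$ is the set of maps for which this is finite, and convergence in $\mathcal C^2_b$ is convergence in $\|\cdot\|_{\mathcal C^2}$. **Fine differentiability.** For a Banach space $E$, $L(\mathcal P,E)$ denotes the set of continuous linear maps from $\mathcal P$ to $E$; $L(\mathcal P,L(\mathcal P,E))$ is identified with $L(\mathcal P^{\otimes2},E)$, and similarly for higher orders. A map $F:\mathcal P\to E$ is finely-$\mathcal C^1$ if there is a continuous map $F':\mathcal P\to L(\mathcal P,E)$ such that $$F(y_{[0,a]})=F(y_{[0,0]})+\int_0^aF'\big(y_{[0,r]};\dot y_{[0,r]}\big)\,dr\quad\text{for any } y_{[0,a]}\in\mathcal P^1 ;$$ its fine derivative $F'$ is also written $F^{\{1\}}$. For $k\ge2$, $F$ is finely-$\mathcal C^k$ if $F^{\{k-1\}}$ is finely-$\mathcal C^1$, with fine derivative $F^{\{k\}}$; $F^{\{0\}}=F$. If $F$ is bounded and finely-$\mathcal C^k$ with bounded fine derivatives, $|F|_{\mathcal C^k}=\sum_{i=0}^k|F^{\{i\}}|$ (uniform norms). **The norm $(\!|\cdot|\!)$.** $$(\!|V_i|\!)=\sum_{k=0}^{2}\Big\{\big|V_i^{(k)}\big|_{\mathcal C^{3-k}}+\big\|\big(V_i^{(k)}\big)^{\{2-k\}}\big\|_{\mathcal C^1}\Big\}.$$ **Brackets.** For path-dependent vector fields $V,W$ with $W$ of class $\mathcal C^1$, $(VW)(y_{[0,a]})=\frac{d}{d\epsilon}\big|_{\epsilon=0}W\big(s\in[0,a]\mapsto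 y_s+\epsilon V(y_{[0,a]})\big)$; if both are $\mathcal C^1$, $[V,W]=VW-WV$. **Rough paths.** A Hölder weak geometric $p$-rough path, $2\le p<3$, is a pair $(X_{ts},\mathbb X_{ts})\in\mathbb R^\ell\times(\mathbb R^\ell)^{\otimes2}$, $0\le s\le t\le T$, with $X_{ts}=X_{us}+X_{tu}$ and $\mathbb X_{ts}=\mathbb X_{us}+\mathbb X_{tu}+X_{us}\otimes X_{tu}$ for $s\le u\le t$, with the symmetric part of $\mathbb X_{ts}$ equal to $\frac12X_{ts}\otimes X_{ts}$, and with $|X_{ts}|$ and $|\mathbb X_{ts}|$ bounded by constant multiples of $|t-s|^{1/p}$ and $|t-s|^{2/p}$ respectively. **The maps $\mu_{ts}$.** For $V,V_1,\dots,V_\ell$ satisfying (H1) and $0\le s\le t\le T$, $\mu_{ts}:\mathbb R^d\to\mathbb R^d$ is the time $1$ map ($y_0=x\mapsto y_1$) of the path-dependent ordinary differential equation, with summation over repeated indices, $$\dot y_u=(h_t-h_s)V(y_{[0,u]})+X^i_{ts}V_i(y_{[0,u]})+\tfrac12\mathbb X^{jk}_{ts}[V_j,V_k](y_{[0,u]}),\quad 0\le u\le1.$$ **Solution flow.** A flow is a family $(\varphi_{ts})_{0\le s\le t\le T}$ of maps from $\mathbb R^d$ to itself with $\varphi_{tu}\circ\varphi_{us}=\varphi_{ts}$ for all $s\le u\le t$. It solves the equation $d\varphi=Vh(dt)+\mathrm F\mathbf X(dt)$ if there exist a constant $\gamma>1$ independent of $\mathbf X$ and two possibly $\mathbf X$-dependent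 positive constants $\delta,c$ such that $\sup_{x\in\mathbb R^d}|\varphi_{ts}(x)-\mu_{ts}(x)|\le c\,|t-s|^\gamma$ for all $0\le s\le t\le T$ with $t-s\le\delta$. Under (H1) such a flow exists and is unique; it is called the solution flow.
   Formalization: It is assumed that T ≥ 1: the maps μ_ts are time-1 maps of an equation that evaluates the vector fields on paths over [0,u] for all u ≤ 1, whereas the fields are defined only on paths of duration at most T, so for T < 1 the solution flow is undefined. *)

theory Defs
  imports "HOL-Analysis.Analysis"
begin

text \<open>
  An element of \<open>\<C>([0,a],\<real>\<^sup>d)\<close> is represented by its extension to the whole line that is constant on
  each side of \<open>[0,a]\<close>. The supremum norm of bounded continuous functions then is the supremum norm
  on \<open>[0,a]\<close>, and for \<open>a \<le> T\<close> the restriction to \<open>[0,T]\<close> is the path stopped at \<open>a\<close>.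
\<close>

type_synonym 'd curve = "real \<Rightarrow>\<^sub>C (real ^ 'd)"

definition stop :: "real \<Rightarrow> (real \<Rightarrow>\<^sub>C 'a::metric_space) \<Rightarrow> (real \<Rightarrow>\<^sub>C 'a)" where
  "stop a y = Bcontfun (\<lambda>t. y (max 0 (min a t)))"

text \<open>\<open>stop a y\<close> is indeed continuous and bounded:\<close>

lemma stop_apply [simp]: "stop a y t = y (max 0 (min a t))"
proof -
  have "continuous_on UNIV (\<lambda>t. y (max 0 (min a t)))"
    by (rule continuous_on_compose2[where g = "apply_bcontfun y" and t = UNIV])
       (auto intro!: continuous_intros)
  moreover have "bounded (range (\<lambda>t. y (max 0 (min a t))))"
    by (rule bounded_subset[OF bounded_apply_bcontfun[of y]]) auto
  ultimately have "(\<lambda>t. y (max 0 (min a t))) \<in> bcontfun"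
    by (simp add: bcontfun_def)
  then show ?thesis
    by (simp add: stop_def Bcontfun_inverse)
qed

definition curves :: "real \<Rightarrow> 'd::finite curve set" where
  "curves a = {y. stop a y = y}"

text \<open>
  The space \<open>\<P>\<close>: the pair \<open>(a, y)\<close> stands for \<open>y\<^bsub>[0,a]\<^esub>\<close>, and \<open>(T, y)\<close> for the stopped path
  on \<open>[0,T]\<close>. The metric \<open>\<bar>b - a\<bar> + \<parallel>y - z\<parallel>\<close> induces the product topology used below.
\<close>

definition paths :: "real \<Rightarrow> (real \<times> 'd::finite curve) set" where
  "paths T = {(a, y). 0 \<le> a \<and> a \<le> T \<and> y \<in> curves a}"

type_synonym 'd vfield = "real \<times> 'd curve \<Rightarrow> real ^ 'd"

definition strongly_lipschitz :: "real \<Rightarrow> 'd::finite vfield \<Rightarrow> bool" where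
  "strongly_lipschitz T V \<longleftrightarrow>
    (\<exists>\<kappa>>0. \<forall>(a, y) \<in> paths T. \<forall>(b, z) \<in> paths T. norm (V (a, y) - V (b, z)) \<le> \<kappa> * norm (y - z))"

text \<open>
  \<open>frechet_deriv T F D\<close>: \<open>F\<close> is of class \<open>\<C>\<^sup>1\<close> with derivative \<open>D\<close>. A continuous linear map on
  \<open>\<C>([0,a],\<real>\<^sup>d)\<close> is represented by its composition with the norm-one projection \<open>stop a\<close>; this
  makes \<open>D\<close> unique on \<open>paths T\<close> and its operator norm that over \<open>\<C>([0,a],\<real>\<^sup>d)\<close>.
\<close>

definition frechet_deriv ::
  "real \<Rightarrow> (real \<times> 'd::finite curve \<Rightarrow> 'e::banach) \<Rightarrow> (real \<times> 'd curve \<Rightarrow> 'd curve \<Rightarrow>\<^sub>L 'e) \<Rightarrow> bool"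
where
  "frechet_deriv T F D \<longleftrightarrow>
    (\<forall>a\<in>{0..T}.
      (\<forall>y\<in>curves a. ((\<lambda>z. F (a, z)) has_derivative blinfun_apply (D (a, y))) (at y within curves a)
        \<and> (\<forall>z. blinfun_apply (D (a, y)) z = blinfun_apply (D (a, y)) (stop a z))) \<and>
      continuous_on (curves a) (\<lambda>y. D (a, y)))"

text \<open>
  \<open>fine_deriv T F D\<close>: \<open>F\<close> is finely-\<open>\<C>\<^sup>1\<close> with fine derivative \<open>D\<close>. Linear maps on \<open>\<P>\<close> refer to
  the linear structure given by the stopped paths on \<open>[0,T]\<close>, so \<open>L(\<P>,E)\<close> is the Banach space
  \<open>L(\<C>([0,T],\<real>\<^sup>d),E)\<close>, encoded through \<open>stop T\<close> as above. For \<open>a = 0\<close> the derivative \<open>y'\<close> is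
  unconstrained, in accordance with \<open>\<C>\<^sup>1([0,0],\<real>\<^sup>d) = \<real>\<^sup>d \<times> \<real>\<^sup>d\<close>. The formula determines \<open>D\<close> at
  \<open>y\<close> only in the direction of the derivative of \<open>y\<close>, so fine derivatives need not be unique.
\<close>

definition fine_deriv ::
  "real \<Rightarrow> (real \<times> 'd::finite curve \<Rightarrow> 'e::banach) \<Rightarrow> (real \<times> 'd curve \<Rightarrow> 'd curve \<Rightarrow>\<^sub>L 'e) \<Rightarrow> bool"
where
  "fine_deriv T F D \<longleftrightarrow>
    continuous_on (paths T) D \<and>
    (\<forall>x\<in>paths T. \<forall>z. blinfun_apply (D x) z = blinfun_apply (D x) (stop T z)) \<and>
    (\<forall>a\<in>{0..T}. \<forall>y\<in>curves a. \<forall>y'\<in>curves a.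
      (\<forall>r\<in>{0..a}. (apply_bcontfun y has_vector_derivative apply_bcontfun y' r) (at r within {0..a})) \<longrightarrow>
      ((\<lambda>r. blinfun_apply (D (r, stop r y)) (stop r y')) has_integral (F (a, y) - F (0, stop 0 y))) {0..a})"

text \<open>
  Norms take values in \<open>[0,\<infinity>]\<close> and are infinite when the required derivatives do not exist.
  The infimum over Frechet derivatives is over a single value. As fine derivatives are not unique,
  the infimum over them is the seminorm of the best choice: it is finite if and only if some choice
  is bounded, and it tends to \<open>0\<close> if and only if suitable choices do.
\<close>

definition unorm :: "real \<Rightarrow> (real \<times> 'd::finite curve \<Rightarrow> 'e::banach) \<Rightarrow> ennreal" where
  "unorm T F = (SUP x\<in>paths T. ennreal (norm (F x)))"

definition C1_norm :: "real \<Rightarrow> (real \<times> 'd::finite curve \<Rightarrow> 'e::banach) \<Rightarrow> ennreal" where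
  "C1_norm T F = (INF D\<in>{D. frechet_deriv T F D}. unorm T F + unorm T D)"

definition C2_norm :: "real \<Rightarrow> (real \<times> 'd::finite curve \<Rightarrow> 'e::banach) \<Rightarrow> ennreal" where
  "C2_norm T F =
    (INF (D1, D2)\<in>{(D1, D2). frechet_deriv T F D1 \<and> frechet_deriv T D1 D2}.
      unorm T F + unorm T D1 + unorm T D2)"

text \<open>
  \<open>fine3_norm\<close>, \<open>fine2_norm\<close> and \<open>fine1_norm\<close> are, for \<open>k = 0, 1, 2\<close> respectively, the sum of the
  fine \<open>\<C>\<^bsup>3-k\<^esup>\<close> norm of \<open>F\<close> and of the Frechet \<open>\<C>\<^sup>1\<close> norm of its fine derivative of order \<open>2-k\<close>.
  Each is applied below to the Frechet derivative of order \<open>k\<close> of a vector field. The types of the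
  derivatives grow with the order, which rules out a recursive definition.
\<close>

definition fine3_norm :: "real \<Rightarrow> (real \<times> 'd::finite curve \<Rightarrow> 'e::banach) \<Rightarrow> ennreal" where
  "fine3_norm T F =
    (INF (A1, A2, A3)\<in>{(A1, A2, A3). fine_deriv T F A1 \<and> fine_deriv T A1 A2 \<and> fine_deriv T A2 A3}.
      (unorm T F + unorm T A1 + unorm T A2 + unorm T A3) + C1_norm T A2)"

definition fine2_norm :: "real \<Rightarrow> (real \<times> 'd::finite curve \<Rightarrow> 'e::banach) \<Rightarrow> ennreal" where
  "fine2_norm T F =
    (INF (A1, A2)\<in>{(A1, A2). fine_deriv T F A1 \<and> fine_deriv T A1 A2}.
      (unorm T F + unorm T A1 + unorm T A2) + C1_norm T A1)"

definition fine1_norm :: "real \<Rightarrow> (real \<times> 'd::finite curve \<Rightarrow> 'e::banach) \<Rightarrow> ennreal" where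
  "fine1_norm T F =
    (INF A1\<in>{A1. fine_deriv T F A1}. (unorm T F + unorm T A1) + C1_norm T F)"

text \<open>
  The Frechet derivative of \<open>V\<close> at \<open>y\<^bsub>[0,a]\<^esub>\<close> is a linear map on \<open>\<C>([0,a],\<real>\<^sup>d)\<close> only. To be finely
  differentiated it has to take values in the fixed space \<open>L(\<P>,\<real>\<^sup>d)\<close>. A strongly Lipschitz \<open>V\<close>
  satisfies \<open>V (a, y) = V (T, y)\<close>, so the derivative of \<open>V\<close> on \<open>\<C>([0,T],\<real>\<^sup>d)\<close> at the stopped path
  extends the one on \<open>\<C>([0,a],\<real>\<^sup>d)\<close>; likewise for the second derivative.
\<close>

definition extend :: "real \<Rightarrow> (real \<times> 'd::finite curve \<Rightarrow> 'e) \<Rightarrow> (real \<times> 'd curve \<Rightarrow> 'e)" where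
  "extend T D = (\<lambda>(a, y). D (T, y))"

definition rough_norm :: "real \<Rightarrow> 'd::finite vfield \<Rightarrow> ennreal" where
  "rough_norm T V =
    (INF (D1, D2)\<in>{(D1, D2). frechet_deriv T V D1 \<and> frechet_deriv T D1 D2}.
      fine3_norm T V + fine2_norm T (extend T D1) + fine1_norm T (extend T D2))"

definition lie_prod :: "'d::finite vfield \<Rightarrow> 'd vfield \<Rightarrow> 'd vfield" where
  "lie_prod V W = (\<lambda>(a, y).
    vector_derivative (\<lambda>\<epsilon>::real. W (a, y + \<epsilon> *\<^sub>R const_bcontfun (V (a, y)))) (at 0))"

definition lie_bracket :: "'d::finite vfield \<Rightarrow> 'd vfield \<Rightarrow> 'd vfield" where
  "lie_bracket V W = (\<lambda>x. lie_prod V W x - lie_prod W V x)"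

definition tensor :: "real ^ 'l \<Rightarrow> real ^ 'l \<Rightarrow> real ^ 'l ^ 'l" where
  "tensor u v = (\<chi> j k. u $ j * v $ k)"

text \<open>Two-parameter objects take the later time first: \<open>X t s\<close> is \<open>X\<^bsub>ts\<^esub>\<close>.\<close>

definition rough_path ::
  "real \<Rightarrow> real \<Rightarrow> (real \<Rightarrow> real \<Rightarrow> real ^ 'l::finite) \<Rightarrow> (real \<Rightarrow> real \<Rightarrow> real ^ 'l ^ 'l) \<Rightarrow> bool"
where
  "rough_path T p X XX \<longleftrightarrow>
    (\<forall>s u t. 0 \<le> s \<and> s \<le> u \<and> u \<le> t \<and> t \<le> T \<longrightarrow>
      X t s = X u s + X t u \<and> XX t s = XX u s + XX t u + tensor (X u s) (X t u)) \<and>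
    (\<forall>s t. 0 \<le> s \<and> s \<le> t \<and> t \<le> T \<longrightarrow>
      (1/2) *\<^sub>R (XX t s + transpose (XX t s)) = (1/2) *\<^sub>R tensor (X t s) (X t s)) \<and>
    (\<exists>C. \<forall>s t. 0 \<le> s \<and> s \<le> t \<and> t \<le> T \<longrightarrow>
      norm (X t s) \<le> C * \<bar>t - s\<bar> powr (1 / p) \<and> norm (XX t s) \<le> C * \<bar>t - s\<bar> powr (2 / p))"

definition holder :: "real \<Rightarrow> real \<Rightarrow> (real \<Rightarrow> real) \<Rightarrow> bool" where
  "holder T \<alpha> h \<longleftrightarrow>
    (\<exists>C. \<forall>s\<in>{0..T}. \<forall>t\<in>{0..T}. \<bar>h t - h s\<bar> \<le> C * \<bar>t - s\<bar> powr \<alpha>)"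

definition driving_field ::
  "(real \<Rightarrow> real) \<Rightarrow> (real \<Rightarrow> real \<Rightarrow> real ^ 'l::finite) \<Rightarrow> (real \<Rightarrow> real \<Rightarrow> real ^ 'l ^ 'l) \<Rightarrow>
    'd::finite vfield \<Rightarrow> ('l \<Rightarrow> 'd vfield) \<Rightarrow> real \<Rightarrow> real \<Rightarrow> 'd vfield"
where
  "driving_field h X XX V F t s = (\<lambda>x.
    (h t - h s) *\<^sub>R V x + (\<Sum>i\<in>UNIV. X t s $ i *\<^sub>R F i x)
      + (1/2) *\<^sub>R (\<Sum>j\<in>UNIV. \<Sum>k\<in>UNIV. XX t s $ j $ k *\<^sub>R lie_bracket (F j) (F k) x))"

text \<open>
  The ordinary differential equation runs over \<open>[0,1]\<close> whatever \<open>T\<close> is. Its right-hand side is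
  evaluated inside \<open>paths T\<close> only if \<open>1 \<le> T\<close>.
\<close>

definition solves_path_ode :: "'d::finite vfield \<Rightarrow> real ^ 'd \<Rightarrow> 'd curve \<Rightarrow> bool" where
  "solves_path_ode W x y \<longleftrightarrow> y \<in> curves 1 \<and> apply_bcontfun y 0 = x \<and>
    (\<forall>u\<in>{0..1}. (apply_bcontfun y has_vector_derivative W (u, stop u y)) (at u within {0..1}))"

definition time_one_map :: "'d::finite vfield \<Rightarrow> real ^ 'd \<Rightarrow> real ^ 'd" where
  "time_one_map W x = apply_bcontfun (THE y. solves_path_ode W x y) 1"

definition flow :: "real \<Rightarrow> (real \<Rightarrow> real \<Rightarrow> 'a \<Rightarrow> 'a) \<Rightarrow> bool" where
  "flow T \<phi> \<longleftrightarrow>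
    (\<forall>s u t. 0 \<le> s \<and> s \<le> u \<and> u \<le> t \<and> t \<le> T \<longrightarrow> \<phi> t u \<circ> \<phi> u s = \<phi> t s)"

text \<open>
  The definition concerns one driving signal, for which the demand that \<open>\<gamma>\<close> be independent of it is
  void. Any \<open>\<gamma> > 1\<close> is allowed.
\<close>

definition solution_flow ::
  "real \<Rightarrow> (real \<Rightarrow> real) \<Rightarrow> (real \<Rightarrow> real \<Rightarrow> real ^ 'l::finite) \<Rightarrow> (real \<Rightarrow> real \<Rightarrow> real ^ 'l ^ 'l) \<Rightarrow>
    'd::finite vfield \<Rightarrow> ('l \<Rightarrow> 'd vfield) \<Rightarrow> (real \<Rightarrow> real \<Rightarrow> real ^ 'd \<Rightarrow> real ^ 'd) \<Rightarrow> bool"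
where
  "solution_flow T h X XX V F \<phi> \<longleftrightarrow> flow T \<phi> \<and>
    (\<exists>\<gamma>>1. \<exists>\<delta>>0. \<exists>c>0. \<forall>s t. 0 \<le> s \<and> s \<le> t \<and> t \<le> T \<and> t - s \<le> \<delta> \<longrightarrow>
      (\<forall>x. norm (\<phi> t s x - time_one_map (driving_field h X XX V F t s) x) \<le> c * \<bar>t - s\<bar> powr \<gamma>))"

definition H1 :: "real \<Rightarrow> 'd::finite vfield \<Rightarrow> ('l \<Rightarrow> 'd vfield) \<Rightarrow> bool" where
  "H1 T V F \<longleftrightarrow> strongly_lipschitz T V \<and> C2_norm T V < \<infinity> \<and>
    (\<forall>i. strongly_lipschitz T (F i) \<and> rough_norm T (F i) < \<infinity>)"

definition markovian :: "real \<Rightarrow> 'd::finite vfield \<Rightarrow> bool" where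
  "markovian T V \<longleftrightarrow>
    (\<forall>u\<in>{0..T}. \<forall>y\<in>curves u. \<forall>z\<in>curves u. apply_bcontfun y u = apply_bcontfun z u \<longrightarrow> V (u, y) = V (u, z))"

end

theory Submission
  imports Defs
begin

text \<open>
  Expanding the path-dependent differential equation shows that its time-one map is, up to an error
  \<open>O(\<bar>t - s\<bar>\<^sup>\<gamma>)\<close> with \<open>\<gamma> > 1\<close>, an explicit local map that only involves the fields and their Frechet
  derivatives at constant curves. The composition defect of the local maps is of the same order, up
  to a quadratic expression in the increments of the path whose coefficients measure how the fields
  depend on the starting point of their argument. If a solution flow exists, that expression is
  itself \<open>O(\<bar>t - s\<bar>\<^sup>\<gamma>)\<close>, with constants that are uniform in the fields because the coefficients range
  over a finite-dimensional space. Halving the interval repeatedly then bounds the distance of the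
  solution flow to the local maps by a constant that does not depend on \<open>\<lambda>\<close>.

  In the Markovian limit the quadratic expression vanishes, the local maps are those of Davie's
  scheme, and their composition defect is also small in the Lipschitz norm; hence dyadic compositions of
  them are Lipschitz uniformly in the number of factors. Comparing both flows with such compositions,
  only finitely many factors matter for a given accuracy, and on each factor the local maps converge
  uniformly.
\<close>

subsection \<open>Stopped curves\<close>

text \<open>The obstacle is that each time-one map restarts from a constant curve and forgets the
  past: the differential equation sees \<open>DF\<close> along a ramp, whereas Chen's relation calls
  for half of \<open>DF\<close> along a constant curve. The mismatch is quadratic in the increments
  of \<open>X\<close>, of order |t-s|^(2/p) with 2/p at most 1, too large to be summed over a
  partition. Moreover \<open>solution_flow\<close> grants every flow its own exponent, range and
  constant. What rescues uniformity is that the set of coefficient tensors for which the mismatch is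
  small depends on the signal alone. The comparison of the flows is asymmetric: closeness to the
  local maps in the supremum norm is shown for all flows, but the Lipschitz bound on the composition
  defect for the limit only, so the local maps of the limit are the ones that are composed. With n
  halvings the error is of order \<rho>^n plus (2+\<kappa>)^n \<eta>, where \<eta> is the distance
  between the local maps: n is chosen first, then \<eta>.\<close>

lemma stop_add: "stop a (y + z) = stop a y + stop a z"
  and stop_diff: "stop a (y - z) = stop a y - stop a z"
  and stop_scaleR: "stop a (c *\<^sub>R y) = c *\<^sub>R stop a y"
  and stop_const [simp]: "stop a (const_bcontfun x) = const_bcontfun x"
  for y z :: "real \<Rightarrow>\<^sub>C 'a::real_normed_vector"
  by (rule bcontfun_eqI, simp add: const_bcontfun.rep_eq)+

lemma norm_stop_le: "norm (stop a y) \<le> norm y"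
  for y :: "real \<Rightarrow>\<^sub>C 'a::real_normed_vector"
  by (rule norm_bound) (simp add: norm_bounded)

lemma bounded_linear_stop: "bounded_linear (stop a :: (real \<Rightarrow>\<^sub>C 'a::real_normed_vector) \<Rightarrow> _)"
  by (rule bounded_linear_intro[where K = 1]) (simp_all add: stop_add stop_scaleR norm_stop_le)

lemma norm_const_bcontfun [simp]:
  "norm (const_bcontfun x :: 'b::topological_space \<Rightarrow>\<^sub>C 'a::real_normed_vector) = norm x"
proof (rule antisym)
  show "norm (const_bcontfun x :: 'b \<Rightarrow>\<^sub>C 'a) \<le> norm x"
    by (rule norm_bound) (simp add: const_bcontfun.rep_eq)
  show "norm x \<le> norm (const_bcontfun x :: 'b \<Rightarrow>\<^sub>C 'a)"
    using norm_bounded[of "const_bcontfun x :: 'b \<Rightarrow>\<^sub>C 'a" undefined]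
    by (simp add: const_bcontfun.rep_eq)
qed

lemma const_bcontfun_add: "const_bcontfun (x + y) = const_bcontfun x + const_bcontfun y"
  and const_bcontfun_diff: "const_bcontfun (x - y) = const_bcontfun x - const_bcontfun y"
  and const_bcontfun_scaleR: "const_bcontfun (c *\<^sub>R x) = c *\<^sub>R const_bcontfun x"
  for x y :: "'a::real_normed_vector"
  by (rule bcontfun_eqI, simp add: const_bcontfun.rep_eq)+

lemma bounded_linear_const_bcontfun:
  "bounded_linear (const_bcontfun :: 'a::real_normed_vector \<Rightarrow> ('b::topological_space \<Rightarrow>\<^sub>C 'a))"
  by (rule bounded_linear_intro[where K = 1])
    (simp_all add: const_bcontfun_add const_bcontfun_scaleR)

lemma stop_stop: "0 \<le> a \<Longrightarrow> 0 \<le> b \<Longrightarrow> stop a (stop b y) = stop (min a b) y"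
  by (rule bcontfun_eqI) (auto simp: min_def max_def)

lemma stop_in_curves [simp]: "0 \<le> a \<Longrightarrow> stop a y \<in> curves a"
  by (simp add: curves_def stop_stop)

lemma const_in_curves [simp]: "const_bcontfun x \<in> curves a"
  by (simp add: curves_def)

lemma curves_mono: "y \<in> curves a \<Longrightarrow> 0 \<le> a \<Longrightarrow> a \<le> b \<Longrightarrow> y \<in> curves b"
  unfolding curves_def using stop_stop[of b a y] by (simp add: min_def split: if_splits)

lemma curves_add: "y \<in> curves a \<Longrightarrow> z \<in> curves a \<Longrightarrow> y + z \<in> curves a"
  and curves_scaleR: "y \<in> curves a \<Longrightarrow> c *\<^sub>R y \<in> curves a"
  by (simp_all add: curves_def stop_add stop_scaleR)

lemma continuous_on_stop: "continuous_on {0..b} (\<lambda>u. stop u y)"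
  for y :: "real \<Rightarrow>\<^sub>C 'a::real_normed_vector"
  unfolding continuous_on_iff
proof (intro ballI allI impI)
  fix u \<epsilon> :: real assume u: "u \<in> {0..b}" and \<epsilon>: "0 < \<epsilon>"
  have "uniformly_continuous_on {0..b} (apply_bcontfun y)"
    by (rule compact_uniformly_continuous) auto
  then obtain d where d: "d > 0"
    "\<And>s t. s \<in> {0..b} \<Longrightarrow> t \<in> {0..b} \<Longrightarrow> dist t s < d \<Longrightarrow> dist (y t) (y s) < \<epsilon> / 2"
    using \<epsilon> unfolding uniformly_continuous_on_def by (metis half_gt_zero)
  show "\<exists>d>0. \<forall>v\<in>{0..b}. dist v u < d \<longrightarrow> dist (stop v y) (stop u y) < \<epsilon>"
  proof (intro exI conjI ballI impI)
    fix v assume v: "v \<in> {0..b}" "dist v u < d"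
    have "dist (stop v y) (stop u y) \<le> \<epsilon> / 2"
    proof (rule dist_bound)
      fix t
      have "dist (y (max 0 (min v t))) (y (max 0 (min u t))) < \<epsilon> / 2"
        using u v by (intro d(2)) (auto simp: dist_real_def min_def max_def)
      then show "dist (stop v y t) (stop u y t) \<le> \<epsilon> / 2" by simp
    qed
    then show "dist (stop v y) (stop u y) < \<epsilon>" using \<epsilon> by simp
  qed (fact d(1))
qed

subsection \<open>Path-dependent differential equations\<close>

text \<open>Clamping the time to [0,1] makes every image constant outside that interval. The fixed
  point can therefore be sought in the whole complete space of bounded continuous functions and lies
  in \<open>curves 1\<close> by itself.\<close>

definition picard :: "('d::finite curve \<Rightarrow> real ^ 'd) \<Rightarrow> real ^ 'd \<Rightarrow> 'd curve \<Rightarrow> 'd curve" where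
  "picard W x y = Bcontfun (\<lambda>t. x + integral {0..max 0 (min 1 t)} (\<lambda>r. W (stop r y)))"

text \<open>Over a time interval of length 1 the Lipschitz constant of the field is a contraction
  factor of the Picard map, so the value 1/2 allows a single application of Banach's fixed point
  theorem. Small increments of the signal provide it.\<close>

locale contracting_field =
  fixes W :: "'d::finite curve \<Rightarrow> real ^ 'd"
  assumes contracting: "norm (W y - W z) \<le> 1 / 2 * norm (y - z)"
begin

lemma continuous_on_W: "continuous_on S W"
  by (rule lipschitz_on_continuous_on[where L = "1/2"])
    (auto simp: lipschitz_on_def dist_norm contracting[simplified])

lemma continuous_on_along: "continuous_on {0..b} (\<lambda>r. W (stop r y))"
  by (rule continuous_on_compose2[OF continuous_on_W[of UNIV] continuous_on_stop]) auto

lemma integrable_along: "u \<le> b \<Longrightarrow> (\<lambda>r. W (stop r y)) integrable_on {0..u}"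
  by (rule integrable_continuous_interval) (rule continuous_on_along)

lemma picard_apply:
  "picard W x y t = x + integral {0..max 0 (min 1 t)} (\<lambda>r. W (stop r y))"
proof -
  let ?I = "\<lambda>u. integral {0..u} (\<lambda>r. W (stop r y))"
  have c: "continuous_on {0..1} ?I"
    by (rule indefinite_integral_continuous_1) (rule integrable_along[of 1 1], simp)
  have "continuous_on UNIV (\<lambda>t. x + ?I (max 0 (min 1 t)))"
    by (intro continuous_intros continuous_on_compose2[OF c]) auto
  moreover have "bounded (range (\<lambda>t. x + ?I (max 0 (min 1 t))))"
    by (rule bounded_subset[of "(\<lambda>u. x + ?I u) ` {0..1}"])
      (auto intro!: compact_imp_bounded compact_continuous_image continuous_intros c)
  ultimately show ?thesis
    by (simp add: picard_def Bcontfun_inverse bcontfun_def)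
qed

lemma picard_fixed_point: "\<exists>!y. picard W x y = y"
proof (rule banach_fix_type[of "1/2"])
  show "\<forall>y z. dist (picard W x y) (picard W x z) \<le> 1 / 2 * dist y z"
  proof (intro allI)
    fix y z
    show "dist (picard W x y) (picard W x z) \<le> 1 / 2 * dist y z"
    proof (rule dist_bound)
      fix t :: real
      define u where "u = max 0 (min 1 t)"
      have u: "0 \<le> u" "u \<le> 1" by (auto simp: u_def)
      have "norm (W (stop r y) - W (stop r z)) \<le> 1 / 2 * norm (y - z)" for r
        using contracting[of "stop r y" "stop r z"] norm_stop_le[of r "y - z"]
        by (simp add: stop_diff)
      then have "norm (integral {0..u} (\<lambda>r. W (stop r y) - W (stop r z))) \<le> 1/2 * norm (y - z) * (u - 0)"
        by (intro integral_bound[OF u(1)]) (auto intro!: continuous_intros continuous_on_along)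
      also have "\<dots> \<le> 1/2 * norm (y - z) * 1"
        using u by (intro mult_left_mono) auto
      finally have "norm (integral {0..u} (\<lambda>r. W (stop r y)) - integral {0..u} (\<lambda>r. W (stop r z)))
        \<le> 1/2 * norm (y - z)"
        by (simp add: Henstock_Kurzweil_Integration.integral_diff[OF integrable_along[of u u] integrable_along[of u u]])
      then show "dist (picard W x y t) (picard W x z t) \<le> 1 / 2 * dist y z"
        by (simp add: picard_apply dist_norm u_def)
    qed
  qed
qed simp_all

text \<open>Agreement of \<open>G\<close> and \<open>W\<close> on curves stopped at times in [0,1]
  is how a field on \<open>paths T\<close> gets replaced by a map of the curve alone.\<close>

lemma picard_fixed_point_iff:
  assumes G: "\<And>u y. u \<in> {0..1} \<Longrightarrow> y \<in> curves u \<Longrightarrow> G (u, y) = W y"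
  shows "solves_path_ode G x y \<longleftrightarrow> picard W x y = y"
proof
  assume s: "solves_path_ode G x y"
  then have y: "y \<in> curves 1" "y 0 = x"
    and d: "\<And>u. u \<in> {0..1} \<Longrightarrow> (y has_vector_derivative W (stop u y)) (at u within {0..1})"
    by (auto simp: solves_path_ode_def G)
  show "picard W x y = y"
  proof (rule bcontfun_eqI)
    fix t :: real
    define u where "u = max 0 (min 1 t)"
    have u: "0 \<le> u" "u \<le> 1" by (auto simp: u_def)
    have "((\<lambda>r. W (stop r y)) has_integral (y u - y 0)) {0..u}"
      using u by (intro fundamental_theorem_of_calculus)
        (auto intro: has_vector_derivative_within_subset[OF d])
    moreover have "y u = y t"
      using y(1) stop_apply[of 1 y t] by (simp add: curves_def u_def)
    ultimately show "picard W x y t = y t"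
      by (simp add: picard_apply u_def[symmetric] y(2) integral_unique)
  qed
next
  assume fix1: "picard W x y = y"
  have y: "y t = x + integral {0..max 0 (min 1 t)} (\<lambda>r. W (stop r y))" for t
    by (subst fix1[symmetric]) (rule picard_apply)
  have "stop 1 y t = y t" for t
    unfolding stop_apply by (subst (1 2) y) simp
  then have "y \<in> curves 1"
    by (simp add: curves_def bcontfun_eqI)
  moreover have "y 0 = x" by (subst y) simp
  moreover have "(y has_vector_derivative G (u, stop u y)) (at u within {0..1})" if u: "u \<in> {0..1}" for u
  proof -
    have "((\<lambda>t. x + integral {0..t} (\<lambda>r. W (stop r y))) has_vector_derivative (0 + W (stop u y)))
        (at u within {0..1})"
      by (intro has_vector_derivative_add has_vector_derivative_const
          integral_has_vector_derivative continuous_on_along u)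
    from u _ this have "(y has_vector_derivative (0 + W (stop u y))) (at u within {0..1})"
    proof (rule has_vector_derivative_transform)
      fix t :: real assume "t \<in> {0..1}"
      then show "y t = x + integral {0..t} (\<lambda>r. W (stop r y))"
        by (subst y) simp
    qed
    then show ?thesis
      using u by (simp add: G)
  qed
  ultimately show "solves_path_ode G x y" by (simp add: solves_path_ode_def)
qed

lemma time_one_map_eq:
  assumes "\<And>u y. u \<in> {0..1} \<Longrightarrow> y \<in> curves u \<Longrightarrow> G (u, y) = W y"
  obtains y where "solves_path_ode G x y" "picard W x y = y" "time_one_map G x = y 1"
proof -
  have eq: "solves_path_ode G x y \<longleftrightarrow> picard W x y = y" for y
    by (rule picard_fixed_point_iff) (rule assms)
  have "\<exists>!y. solves_path_ode G x y"
    unfolding eq by (rule picard_fixed_point)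
  then have "solves_path_ode G x (THE y. solves_path_ode G x y)" by (rule theI')
  then show ?thesis
    using that eq by (auto simp: time_one_map_def)
qed

end

subsection \<open>Bounded Lipschitz maps and second differences\<close>

definition bdd_lip :: "real \<Rightarrow> ('a::real_normed_vector \<Rightarrow> 'b::real_normed_vector) \<Rightarrow> bool" where
  "bdd_lip K q \<longleftrightarrow> (\<forall>x. norm (q x) \<le> K) \<and> (\<forall>x y. norm (q x - q y) \<le> K * norm (x - y))"

text \<open>The quantitative form of \<open>C\<^sup>1\<^sup>,\<^sup>1\<close> regularity that survives sums, products and compositions
  without referring to derivatives.\<close>

definition second_diff :: "real \<Rightarrow> ('a::real_normed_vector \<Rightarrow> 'b::real_normed_vector) \<Rightarrow> bool" where
  "second_diff K q \<longleftrightarrow> (\<forall>a b a' b'. norm (q a - q b - (q a' - q b'))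
     \<le> K * (norm (a - b - (a' - b')) + (norm (a - b) + norm (a' - b')) * (norm (a - a') + norm (b - b'))))"

lemma bdd_lipD:
  assumes "bdd_lip K q"
  shows "norm (q x) \<le> K" "norm (q x - q y) \<le> K * norm (x - y)"
  using assms by (auto simp: bdd_lip_def)

lemma second_diffD:
  "second_diff K q \<Longrightarrow> norm (q a - q b - (q a' - q b'))
     \<le> K * (norm (a - b - (a' - b')) + (norm (a - b) + norm (a' - b')) * (norm (a - a') + norm (b - b')))"
  by (auto simp: second_diff_def)

lemma bdd_lip_nonneg: "bdd_lip K q \<Longrightarrow> 0 \<le> K"
  using bdd_lipD(1) norm_ge_zero order_trans by blast

lemma bdd_lip_mono:
  assumes "bdd_lip K q" "K \<le> L" shows "bdd_lip L q"
  unfolding bdd_lip_def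
proof (intro conjI allI)
  fix x y
  show "norm (q x) \<le> L" using bdd_lipD(1)[OF assms(1), of x] assms(2) by linarith
  show "norm (q x - q y) \<le> L * norm (x - y)"
    using bdd_lipD(2)[OF assms(1), of x y] mult_right_mono[OF assms(2), of "norm (x - y)"] by simp
qed

lemma second_diff_mono:
  assumes "second_diff K q" "K \<le> L" shows "second_diff L q"
  unfolding second_diff_def
  by (intro allI order_trans[OF second_diffD[OF assms(1)]] mult_right_mono assms(2)) simp

lemma bdd_lip_add:
  assumes "bdd_lip K q" "bdd_lip L r" shows "bdd_lip (K + L) (\<lambda>x. q x + r x)"
  unfolding bdd_lip_def
proof (intro conjI allI)
  fix x y
  show "norm (q x + r x) \<le> K + L"
    by (intro norm_triangle_mono bdd_lipD[OF assms(1)] bdd_lipD[OF assms(2)])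
  have "norm ((q x - q y) + (r x - r y)) \<le> K * norm (x - y) + L * norm (x - y)"
    by (intro norm_triangle_mono bdd_lipD[OF assms(1)] bdd_lipD[OF assms(2)])
  then show "norm (q x + r x - (q y + r y)) \<le> (K + L) * norm (x - y)"
    by (simp add: algebra_simps)
qed

lemma bdd_lip_scaleR:
  assumes "bdd_lip K q" shows "bdd_lip (\<bar>c\<bar> * K) (\<lambda>x. c *\<^sub>R q x)"
  using assms unfolding bdd_lip_def
  by (auto simp: scaleR_diff_right[symmetric] mult.assoc intro: mult_left_mono)

lemma bdd_lip_zero: "bdd_lip 0 (\<lambda>x. 0)"
  by (simp add: bdd_lip_def)

lemma bdd_lip_sum:
  assumes "finite I" "\<And>i. i \<in> I \<Longrightarrow> bdd_lip (K i) (q i)"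
  shows "bdd_lip (\<Sum>i\<in>I. K i) (\<lambda>x. \<Sum>i\<in>I. q i x)"
  using assms by (induction I) (auto simp: bdd_lip_zero bdd_lip_add)

lemma second_diff_add:
  fixes q r :: "'a::real_normed_vector \<Rightarrow> 'b::real_normed_vector"
  assumes "second_diff K q" "second_diff L r" shows "second_diff (K + L) (\<lambda>x. q x + r x)"
  unfolding second_diff_def
proof (intro allI)
  fix a b a' b' :: 'a
  have "q a + r a - (q b + r b) - (q a' + r a' - (q b' + r b'))
      = (q a - q b - (q a' - q b')) + (r a - r b - (r a' - r b'))" by simp
  then show "norm (q a + r a - (q b + r b) - (q a' + r a' - (q b' + r b'))) \<le> (K + L) *
      (norm (a - b - (a' - b')) + (norm (a - b) + norm (a' - b')) * (norm (a - a') + norm (b - b')))"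
    using norm_triangle_mono[OF second_diffD[OF assms(1)] second_diffD[OF assms(2)]]
    by (metis distrib_right)
qed

lemma second_diff_scaleR:
  assumes "second_diff K q" shows "second_diff (\<bar>c\<bar> * K) (\<lambda>x. c *\<^sub>R q x)"
  unfolding second_diff_def scaleR_diff_right[symmetric] norm_scaleR mult.assoc
  by (intro allI mult_left_mono second_diffD[OF assms]) simp

lemma second_diff_sum:
  assumes "finite I" "\<And>i. i \<in> I \<Longrightarrow> second_diff (K i) (q i)"
  shows "second_diff (\<Sum>i\<in>I. K i) (\<lambda>x. \<Sum>i\<in>I. q i x)"
  using assms by (induction I) (auto simp: second_diff_add second_diff_def[of 0])

lemma bdd_lip_blinfun_apply:
  assumes M: "bdd_lip K M" and u: "bdd_lip L u"
  shows "bdd_lip (2 * K * L) (\<lambda>x. blinfun_apply (M x) (u x))"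
  unfolding bdd_lip_def
proof (intro conjI allI)
  note [simp] = bdd_lip_nonneg[OF M] bdd_lip_nonneg[OF u]
  have KL: "0 \<le> K * L" by simp
  fix x y
  have "norm (M x (u x)) \<le> K * L"
    by (rule order_trans[OF norm_blinfun mult_mono]) (auto simp: bdd_lipD(1)[OF M] bdd_lipD(1)[OF u])
  then show "norm (M x (u x)) \<le> 2 * K * L"
    using KL by linarith
  have "M x (u x) - M y (u y) = (M x - M y) (u x) + M y (u x - u y)"
    by (simp add: blinfun.bilinear_simps)
  also have "norm \<dots> \<le> (K * norm (x - y)) * L + K * (L * norm (x - y))"
    by (intro norm_triangle_le add_mono order_trans[OF norm_blinfun mult_mono])
      (auto simp: bdd_lipD[OF M] bdd_lipD[OF u])
  finally show "norm (M x (u x) - M y (u y)) \<le> 2 * K * L * norm (x - y)"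
    by (simp add: algebra_simps)
qed

text \<open>A discrete Leibniz rule: two terms carry a second difference of one factor, the other
  two a first difference along a side (\<open>a - b\<close> or \<open>a' - b'\<close>) times a first
  difference across (\<open>a - a'\<close> or \<open>b - b'\<close>). The latter explain the product
  in the definition of \<open>second_diff\<close>.\<close>

lemma second_diff_blinfun_apply:
  fixes M :: "'a::real_normed_vector \<Rightarrow> 'b::real_normed_vector \<Rightarrow>\<^sub>L 'c::real_normed_vector"
  assumes M: "bdd_lip K M" "second_diff K M" and u: "bdd_lip L u" "second_diff L u"
  shows "second_diff (3 * K * L) (\<lambda>x. blinfun_apply (M x) (u x))"
  unfolding second_diff_def
proof (intro allI)
  fix a b a' b' :: 'a
  note K [simp] = bdd_lip_nonneg[OF M(1)] note L [simp] = bdd_lip_nonneg[OF u(1)]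
  let ?D = "norm (a - b - (a' - b'))" and ?E = "norm (a - b) + norm (a' - b')"
    and ?F = "norm (a - a') + norm (b - b')"
  have "M a (u a) - M b (u b) - (M a' (u a') - M b' (u b')) =
      (M a - M b - (M a' - M b')) (u a) + (M a' - M b') (u a - u a') + (M b - M b') (u a - u b)
      + M b' (u a - u b - (u a' - u b'))"
    by (simp add: blinfun.bilinear_simps)
  also have "norm \<dots> \<le> (K * (?D + ?E * ?F)) * L
      + (K * norm (a' - b')) * (L * norm (a - a')) + (K * norm (b - b')) * (L * norm (a - b))
      + K * (L * (?D + ?E * ?F))"
    by (intro norm_triangle_le add_mono order_trans[OF norm_blinfun mult_mono])
      (auto intro: bdd_lipD[OF M(1)] bdd_lipD[OF u(1)] second_diffD[OF M(2)] second_diffD[OF u(2)])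
  also have "\<dots> = K * L * (2 * (?D + ?E * ?F) + (norm (a' - b') * norm (a - a') + norm (b - b') * norm (a - b)))"
    by (simp add: algebra_simps)
  also have "\<dots> \<le> K * L * (2 * (?D + ?E * ?F) + (?D + ?E * ?F))"
    by (intro mult_left_mono add_left_mono) (auto simp: algebra_simps)
  finally show "norm (M a (u a) - M b (u b) - (M a' (u a') - M b' (u b'))) \<le> 3 * K * L * (?D + ?E * ?F)"
    by (simp add: algebra_simps)
qed

text \<open>Mean value inequality for \<open>q - Dq x\<close> on the ball of radius \<open>r\<close>
  around \<open>x\<close>, where the derivative is at most \<open>K * r\<close>. Both
  \<open>u\<close> and \<open>v\<close> are free because the Lipschitz version of the Davie estimate
  compares two displaced points.\<close>

lemma derivative_remainder_le:
  fixes q :: "'a::real_normed_vector \<Rightarrow> 'b::real_normed_vector"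
  assumes d: "\<And>x. (q has_derivative blinfun_apply (Dq x)) (at x)" and l: "bdd_lip K Dq"
    and r: "norm (u - x) \<le> r" "norm (v - x) \<le> r"
  shows "norm (q u - q v - Dq x (u - v)) \<le> K * r * norm (u - v)"
proof -
  have "norm ((q u - Dq x u) - (q v - Dq x v)) \<le> K * r * norm (u - v)"
  proof (rule differentiable_bound[of "cball x r" _ "\<lambda>z h. Dq z h - Dq x h"])
    fix z assume z: "z \<in> cball x r"
    show "((\<lambda>z. q z - Dq x z) has_derivative (\<lambda>h. Dq z h - Dq x h)) (at z within cball x r)"
      by (intro has_derivative_diff has_derivative_at_withinI[OF d]
          bounded_linear_imp_has_derivative blinfun.bounded_linear_right)
    have "onorm (\<lambda>h. Dq z h - Dq x h) = norm (Dq z - Dq x)"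
      by (simp add: norm_blinfun.rep_eq minus_blinfun.rep_eq)
    also have "\<dots> \<le> K * norm (z - x)" by (rule bdd_lipD[OF l])
    also have "\<dots> \<le> K * r"
      using z bdd_lip_nonneg[OF l] by (intro mult_left_mono) (auto simp: dist_norm norm_minus_commute)
    finally show "onorm (\<lambda>h. Dq z h - Dq x h) \<le> K * r" .
  qed (use r in \<open>auto simp: dist_norm norm_minus_commute\<close>)
  then show ?thesis by (simp add: blinfun.bilinear_simps algebra_simps)
qed

lemma norm_diff_unit_interval_le:
  fixes f :: "real \<Rightarrow> 'b::real_normed_vector"
  assumes "\<And>t. t \<in> {0..1} \<Longrightarrow> (f has_vector_derivative f' t) (at t within {0..1})"
    and "\<And>t. t \<in> {0..1} \<Longrightarrow> norm (f' t) \<le> B"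
  shows "norm (f 1 - f 0) \<le> B"
proof -
  have "norm (f 1 - f 0) \<le> B * norm (1 - 0 :: real)"
  proof (rule differentiable_bound[of "{0..1}" f "\<lambda>t h. h *\<^sub>R f' t"])
    fix t :: real assume t: "t \<in> {0..1}"
    show "(f has_derivative (\<lambda>h. h *\<^sub>R f' t)) (at t within {0..1})"
      using assms(1)[OF t] by (simp add: has_vector_derivative_def)
    show "onorm (\<lambda>h. h *\<^sub>R f' t) \<le> B"
      by (rule onorm_le) (use assms(2)[OF t] in \<open>auto simp: mult.commute[of B] intro: mult_left_mono\<close>)
  qed auto
  then show ?thesis by simp
qed

text \<open>The segments from \<open>b\<close> to \<open>a\<close> and from \<open>b'\<close> to
  \<open>a'\<close> are run through with the same parameter. The derivative of the difference is
  \<open>Dq\<close> applied to \<open>a - b - (a' - b')\<close> plus a difference of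
  \<open>Dq\<close> between two points at distance at most
  \<open>norm (a - a') + norm (b - b')\<close>.\<close>

lemma second_diff_derivative:
  fixes q :: "'a::real_normed_vector \<Rightarrow> 'b::real_normed_vector"
  assumes d: "\<And>x. (q has_derivative blinfun_apply (Dq x)) (at x)" and l: "bdd_lip K Dq"
  shows "second_diff K q"
  unfolding second_diff_def
proof (intro allI)
  fix a b a' b' :: 'a
  note K = bdd_lip_nonneg[OF l]
  let ?D = "norm (a - b - (a' - b'))" and ?E = "norm (a - b) + norm (a' - b')"
    and ?F = "norm (a - a') + norm (b - b')"
  define f where "f t = q (b + t *\<^sub>R (a - b)) - q (b' + t *\<^sub>R (a' - b'))" for t
  define f' where "f' t = Dq (b + t *\<^sub>R (a - b)) (a - b) - Dq (b' + t *\<^sub>R (a' - b')) (a' - b')" for t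
  have "norm (f 1 - f 0) \<le> K * (?D + ?E * ?F)"
  proof (rule norm_diff_unit_interval_le)
    fix t :: real assume t: "t \<in> {0..1}"
    have line: "((\<lambda>t. q (v + t *\<^sub>R w)) has_vector_derivative Dq (v + t *\<^sub>R w) w) (at t within {0..1})" for v w
    proof -
      have "((\<lambda>t. q (v + t *\<^sub>R w)) has_derivative (\<lambda>h. Dq (v + t *\<^sub>R w) (0 + h *\<^sub>R w))) (at t within {0..1})"
        by (intro has_derivative_compose[OF _ d] derivative_intros)
      then show ?thesis by (simp add: has_vector_derivative_def blinfun.scaleR_right)
    qed
    show "(f has_vector_derivative f' t) (at t within {0..1})"
      unfolding f_def f'_def by (intro has_vector_derivative_diff line)
    let ?p = "b + t *\<^sub>R (a - b)" and ?p' = "b' + t *\<^sub>R (a' - b')"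
    have "?p - ?p' = (1 - t) *\<^sub>R (b - b') + t *\<^sub>R (a - a')" by (simp add: algebra_simps)
    also have "norm \<dots> \<le> (1 - t) * norm (b - b') + t * norm (a - a')"
      using t by (intro norm_triangle_le) auto
    also have "\<dots> \<le> 1 * norm (b - b') + 1 * norm (a - a')"
      using t by (intro add_mono mult_right_mono) auto
    finally have p: "norm (?p - ?p') \<le> ?F" by simp
    have "f' t = Dq ?p (a - b - (a' - b')) + (Dq ?p - Dq ?p') (a' - b')"
      by (simp add: f'_def blinfun.bilinear_simps)
    also have "norm \<dots> \<le> K * ?D + (K * ?F) * norm (a' - b')"
      by (intro norm_triangle_le add_mono order_trans[OF norm_blinfun mult_mono]
          order_trans[OF bdd_lipD(2)[OF l] mult_left_mono[OF p]] bdd_lipD(1)[OF l])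
        (use K in auto)
    also have "\<dots> \<le> K * ?D + (K * ?F) * ?E"
      using K by (intro add_left_mono mult_left_mono) auto
    finally show "norm (f' t) \<le> K * (?D + ?E * ?F)" by (simp add: algebra_simps)
  qed
  then show "norm (q a - q b - (q a' - q b')) \<le> K * (?D + ?E * ?F)"
    by (simp add: f_def algebra_simps)
qed

subsection \<open>Remainder estimates for one step\<close>

text \<open>In the applications \<open>a\<close> and \<open>b\<close> are the powers \<open>\<bar>t - s\<bar>\<^sup>\<theta>\<close> and \<open>\<bar>t - s\<bar>\<^sup>\<beta>\<close> that
  bound the first- and second-order increments of the driving signal.\<close>

locale step_size =
  fixes A a b :: real
  assumes A: "0 \<le> A" and a: "0 \<le> a" "a \<le> 1" and b: "0 \<le> b" "b \<le> a" "a\<^sup>2 \<le> b"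
begin

text \<open>Third-order terms are measured by \<open>a * b\<close>, that is by the power \<theta> +
  \<beta> of the step, whose exponent exceeds 1.\<close>

lemma cube_le: "a ^ 3 \<le> a * b"
  using mult_left_mono[OF b(3) a(1)] by (simp add: power2_eq_square power3_eq_cube mult.assoc)

text \<open>\<open>P\<close> and \<open>R\<close> are the displacements of first and second order
  over the first subinterval, \<open>P'\<close> and \<open>R'\<close> those over the second. The
  only contribution of order \<open>a\<^sup>2\<close> is \<open>D x (P x)\<close>, which Chen's
  relation will cancel; the Taylor remainder, \<open>D x (R x)\<close> and the increment of
  \<open>R'\<close> are each of order \<open>a * b\<close>.\<close>

lemma davie_remainder:
  fixes P P' R R' :: "'a::real_normed_vector \<Rightarrow> 'a"
  assumes P: "\<And>x. norm (P x) \<le> A * a" and R: "\<And>x. norm (R x) \<le> A * b"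
    and d: "\<And>x. (P' has_derivative blinfun_apply (D x)) (at x)" and l: "bdd_lip (A * a) D"
    and R': "bdd_lip (A * b) R'"
  shows "norm (P' (x + P x + R x) - P' x - D x (P x) + (R' (x + P x + R x) - R' x))
    \<le> (4 * A ^ 3 + 3 * A\<^sup>2) * (a * b)"
proof -
  let ?k = "P x + R x"
  have k: "norm ?k \<le> 2 * A * a"
    using norm_triangle_mono[OF P R, of x x] mult_left_mono[OF b(2) A] by linarith
  have "norm (P' (x + ?k) - P' x - D x (x + ?k - x)) \<le> A * a * (2 * A * a) * norm (x + ?k - x)"
    by (rule derivative_remainder_le[OF d l]) (use k A a in auto)
  also have "\<dots> \<le> A * a * (2 * A * a) * (2 * A * a)"
    using k A a by (intro mult_left_mono) auto
  also have "\<dots> = 4 * A ^ 3 * a ^ 3" by (simp add: power3_eq_cube)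
  also have "\<dots> \<le> 4 * A ^ 3 * (a * b)" using A by (intro mult_left_mono cube_le) auto
  finally have 1: "norm (P' (x + ?k) - P' x - D x ?k) \<le> 4 * A ^ 3 * (a * b)" by simp
  have 2: "norm (D x (R x)) \<le> (A * a) * (A * b)"
    by (intro order_trans[OF norm_blinfun mult_mono] bdd_lipD[OF l] R) (use A a in auto)
  have 3: "norm (R' (x + ?k) - R' x) \<le> (A * b) * (2 * A * a)"
    using bdd_lipD(2)[OF R', of "x + ?k" x] k mult_left_mono[of _ _ "A * b"] A b
    by (smt (verit, best) add_diff_cancel_left' mult_nonneg_nonneg)
  have "P' (x + P x + R x) - P' x - D x (P x) + (R' (x + P x + R x) - R' x) =
    (P' (x + ?k) - P' x - D x ?k) + D x (R x) + (R' (x + ?k) - R' x)"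
    by (simp add: blinfun.bilinear_simps add.assoc)
  also have "norm \<dots> \<le> 4 * A ^ 3 * (a * b) + (A * a) * (A * b) + (A * b) * (2 * A * a)"
    by (intro norm_triangle_le add_mono 1 2 3)
  finally show ?thesis by (simp add: algebra_simps power2_eq_square)
qed

text \<open>The difference is split so that one thing changes at a time: the displacement at a fixed
  base point, the base point under a fixed displacement, then the terms with \<open>R\<close> and
  \<open>R'\<close>. The second piece is where second differences of \<open>D\<close> enter.\<close>

lemma davie_remainder_lipschitz:
  fixes P P' R R' :: "'a::real_normed_vector \<Rightarrow> 'a"
  assumes P: "bdd_lip (A * a) P" and R: "bdd_lip (A * b) R"
    and d: "\<And>x. (P' has_derivative blinfun_apply (D x)) (at x)" and l: "bdd_lip (A * a) D" "second_diff (A * a) D"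
    and R': "second_diff (A * b) R'"
  defines "G \<equiv> \<lambda>x. P' (x + P x + R x) - P' x - D x (P x) + (R' (x + P x + R x) - R' x)"
  shows "norm (G x - G y) \<le> (28 * A ^ 3 + 12 * A\<^sup>2) * (a * b) * norm (x - y)"
proof -
  define k where "k z = P z + R z" for z
  have "bdd_lip (A * a + A * b) k"
    unfolding k_def by (intro bdd_lip_add P R)
  then have k: "bdd_lip (2 * A * a) k"
    by (rule bdd_lip_mono) (use mult_left_mono[OF b(2) A] in linarith)
  have A3: "A ^ 3 * a ^ 3 \<le> A ^ 3 * (a * b)" using A by (intro mult_left_mono cube_le) auto
  let ?n = "norm (x - y)"
  have "norm ((P' (x + k x) - P' (x + k y)) - D x ((x + k x) - (x + k y)))
      \<le> A * a * (2 * A * a) * norm (x + k x - (x + k y))"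
    by (rule derivative_remainder_le[OF d l(1)]) (simp_all add: bdd_lipD(1)[OF k])
  also have "\<dots> \<le> A * a * (2 * A * a) * (2 * A * a * ?n)"
    using A a bdd_lipD(2)[OF k] by (intro mult_left_mono) auto
  also have "\<dots> = 4 * (A ^ 3 * a ^ 3) * ?n" by (simp add: power3_eq_cube)
  also have "\<dots> \<le> 4 * (A ^ 3 * (a * b)) * ?n" using A3 by (intro mult_right_mono) auto
  finally have 1: "norm (P' (x + k x) - P' (x + k y) - D x (k x - k y)) \<le> 4 * A ^ 3 * (a * b) * ?n"
    by simp
  define f where "f t = P' (x + t *\<^sub>R k y) - P' (y + t *\<^sub>R k y) - t *\<^sub>R (D x (k y) - D y (k y))" for t
  define f' where "f' t = D (x + t *\<^sub>R k y) (k y) - D (y + t *\<^sub>R k y) (k y) - (D x (k y) - D y (k y))" for t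
  have "norm (f 1 - f 0) \<le> 16 * A ^ 3 * (a * b) * ?n"
  proof (rule norm_diff_unit_interval_le)
    fix t :: real assume t: "t \<in> {0..1}"
    have line: "((\<lambda>t. P' (v + t *\<^sub>R w)) has_vector_derivative D (v + t *\<^sub>R w) w) (at t within {0..1})" for v w
    proof -
      have "((\<lambda>t. P' (v + t *\<^sub>R w)) has_derivative (\<lambda>h. D (v + t *\<^sub>R w) (0 + h *\<^sub>R w))) (at t within {0..1})"
        by (intro has_derivative_compose[OF _ d] derivative_intros)
      then show ?thesis by (simp add: has_vector_derivative_def blinfun.scaleR_right)
    qed
    show "(f has_vector_derivative f' t) (at t within {0..1})"
      unfolding f_def f'_def by (intro has_vector_derivative_diff line) (auto intro!: derivative_eq_intros)
    let ?p = "x + t *\<^sub>R k y" and ?q = "y + t *\<^sub>R k y"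
    have kt: "norm (t *\<^sub>R k y) \<le> 2 * A * a"
      using t bdd_lipD(1)[OF k, of y] mult_right_mono[of t 1 "norm (k y)"] by auto
    have "norm (D ?p - D ?q - (D x - D y)) \<le> A * a * (norm (?p - ?q - (x - y)) +
        (norm (?p - ?q) + norm (x - y)) * (norm (?p - x) + norm (?q - y)))"
      by (rule second_diffD[OF l(2)])
    also have "\<dots> = A * a * (4 * ?n * norm (t *\<^sub>R k y))" by simp
    also have "\<dots> \<le> A * a * (4 * ?n * (2 * A * a))"
      using A a by (intro mult_left_mono kt) auto
    finally have *: "norm (D ?p - D ?q - (D x - D y)) \<le> A * a * (4 * ?n * (2 * A * a))" .
    have "f' t = (D ?p - D ?q - (D x - D y)) (k y)"
      by (simp add: f'_def blinfun.bilinear_simps)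
    also have "norm \<dots> \<le> (A * a * (4 * ?n * (2 * A * a))) * (2 * A * a)"
      by (intro order_trans[OF norm_blinfun mult_mono] * bdd_lipD(1)[OF k]) (use A a in auto)
    also have "\<dots> = 16 * (A ^ 3 * a ^ 3) * ?n" by (simp add: power3_eq_cube)
    also have "\<dots> \<le> 16 * (A ^ 3 * (a * b)) * ?n" using A3 by (intro mult_right_mono) auto
    finally show "norm (f' t) \<le> 16 * A ^ 3 * (a * b) * ?n" by simp
  qed
  then have 2: "norm (P' (x + k y) - P' (y + k y) - (P' x - P' y) - (D x - D y) (k y))
      \<le> 16 * A ^ 3 * (a * b) * ?n"
    by (simp add: f_def blinfun.bilinear_simps algebra_simps)
  have "D x (R x) - D y (R y) = (D x - D y) (R x) + D y (R x - R y)"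
    by (simp add: blinfun.bilinear_simps)
  also have "norm \<dots> \<le> (A * a * ?n) * (A * b) + (A * a) * (A * b * ?n)"
    by (intro norm_triangle_le add_mono order_trans[OF norm_blinfun mult_mono] bdd_lipD[OF l(1)] bdd_lipD[OF R])
      (use A a b in auto)
  finally have 3: "norm (D x (R x) - D y (R y)) \<le> 2 * A\<^sup>2 * (a * b) * ?n"
    by (simp add: power2_eq_square)
  have "norm (R' (x + k x) - R' x - (R' (y + k y) - R' y)) \<le> A * b * (norm (x + k x - x - (y + k y - y)) +
      (norm (x + k x - x) + norm (y + k y - y)) * (norm (x + k x - (y + k y)) + ?n))"
    by (rule second_diffD[OF R'])
  also have "\<dots> \<le> A * b * (2 * A * a * ?n + (2 * A * a + 2 * A * a) * ((?n + 2 * A * a * ?n) + ?n))"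
  proof (intro mult_left_mono add_mono mult_mono)
    show "norm (x + k x - (y + k y)) \<le> ?n + 2 * A * a * ?n"
      using norm_triangle_mono[OF order_refl bdd_lipD(2)[OF k], of "x - y" x y] by (simp add: algebra_simps)
  qed (use A a b bdd_lipD[OF k] in auto)
  also have "\<dots> = (10 * A\<^sup>2 * (a * b) + 8 * A ^ 3 * (a * b) * a) * ?n"
    by (simp add: algebra_simps power2_eq_square power3_eq_cube)
  also have "\<dots> \<le> (10 * A\<^sup>2 * (a * b) + 8 * A ^ 3 * (a * b) * 1) * ?n"
    using A a b by (intro mult_right_mono add_left_mono mult_left_mono) auto
  finally have 4: "norm (R' (x + k x) - R' x - (R' (y + k y) - R' y))
      \<le> (10 * A\<^sup>2 + 8 * A ^ 3) * (a * b) * ?n" by (simp add: algebra_simps)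
  have "G x - G y = (P' (x + k x) - P' (x + k y) - D x (k x - k y))
      + (P' (x + k y) - P' (y + k y) - (P' x - P' y) - (D x - D y) (k y))
      + (D x (R x) - D y (R y)) + (R' (x + k x) - R' x - (R' (y + k y) - R' y))"
    by (simp add: G_def k_def blinfun.bilinear_simps add.assoc)
  then have "norm (G x - G y) \<le> 4 * A ^ 3 * (a * b) * ?n + 16 * A ^ 3 * (a * b) * ?n
      + 2 * A\<^sup>2 * (a * b) * ?n + (10 * A\<^sup>2 + 8 * A ^ 3) * (a * b) * ?n"
    using norm_triangle_mono[OF norm_triangle_mono[OF norm_triangle_mono[OF 1 2] 3] 4] by simp
  then show ?thesis by (simp add: algebra_simps)
qed

end

section \<open>Ramps and the second-order expansion of the time-one map\<close>

definition ramp :: "'a::real_normed_vector \<Rightarrow> real \<Rightarrow>\<^sub>C 'a" where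
  "ramp w = Bcontfun (\<lambda>t. max 0 (min 1 t) *\<^sub>R w)"

lemma ramp_apply: "ramp w t = max 0 (min 1 t) *\<^sub>R w"
proof -
  have "(\<lambda>t. max 0 (min 1 t) *\<^sub>R w) \<in> bcontfun"
    by (rule bcontfun_normI[of _ "norm w"]) (auto intro!: continuous_intros mult_left_le_one_le)
  then show ?thesis by (simp add: ramp_def Bcontfun_inverse)
qed

lemma ramp_add: "ramp (v + w) = ramp v + ramp w" and ramp_scaleR: "ramp (c *\<^sub>R w) = c *\<^sub>R ramp w"
  by (rule bcontfun_eqI, simp add: ramp_apply algebra_simps)+

lemma norm_ramp_le: "norm (ramp w) \<le> norm w"
  by (rule norm_bound) (auto simp: ramp_apply intro!: mult_left_le_one_le)

instance bcontfun :: (metric_space, banach) banach ..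

text \<open>Average over the running time \<open>u\<close> of a straight curve stopped at
  \<open>u\<close>. A bounded linear derivative commutes with the integral, so the second-order term
  of the differential equation is the derivative applied to this one curve.\<close>

definition mean_ramp :: "'a::banach \<Rightarrow> real \<Rightarrow>\<^sub>C 'a" where
  "mean_ramp w = integral {0..1} (\<lambda>u. stop u (ramp w))"

lemma stop_ramp_integrable: "(\<lambda>u. stop u (ramp w)) integrable_on {0..1}"
  for w :: "'a::banach"
  by (intro integrable_continuous_interval continuous_on_stop)

lemma bounded_linear_mean_ramp: "bounded_linear (mean_ramp :: 'a \<Rightarrow> _)"
  and norm_mean_ramp_le: "norm (mean_ramp w) \<le> norm w" for w :: "'a::banach"
proof -
  have n: "norm (mean_ramp w) \<le> norm w" for w :: 'a
  proof -
    have "norm (integral {0..1} (\<lambda>u. stop u (ramp w))) \<le> norm w * (1 - 0)"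
      by (intro integral_bound continuous_on_stop)
        (auto intro: order_trans[OF norm_stop_le norm_ramp_le])
    then show ?thesis by (simp add: mean_ramp_def)
  qed
  show "norm (mean_ramp w) \<le> norm w" by (rule n)
  show "bounded_linear (mean_ramp :: 'a \<Rightarrow> _)"
  proof (rule bounded_linear_intro[where K = 1])
    fix v w :: 'a and c :: real
    show "mean_ramp (v + w) = mean_ramp v + mean_ramp w"
      unfolding mean_ramp_def ramp_add stop_add
      by (intro Henstock_Kurzweil_Integration.integral_add stop_ramp_integrable)
    show "mean_ramp (c *\<^sub>R w) = c *\<^sub>R mean_ramp w"
      unfolding mean_ramp_def ramp_scaleR stop_scaleR by (rule integral_cmul)
    show "norm (mean_ramp w) \<le> norm w * 1" using n by simp
  qed
qed

text \<open>From time 1 on, stopping at \<open>u\<close> leaves the value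
  \<open>u *\<^sub>R w\<close>, whose average is half of \<open>w\<close>. A Markovian field sees
  only such a late value, at which the averaged ramp and half the constant curve coincide.\<close>

lemma mean_ramp_apply_end:
  assumes "1 \<le> t" shows "mean_ramp w t = (1/2) *\<^sub>R (w :: 'a::banach)"
proof -
  have "bounded_linear (\<lambda>y :: real \<Rightarrow>\<^sub>C 'a. y t)"
    by (rule bounded_linear_intro[where K = 1]) (auto simp: norm_bounded)
  from integral_linear[OF stop_ramp_integrable this, of w]
  have "mean_ramp w t = integral {0..1} (\<lambda>u. stop u (ramp w) t)"
    by (simp add: mean_ramp_def o_def)
  also have "\<dots> = integral {0..1} (\<lambda>u. u *\<^sub>R w)"
    by (rule integral_cong) (use assms in \<open>auto simp: ramp_apply min_def max_def\<close>)
  also have "((\<lambda>u. u *\<^sub>R w) has_integral ((1/2 * 1\<^sup>2) *\<^sub>R w - (1/2 * 0\<^sup>2) *\<^sub>R w)) {0..1}"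
    by (rule fundamental_theorem_of_calculus) (auto intro!: derivative_eq_intros)
  then have "integral {0..1} (\<lambda>u. u *\<^sub>R w) = (1/2) *\<^sub>R w"
    by (simp add: integral_unique)
  finally show ?thesis .
qed

text \<open>A bootstrap: the bound on the field keeps the solution within order \<open>a\<close> of
  the constant curve; hence the field stays within order \<open>b\<close> of \<open>P (c x)\<close>
  and the solution within order \<open>b\<close> of a ramp; inserted in the expansion of
  \<open>P\<close> this leaves \<open>a * b\<close>. The hypothesis \<open>small\<close> makes the
  Lipschitz constant \<open>2 * A * a\<close> of the field at most 1/2.\<close>

lemma (in step_size) time_one_map_expansion:
  fixes P R :: "'d::finite curve \<Rightarrow> real ^ 'd"
  assumes P: "bdd_lip (A * a) P" and R: "bdd_lip (A * b) R"
    and d: "\<And>y. (P has_derivative blinfun_apply (D y)) (at y)" and l: "bdd_lip (A * a) D"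
    and small: "4 * A * a \<le> 1"
    and G: "\<And>u y. u \<in> {0..1} \<Longrightarrow> y \<in> curves u \<Longrightarrow> G (u, y) = P y + R y"
  defines "c \<equiv> const_bcontfun :: real ^ 'd \<Rightarrow> 'd curve"
  shows "norm (time_one_map G x - (x + P (c x) + R (c x) + D (c x) (mean_ramp (P (c x)))))
    \<le> (6 * A ^ 3 + 3 * A\<^sup>2) * (a * b)"
proof -
  have Ab: "A * b \<le> A * a" by (rule mult_left_mono[OF b(2) A])
  have BL: "bdd_lip (2 * A * a) (\<lambda>y. P y + R y)"
    by (rule bdd_lip_mono[OF bdd_lip_add[OF P R]]) (use Ab in linarith)
  interpret contracting_field "\<lambda>y. P y + R y"
  proof
    fix y z :: "'d curve"
    have "2 * A * a * norm (y - z) \<le> 1 / 2 * norm (y - z)"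
      using small by (intro mult_right_mono) auto
    with bdd_lipD(2)[OF BL, of y z]
    show "norm (P y + R y - (P z + R z)) \<le> 1 / 2 * norm (y - z)" by linarith
  qed
  obtain y where fp: "picard (\<lambda>y. P y + R y) x y = y" and y1: "time_one_map G x = y 1"
    using time_one_map_eq[of G x] G by blast
  let ?W = "\<lambda>u. P (stop u y) + R (stop u y)" and ?w = "P (c x)"
  let ?k = "2 * A * a" and ?e = "(2 * A\<^sup>2 + A) * b"
  have k0: "0 \<le> ?k" and e0: "0 \<le> ?e" using A a b by auto
  have y: "y t = x + integral {0..max 0 (min 1 t)} ?W" for t
    by (subst fp[symmetric]) (rule picard_apply)
  have dev: "norm (stop u y - c x) \<le> ?k" if u: "u \<in> {0..1}" for u
  proof (rule norm_bound)
    fix t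
    define r where "r = max 0 (min u t)"
    have r: "0 \<le> r" "r \<le> 1" using u by (auto simp: r_def)
    have "norm (integral {0..r} ?W) \<le> ?k * (r - 0)"
      by (intro integral_bound continuous_on_along bdd_lipD(1)[OF BL]) (use r in auto)
    also have "\<dots> \<le> ?k * 1" using r k0 by (intro mult_left_mono) auto
    finally show "norm ((stop u y - c x) t) \<le> ?k"
      using r by (simp add: c_def const_bcontfun.rep_eq r_def[symmetric]) (subst y, simp)
  qed
  have W: "norm (?W u - ?w) \<le> ?e" if u: "u \<in> {0..1}" for u
  proof -
    have "norm ((P (stop u y) - P (c x)) + R (stop u y)) \<le> A * a * ?k + A * b"
      using mult_left_mono[OF dev[OF u], of "A * a"] A a
      by (intro norm_triangle_mono bdd_lipD(1)[OF R] order_trans[OF bdd_lipD(2)[OF P]]) auto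
    also have "A * a * ?k = 2 * A\<^sup>2 * a\<^sup>2" by (simp add: power2_eq_square)
    also have "\<dots> \<le> 2 * A\<^sup>2 * b" using A b by (intro mult_left_mono) auto
    finally show ?thesis by (simp add: algebra_simps)
  qed
  have dev2: "norm (stop u y - c x - stop u (ramp ?w)) \<le> ?e" if u: "u \<in> {0..1}" for u
  proof (rule norm_bound)
    fix t
    define r where "r = max 0 (min u t)"
    have r: "0 \<le> r" "r \<le> 1" using u by (auto simp: r_def)
    have "norm (integral {0..r} (\<lambda>u. ?W u - ?w)) \<le> ?e * (r - 0)"
      by (intro integral_bound continuous_on_diff continuous_on_along continuous_on_const W) (use r in auto)
    also have "\<dots> \<le> ?e * 1" using r e0 by (intro mult_left_mono) auto
    also have "integral {0..r} (\<lambda>u. ?W u - ?w) = integral {0..r} ?W - r *\<^sub>R ?w"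
      using r by (subst Henstock_Kurzweil_Integration.integral_diff[OF integrable_along[of r r]]) auto
    finally show "norm ((stop u y - c x - stop u (ramp ?w)) t) \<le> ?e"
      using r by (simp add: c_def const_bcontfun.rep_eq r_def[symmetric] ramp_apply) (subst y, simp)
  qed
  have int: "norm (?W u - (?w + R (c x) + D (c x) (stop u (ramp ?w)))) \<le> (6 * A ^ 3 + 3 * A\<^sup>2) * (a * b)"
    if u: "u \<in> {0..1}" for u
  proof -
    have "norm (P (stop u y) - P (c x) - D (c x) (stop u y - c x)) \<le> A * a * ?k * norm (stop u y - c x)"
      by (rule derivative_remainder_le[OF d l]) (use dev[OF u] k0 in auto)
    also have "\<dots> \<le> A * a * ?k * ?k" using A a k0 by (intro mult_left_mono dev[OF u]) auto
    also have "\<dots> = 4 * A ^ 3 * a ^ 3" by (simp add: power3_eq_cube)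
    also have "\<dots> \<le> 4 * A ^ 3 * (a * b)" using A by (intro mult_left_mono cube_le) auto
    finally have 1: "norm (P (stop u y) - P (c x) - D (c x) (stop u y - c x)) \<le> 4 * A ^ 3 * (a * b)" .
    have 2: "norm (D (c x) (stop u y - c x - stop u (ramp ?w))) \<le> (A * a) * ?e"
      by (intro order_trans[OF norm_blinfun mult_mono] bdd_lipD[OF l] dev2 u) (use A a in auto)
    have 3: "norm (R (stop u y) - R (c x)) \<le> (A * b) * ?k"
      by (rule order_trans[OF bdd_lipD(2)[OF R] mult_left_mono[OF dev[OF u]]]) (use A b in auto)
    have "norm (?W u - (?w + R (c x) + D (c x) (stop u (ramp ?w)))) \<le>
        4 * A ^ 3 * (a * b) + (A * a) * ?e + (A * b) * ?k"
      using norm_triangle_mono[OF norm_triangle_mono[OF 1 2] 3]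
      by (simp add: blinfun.bilinear_simps algebra_simps)
    then show ?thesis by (simp add: algebra_simps power2_eq_square power3_eq_cube)
  qed
  have cont: "continuous_on {0..1} (\<lambda>u. D (c x) (stop u (ramp ?w)))"
    by (intro continuous_intros continuous_on_stop)
  have intD: "integral {0..1} (\<lambda>u. D (c x) (stop u (ramp ?w))) = D (c x) (mean_ramp ?w)"
    using integral_linear[OF stop_ramp_integrable blinfun.bounded_linear_right, of "D (c x)" ?w]
    by (simp add: mean_ramp_def o_def)
  let ?Q = "\<lambda>u. ?w + R (c x) + D (c x) (stop u (ramp ?w))"
  have "norm (integral {0..1} (\<lambda>u. ?W u - ?Q u)) \<le> (6 * A ^ 3 + 3 * A\<^sup>2) * (a * b) * (1 - 0)"
    by (intro integral_bound int continuous_on_diff continuous_on_along continuous_on_add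
        continuous_on_const cont) auto
  also have "integral {0..1} (\<lambda>u. ?W u - ?Q u) = integral {0..1} ?W - integral {0..1} ?Q"
    by (intro Henstock_Kurzweil_Integration.integral_diff integrable_along integrable_continuous_interval
        continuous_on_add continuous_on_const cont) auto
  also have "integral {0..1} ?Q = ?w + R (c x) + D (c x) (mean_ramp ?w)"
    by (subst Henstock_Kurzweil_Integration.integral_add)
      (auto intro!: integrable_continuous_interval cont simp: intD)
  also have "integral {0..1} ?W = y 1 - x" using y[of 1] by simp
  finally show ?thesis by (simp add: y1 algebra_simps)
qed

subsection \<open>Flows close to almost flows\<close>

lemma flowD: "flow T \<phi> \<Longrightarrow> 0 \<le> s \<Longrightarrow> s \<le> u \<Longrightarrow> u \<le> t \<Longrightarrow> t \<le> T \<Longrightarrow> \<phi> t u (\<phi> u s x) = \<phi> t s x"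
  unfolding flow_def by (metis comp_apply)

lemma powr_half: "(h / 2) powr g = 2 powr (- g) * h powr g" if "0 \<le> h" for h g :: real
  using that by (simp add: powr_divide powr_minus field_simps)

lemma small_step:
  fixes \<theta> c L d :: real
  assumes "0 < \<theta>" "0 < c" "0 < d"
  obtains \<eta> where "0 < \<eta>" "\<eta> \<le> d" "L * \<eta> powr \<theta> \<le> c"
proof -
  define \<eta> where "\<eta> = min d ((c / (\<bar>L\<bar> + 1)) powr (1 / \<theta>))"
  have "\<eta> powr \<theta> \<le> ((c / (\<bar>L\<bar> + 1)) powr (1 / \<theta>)) powr \<theta>"
    using assms by (intro powr_mono2) (auto simp: \<eta>_def)
  also have "\<dots> = c / (\<bar>L\<bar> + 1)"
    using assms by (simp add: powr_powr)
  finally have "\<bar>L\<bar> * \<eta> powr \<theta> \<le> (\<bar>L\<bar> + 1) * (c / (\<bar>L\<bar> + 1))"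
    by (intro mult_mono) auto
  moreover have "L * \<eta> powr \<theta> \<le> \<bar>L\<bar> * \<eta> powr \<theta>" by (intro mult_right_mono) auto
  moreover have "(\<bar>L\<bar> + 1) * (c / (\<bar>L\<bar> + 1)) = c" by simp
  ultimately have "L * \<eta> powr \<theta> \<le> c" by linarith
  moreover have "0 < \<eta>" "\<eta> \<le> d" using assms by (auto simp: \<eta>_def)
  ultimately show ?thesis using that by blast
qed

text \<open>Halving an interval doubles the number of errors while each, being of order \<gamma>,
  shrinks by \<open>2 powr (- \<gamma>)\<close>. As \<gamma> > 1 the product stays below 1, with
  room for a Lipschitz factor \<open>1 + \<kappa>\<close> on one of the halves.\<close>

lemma contraction_ratio:
  fixes \<gamma> :: real
  assumes "1 < \<gamma>"
  obtains \<kappa> \<rho> where "0 < \<kappa>" "\<kappa> \<le> 1" "(2 + \<kappa>) * 2 powr (- \<gamma>) \<le> \<rho>" "0 < \<rho>" "\<rho> < 1"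
proof -
  define q where "q = 2 powr (- \<gamma>)"
  have q: "0 < q" "2 * q < 1"
  proof -
    have "2 * q = 2 powr (1 - \<gamma>)" by (simp add: q_def powr_diff powr_minus field_simps)
    also have "\<dots> < 2 powr 0" using assms by (intro powr_less_mono) auto
    finally show "2 * q < 1" by simp
  qed (simp add: q_def)
  \<comment> \<open>Chosen so that \<open>(2 + k) * q\<close> does not pass the midpoint of
    \<open>2 * q\<close> and 1; the cap 1 keeps the Lipschitz factor at most 2.\<close>
  define k where "k = min 1 ((1 - 2 * q) / 2 / q)"
  have "k * q \<le> (1 - 2 * q) / 2 / q * q"
    using q by (intro mult_right_mono) (auto simp: k_def)
  also have "\<dots> = (1 - 2 * q) / 2" using q by simp
  finally have "(2 + k) * 2 powr (- \<gamma>) \<le> (1 + 2 * q) / 2"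
    unfolding q_def[symmetric] by (simp add: distrib_right)
  then show ?thesis
    using q by (intro that[of k "(1 + 2 * q) / 2"]) (auto simp: k_def)
qed

text \<open>The a priori bound may have arbitrarily bad constants; the halving recursion
  \<open>\<epsilon>(h) \<le> (2 + \<kappa>) \<epsilon>(h/2) + C\<^sub>0 h\<^sup>\<gamma>\<close> replaces it by one that depends on the almost flow only.\<close>

lemma flow_close_to_almost_flow:
  fixes m \<phi> :: "real \<Rightarrow> real \<Rightarrow> 'a::real_normed_vector \<Rightarrow> 'a"
  assumes flow: "flow T \<phi>"
    and lip: "\<And>s t x y. 0 \<le> s \<Longrightarrow> s \<le> t \<Longrightarrow> t \<le> T \<Longrightarrow> t - s \<le> \<delta> \<Longrightarrow>
      norm (m t s x - m t s y) \<le> (1 + L * (t - s) powr \<theta>) * norm (x - y)"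
    and almost: "\<And>s u t x. 0 \<le> s \<Longrightarrow> s \<le> u \<Longrightarrow> u \<le> t \<Longrightarrow> t \<le> T \<Longrightarrow> t - s \<le> \<delta> \<Longrightarrow>
      norm (m t u (m u s x) - m t s x) \<le> C0 * (t - s) powr \<gamma>"
    and apriori: "\<And>s t x. 0 \<le> s \<Longrightarrow> s \<le> t \<Longrightarrow> t \<le> T \<Longrightarrow> t - s \<le> \<delta>' \<Longrightarrow>
      norm (\<phi> t s x - m t s x) \<le> c * (t - s) powr \<gamma>'"
    and pos: "0 < \<theta>" "1 < \<gamma>'" "0 < \<delta>'" "0 < \<delta>" "0 \<le> c" "0 \<le> L" "0 \<le> C1"
    and \<delta>: "L * \<delta> powr \<theta> \<le> \<kappa>" and \<rho>: "(2 + \<kappa>) * 2 powr (- \<gamma>) \<le> \<rho>" and C: "C0 \<le> (1 - \<rho>) * C1"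
    and st: "0 \<le> s" "s \<le> t" "t \<le> T" "t - s \<le> \<delta>"
  shows "norm (\<phi> t s x - m t s x) \<le> C1 * (t - s) powr \<gamma>"
proof -
  have halve: "norm (\<phi> t s x - m t s x) \<le> (2 + L * \<eta> powr \<theta>) * e + C0 * (t - s) powr \<gamma>"
    if st: "0 \<le> s" "s \<le> t" "t \<le> T" "t - s \<le> \<delta>" "t - s \<le> \<eta>"
      and e: "\<And>s' t' x. 0 \<le> s' \<Longrightarrow> s' \<le> t' \<Longrightarrow> t' \<le> T \<Longrightarrow> t' - s' = (t - s) / 2 \<Longrightarrow> norm (\<phi> t' s' x - m t' s' x) \<le> e"
    for s t x \<eta> e
  proof -
    define u where "u = (s + t) / 2"
    have u: "s \<le> u" "u \<le> t" "t - u = (t - s) / 2" "u - s = (t - s) / 2"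
      using st by (auto simp: u_def field_simps)
    have 1: "norm (\<phi> t u (\<phi> u s x) - m t u (\<phi> u s x)) \<le> e"
      by (rule e) (use st u in auto)
    have 2: "norm (\<phi> u s x - m u s x) \<le> e"
      by (rule e) (use st u in auto)
    have "norm (m t u (\<phi> u s x) - m t u (m u s x)) \<le> (1 + L * (t - u) powr \<theta>) * norm (\<phi> u s x - m u s x)"
      by (rule lip) (use st u in auto)
    also have "\<dots> \<le> (1 + L * \<eta> powr \<theta>) * e"
      using st u pos 2 by (intro mult_mono add_left_mono mult_left_mono powr_mono2) auto
    finally have 3: "norm (m t u (\<phi> u s x) - m t u (m u s x)) \<le> (1 + L * \<eta> powr \<theta>) * e" .
    have 4: "norm (m t u (m u s x) - m t s x) \<le> C0 * (t - s) powr \<gamma>"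
      by (rule almost) (use st u in auto)
    have "\<phi> t s x = \<phi> t u (\<phi> u s x)"
      using flowD[OF flow, of s u t x] st u by simp
    then have "\<phi> t s x - m t s x = (\<phi> t u (\<phi> u s x) - m t u (\<phi> u s x))
        + (m t u (\<phi> u s x) - m t u (m u s x)) + (m t u (m u s x) - m t s x)" by simp
    also have "norm \<dots> \<le> e + (1 + L * \<eta> powr \<theta>) * e + C0 * (t - s) powr \<gamma>"
      by (intro norm_triangle_mono 1 3 4)
    finally show ?thesis by (simp add: algebra_simps)
  qed
  \<comment> \<open>The constant \<open>C1\<close> reproduces itself under halving: the recursion
    leaves the fraction \<rho> of it and the fresh error \<open>C0\<close> is paid by
    \<open>(1 - \<rho>) * C1\<close>.\<close>
  have C1_step: "(2 + L * \<eta> powr \<theta>) * (C1 * (h / 2) powr \<gamma>) + C0 * h powr \<gamma> \<le> C1 * h powr \<gamma>"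
    if "0 \<le> h" "0 \<le> \<eta>" "\<eta> \<le> \<delta>" for h \<eta>
  proof -
    have "L * \<eta> powr \<theta> \<le> \<kappa>"
      using \<delta> powr_mono2[of \<theta> \<eta> \<delta>] that pos by (meson less_imp_le mult_left_mono order_trans)
    then have "(2 + L * \<eta> powr \<theta>) * 2 powr (- \<gamma>) \<le> \<rho>"
      by (intro order_trans[OF mult_right_mono \<rho>]) auto
    then have "((2 + L * \<eta> powr \<theta>) * 2 powr (- \<gamma>)) * (C1 * h powr \<gamma>) \<le> \<rho> * (C1 * h powr \<gamma>)"
      using pos by (intro mult_right_mono) auto
    moreover have "C0 * h powr \<gamma> \<le> (1 - \<rho>) * C1 * h powr \<gamma>"
      using C by (intro mult_right_mono) auto
    ultimately show ?thesis
      using that by (simp add: powr_half algebra_simps)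
  qed
  \<comment> \<open>The a priori exponent \<gamma>' needs a ratio of its own. Below the length
    \<eta> the Lipschitz factor is close enough to 1 for it, so each halving shrinks the a priori
    term by \<rho>'.\<close>
  obtain \<kappa>' \<rho>' where \<kappa>': "0 < \<kappa>'" "(2 + \<kappa>') * 2 powr (- \<gamma>') \<le> \<rho>'" "0 < \<rho>'" "\<rho>' < 1"
    using contraction_ratio[OF pos(2)] by metis
  obtain \<eta> where \<eta>: "0 < \<eta>" "\<eta> \<le> min \<delta> \<delta>'" "L * \<eta> powr \<theta> \<le> \<kappa>'"
    using small_step[OF pos(1) \<kappa>'(1), of "min \<delta> \<delta>'" L] pos by auto
  have iter: "norm (\<phi> t s x - m t s x) \<le> C1 * (t - s) powr \<gamma> + c * \<rho>' ^ n * (t - s) powr \<gamma>'"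
    if "0 \<le> s" "s \<le> t" "t \<le> T" "t - s \<le> \<eta>" for s t x n
    using that
  proof (induction n arbitrary: s t x)
    case 0
    then show ?case
      using apriori[of s t x] \<eta>(2) pos by (intro order_trans[OF apriori]) auto
  next
    case (Suc n)
    let ?e = "C1 * ((t - s) / 2) powr \<gamma> + c * \<rho>' ^ n * ((t - s) / 2) powr \<gamma>'"
    have "norm (\<phi> t s x - m t s x) \<le> (2 + L * \<eta> powr \<theta>) * ?e + C0 * (t - s) powr \<gamma>"
    proof (rule halve)
      fix s' t' x assume "0 \<le> s'" "s' \<le> t'" "t' \<le> T" and h: "t' - s' = (t - s) / 2"
      moreover have "t' - s' \<le> \<eta>" using h Suc.prems by argo
      ultimately show "norm (\<phi> t' s' x - m t' s' x) \<le> ?e"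
        using Suc.IH[of s' t' x] by (simp only: h[symmetric])
    qed (use Suc.prems \<eta> in auto)
    also have "\<dots> = ((2 + L * \<eta> powr \<theta>) * (C1 * ((t - s) / 2) powr \<gamma>) + C0 * (t - s) powr \<gamma>)
        + ((2 + L * \<eta> powr \<theta>) * 2 powr (- \<gamma>')) * (c * \<rho>' ^ n * (t - s) powr \<gamma>')"
      using Suc.prems by (simp add: powr_half algebra_simps)
    also have "\<dots> \<le> C1 * (t - s) powr \<gamma> + \<rho>' * (c * \<rho>' ^ n * (t - s) powr \<gamma>')"
    proof (intro add_mono mult_right_mono C1_step)
      show "(2 + L * \<eta> powr \<theta>) * 2 powr (- \<gamma>') \<le> \<rho>'"
        using \<eta>(3) by (intro order_trans[OF mult_right_mono \<kappa>'(2)]) auto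
    qed (use Suc.prems \<eta> pos \<kappa>' in auto)
    finally show ?case by (simp add: mult.assoc mult.left_commute)
  qed
  have small: "norm (\<phi> t s x - m t s x) \<le> C1 * (t - s) powr \<gamma>"
    if "0 \<le> s" "s \<le> t" "t \<le> T" "t - s \<le> \<eta>" for s t x
  proof (rule LIMSEQ_le_const)
    have "(\<lambda>n. C1 * (t - s) powr \<gamma> + c * \<rho>' ^ n * (t - s) powr \<gamma>') \<longlonglongrightarrow>
        C1 * (t - s) powr \<gamma> + c * 0 * (t - s) powr \<gamma>'"
      using \<kappa>' by (intro tendsto_intros LIMSEQ_power_zero) auto
    then show "(\<lambda>n. C1 * (t - s) powr \<gamma> + c * \<rho>' ^ n * (t - s) powr \<gamma>') \<longlonglongrightarrow> C1 * (t - s) powr \<gamma>"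
      by simp
    show "\<exists>N. \<forall>n\<ge>N. norm (\<phi> t s x - m t s x) \<le> C1 * (t - s) powr \<gamma> + c * \<rho>' ^ n * (t - s) powr \<gamma>'"
      using iter that by blast
  qed
  \<comment> \<open>Leads from the length \<eta>, which depends on the a priori bound, up to
    \<delta>, which does not; each doubling keeps \<open>C1\<close>.\<close>
  have doubling: "norm (\<phi> t s x - m t s x) \<le> C1 * (t - s) powr \<gamma>"
    if "0 \<le> s" "s \<le> t" "t \<le> T" "t - s \<le> \<delta>" "t - s \<le> \<eta> * 2 ^ n" for s t x n
    using that
  proof (induction n arbitrary: s t x)
    case 0
    then show ?case using small by simp
  next
    case (Suc n)
    have "norm (\<phi> t s x - m t s x) \<le> (2 + L * \<delta> powr \<theta>) * (C1 * ((t - s) / 2) powr \<gamma>) + C0 * (t - s) powr \<gamma>"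
    proof (rule halve)
      fix s' t' x assume "0 \<le> s'" "s' \<le> t'" "t' \<le> T" and h: "t' - s' = (t - s) / 2"
      moreover have "t' - s' \<le> \<delta>" "t' - s' \<le> \<eta> * 2 ^ n" using h Suc.prems by auto
      ultimately show "norm (\<phi> t' s' x - m t' s' x) \<le> C1 * ((t - s) / 2) powr \<gamma>"
        using Suc.IH[of s' t' x] by (simp only: h[symmetric])
    qed (use Suc.prems in auto)
    also have "\<dots> \<le> C1 * (t - s) powr \<gamma>"
      by (rule C1_step) (use Suc.prems pos in auto)
    finally show ?case .
  qed
  obtain n where "\<delta> / \<eta> < 2 ^ n"
    using real_arch_pow[of 2 "\<delta> / \<eta>"] by auto
  then have "t - s \<le> \<eta> * 2 ^ n"
    using st \<eta>(1) by (simp add: field_simps)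
  then show ?thesis using doubling st by blast
qed

section \<open>Dyadic compositions of a regular almost flow\<close>

primrec dyadic :: "(real \<Rightarrow> real \<Rightarrow> 'a \<Rightarrow> 'a) \<Rightarrow> nat \<Rightarrow> real \<Rightarrow> real \<Rightarrow> 'a \<Rightarrow> 'a" where
  "dyadic m 0 t s x = m t s x"
| "dyadic m (Suc n) t s x = dyadic m n t ((s + t) / 2) (dyadic m n ((s + t) / 2) s x)"

text \<open>\<open>C1\<close> will bound the distance of the dyadic compositions to \<open>m\<close>
  in the supremum norm, \<open>C2\<close> in the Lipschitz norm. The extra \<open>C1\<close> in the
  condition on \<open>C2\<close> pays for the second-difference term, into which the supremum error
  enters; the condition on \<delta> keeps all compositions Lipschitz with constant
  \<open>1 + \<kappa>\<close>.\<close>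

locale stable_almost_flow =
  fixes T \<delta> \<kappa> \<rho> L \<theta> \<gamma> C0 C1 C2 :: real
    and m :: "real \<Rightarrow> real \<Rightarrow> 'a::real_normed_vector \<Rightarrow> 'a"
  assumes pos: "0 < \<delta>" "0 < \<theta>" "1 < \<gamma>" "0 \<le> L" "0 \<le> C0" "0 \<le> C1" "0 \<le> C2"
    and \<kappa>: "0 < \<kappa>" "\<kappa> \<le> 1" and \<rho>: "(2 + \<kappa>) * 2 powr (- \<gamma>) \<le> \<rho>" "0 < \<rho>" "\<rho> < 1"
    and C: "C0 \<le> (1 - \<rho>) * C1" "C0 + C1 \<le> (1 - \<rho>) * C2"
    and \<delta>: "2 * L * \<delta> powr \<theta> + C2 * \<delta> powr \<gamma> \<le> \<kappa>"
    and lip: "\<And>s t x y. 0 \<le> s \<Longrightarrow> s \<le> t \<Longrightarrow> t \<le> T \<Longrightarrow> t - s \<le> \<delta> \<Longrightarrow>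
      norm ((m t s x - x) - (m t s y - y)) \<le> L * (t - s) powr \<theta> * norm (x - y)"
    and sd: "\<And>s t. 0 \<le> s \<Longrightarrow> s \<le> t \<Longrightarrow> t \<le> T \<Longrightarrow> t - s \<le> \<delta> \<Longrightarrow>
      second_diff (L * (t - s) powr \<theta>) (\<lambda>x. m t s x - x)"
    and almost: "\<And>s u t x. 0 \<le> s \<Longrightarrow> s \<le> u \<Longrightarrow> u \<le> t \<Longrightarrow> t \<le> T \<Longrightarrow> t - s \<le> \<delta> \<Longrightarrow>
      norm (m t u (m u s x) - m t s x) \<le> C0 * (t - s) powr \<gamma>"
    and almost_lip: "\<And>s u t x y. 0 \<le> s \<Longrightarrow> s \<le> u \<Longrightarrow> u \<le> t \<Longrightarrow> t \<le> T \<Longrightarrow> t - s \<le> \<delta> \<Longrightarrow>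
      norm ((m t u (m u s x) - m t s x) - (m t u (m u s y) - m t s y)) \<le> C0 * (t - s) powr \<gamma> * norm (x - y)"
begin

text \<open>One induction serves both bounds because the Lipschitz bound after \<open>Suc n\<close>
  halvings uses the supremum bound after \<open>n\<close>. Replacing the inner composition by
  \<open>m u s\<close> inside \<open>m t u\<close>, for \<open>x\<close> and for \<open>y\<close>,
  is a second difference over four points; this is where \<open>sd\<close> enters.\<close>

lemma dyadic_estimates:
  assumes "0 \<le> s" "s \<le> t" "t \<le> T" "t - s \<le> \<delta>"
  shows "norm (dyadic m n t s x - m t s x) \<le> C1 * (t - s) powr \<gamma> \<and>
    norm ((dyadic m n t s x - m t s x) - (dyadic m n t s y - m t s y)) \<le> C2 * (t - s) powr \<gamma> * norm (x - y)"
  using assms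
proof (induction n arbitrary: s t x y)
  case 0
  then show ?case using pos by simp
next
  case (Suc n)
  define u where "u = (s + t) / 2"
  define h where "h = t - s"
  have h: "0 \<le> h" "h \<le> \<delta>" using Suc.prems by (auto simp: h_def)
  have u: "s \<le> u" "u \<le> t" "t - u = h / 2" "u - s = h / 2"
    using Suc.prems by (auto simp: u_def h_def field_simps)
  let ?M = "dyadic m n"
  define e1 e2 l where "e1 = C1 * (h / 2) powr \<gamma>" and "e2 = C2 * (h / 2) powr \<gamma>" and "l = L * h powr \<theta>"
  have nn: "0 \<le> e1" "0 \<le> e2" "0 \<le> l" using pos by (auto simp: e1_def e2_def l_def)
  have hd: "h powr \<theta> \<le> \<delta> powr \<theta>" "(h / 2) powr \<theta> \<le> h powr \<theta>" "(h / 2) powr \<gamma> \<le> \<delta> powr \<gamma>"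
    using h pos by (auto intro!: powr_mono2)
  have le\<kappa>: "2 * l + e2 \<le> \<kappa>"
    using \<delta> mult_left_mono[OF hd(1), of L] mult_left_mono[OF hd(3), of C2] pos
    by (simp add: l_def e2_def)
  have l: "L * (h / 2) powr \<theta> \<le> l"
    using hd(2) pos by (auto simp: l_def intro: mult_left_mono)
  have IH_us: "norm (?M u s z - m u s z) \<le> e1"
     "norm ((?M u s z - m u s z) - (?M u s w - m u s w)) \<le> e2 * norm (z - w)" for z w
    using Suc.IH[of s u z w] Suc.prems u h by (auto simp: e1_def e2_def)
  have IH_tu: "norm (?M t u z - m t u z) \<le> e1"
     "norm ((?M t u z - m t u z) - (?M t u w - m t u w)) \<le> e2 * norm (z - w)" for z w
    using Suc.IH[of u t z w] Suc.prems u h by (auto simp: e1_def e2_def)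
  have r_us: "norm ((m u s z - z) - (m u s w - w)) \<le> l * norm (z - w)" for z w
    using lip[of s u z w] Suc.prems u h mult_right_mono[OF l, of "norm (z - w)"] by (simp add: u(4))
  have r_tu: "norm ((m t u z - z) - (m t u w - w)) \<le> l * norm (z - w)" for z w
    using lip[of u t z w] Suc.prems u h mult_right_mono[OF l, of "norm (z - w)"] by (simp add: u(3))
  have m_us: "norm (m u s z - m u s w) \<le> (1 + l) * norm (z - w)" for z w
    using norm_triangle_mono[OF r_us order_refl[of "norm (z - w)"], of z w] by (simp add: algebra_simps)
  have M_us: "norm (?M u s z - ?M u s w) \<le> (1 + l + e2) * norm (z - w)" for z w
    using norm_triangle_mono[OF IH_us(2) m_us, of z w z w] by (simp add: algebra_simps)
  have sd_tu: "second_diff l (\<lambda>x. m t u x - x)"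
    using second_diff_mono[OF sd[of u t, unfolded u(3)] l] Suc.prems u h by simp
  have M: "dyadic m (Suc n) t s z - m t s z = (?M t u (?M u s z) - m t u (?M u s z))
      + (m t u (?M u s z) - m t u (m u s z)) + (m t u (m u s z) - m t s z)" for z
    by (simp add: u_def)
  have q2: "(2 + \<kappa>) * (c * (h / 2) powr \<gamma>) \<le> \<rho> * (c * h powr \<gamma>)" if "0 \<le> c" for c
    using mult_right_mono[OF \<rho>(1), of "c * h powr \<gamma>"] h that by (simp add: powr_half algebra_simps)
  have e1_le: "(2 + \<kappa>) * e1 \<le> \<rho> * (C1 * h powr \<gamma>)" and e2_le: "(2 + \<kappa>) * e2 \<le> \<rho> * (C2 * h powr \<gamma>)"
    unfolding e1_def e2_def by (intro q2 pos)+
  have "norm (dyadic m (Suc n) t s x - m t s x) \<le> e1 + (1 + \<kappa>) * e1 + C0 * h powr \<gamma>"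
    unfolding M
  proof (intro norm_triangle_mono IH_tu(1))
    have "norm (m t u (?M u s x) - m t u (m u s x)) \<le> (1 + l) * norm (?M u s x - m u s x)"
      using norm_triangle_mono[OF r_tu order_refl[of "norm (?M u s x - m u s x)"], of "?M u s x" "m u s x"]
      by (simp add: algebra_simps)
    also have "\<dots> \<le> (1 + \<kappa>) * e1"
      using le\<kappa> nn \<kappa> by (intro mult_mono IH_us) auto
    finally show "norm (m t u (?M u s x) - m t u (m u s x)) \<le> (1 + \<kappa>) * e1" .
    show "norm (m t u (m u s x) - m t s x) \<le> C0 * h powr \<gamma>"
      unfolding h_def by (rule almost) (use Suc.prems u in auto)
  qed
  also have "\<dots> \<le> \<rho> * (C1 * h powr \<gamma>) + (1 - \<rho>) * C1 * h powr \<gamma>"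
    using e1_le mult_right_mono[OF C(1), of "h powr \<gamma>"] by (simp add: algebra_simps)
  finally have sup: "norm (dyadic m (Suc n) t s x - m t s x) \<le> C1 * h powr \<gamma>"
    by (simp add: algebra_simps)
  define d where "d = norm (x - y)"
  have d0: "0 \<le> d" by (simp add: d_def)
  let ?a = "?M u s x" and ?b = "m u s x" and ?a' = "?M u s y" and ?b' = "m u s y"
  have 1: "norm ((?M t u ?a - m t u ?a) - (?M t u ?a' - m t u ?a')) \<le> e2 * ((1 + l + e2) * d)"
    using IH_tu(2)[of ?a ?a'] mult_left_mono[OF M_us[of x y] nn(2)] by (simp add: d_def)
  have 2: "norm ((m t u ?a - m t u ?b) - (m t u ?a' - m t u ?b')) \<le>
      e2 * d + l * (e2 * d + (e1 + e1) * ((1 + l + e2) * d + (1 + l) * d))"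
  proof -
    have "norm ((m t u ?a - ?a) - (m t u ?b - ?b) - ((m t u ?a' - ?a') - (m t u ?b' - ?b')))
      \<le> l * (norm (?a - ?b - (?a' - ?b')) + (norm (?a - ?b) + norm (?a' - ?b')) * (norm (?a - ?a') + norm (?b - ?b')))"
      by (rule second_diffD[OF sd_tu])
    also have "\<dots> \<le> l * (e2 * d + (e1 + e1) * ((1 + l + e2) * d + (1 + l) * d))"
      unfolding d_def using nn by (intro mult_left_mono add_mono mult_mono IH_us M_us m_us) auto
    finally have *: "norm ((m t u ?a - ?a) - (m t u ?b - ?b) - ((m t u ?a' - ?a') - (m t u ?b' - ?b'))) \<le> \<dots>" .
    have "norm (?a - ?b - (?a' - ?b')) \<le> e2 * d"
      using IH_us(2) by (simp add: d_def)
    from norm_triangle_mono[OF this *] show ?thesis by (simp add: algebra_simps)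
  qed
  have 3: "norm ((m t u ?b - m t s x) - (m t u ?b' - m t s y)) \<le> C0 * h powr \<gamma> * d"
    unfolding h_def d_def by (rule almost_lip) (use Suc.prems u in auto)
  have "(dyadic m (Suc n) t s x - m t s x) - (dyadic m (Suc n) t s y - m t s y) =
    ((?M t u ?a - m t u ?a) - (?M t u ?a' - m t u ?a')) + ((m t u ?a - m t u ?b) - (m t u ?a' - m t u ?b'))
    + ((m t u ?b - m t s x) - (m t u ?b' - m t s y))"
    unfolding M by simp
  then have "norm ((dyadic m (Suc n) t s x - m t s x) - (dyadic m (Suc n) t s y - m t s y)) =
    norm (((?M t u ?a - m t u ?a) - (?M t u ?a' - m t u ?a')) + ((m t u ?a - m t u ?b) - (m t u ?a' - m t u ?b'))
    + ((m t u ?b - m t s x) - (m t u ?b' - m t s y)))"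
    by (rule arg_cong)
  also have "\<dots> \<le>
      e2 * ((1 + l + e2) * d) + (e2 * d + l * (e2 * d + (e1 + e1) * ((1 + l + e2) * d + (1 + l) * d)))
      + C0 * h powr \<gamma> * d"
    by (intro norm_triangle_mono 1 2 3)
  \<comment> \<open>Collected so that one factor, at most \<open>2 + \<kappa>\<close>, multiplies
    both errors. The prefactor \<open>2 * l\<close> of \<open>e1\<close> is at most \<kappa>, hence
    at most 1, so that part costs no more than \<open>C1 * h powr \<gamma>\<close>.\<close>
  also have "\<dots> = ((2 + (2 * l + e2)) * e2 + 2 * l * ((2 + (2 * l + e2)) * e1) + C0 * h powr \<gamma>) * d"
    by (simp add: algebra_simps)
  also have "\<dots> \<le> (\<rho> * (C2 * h powr \<gamma>) + C1 * h powr \<gamma> + C0 * h powr \<gamma>) * d"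
  proof -
    have "(2 + (2 * l + e2)) * e2 \<le> (2 + \<kappa>) * e2" using le\<kappa> nn by (intro mult_right_mono) auto
    then have *: "(2 + (2 * l + e2)) * e2 \<le> \<rho> * (C2 * h powr \<gamma>)" using e2_le by linarith
    have "(2 + (2 * l + e2)) * e1 \<le> (2 + \<kappa>) * e1" using le\<kappa> nn by (intro mult_right_mono) auto
    also have "\<dots> \<le> 1 * (C1 * h powr \<gamma>)"
      by (rule order_trans[OF e1_le mult_right_mono]) (use \<rho> pos in auto)
    finally have "2 * l * ((2 + (2 * l + e2)) * e1) \<le> 1 * (1 * (C1 * h powr \<gamma>))"
      by (rule mult_mono[rotated]) (use le\<kappa> \<kappa> nn pos in auto)
    with * d0 show ?thesis by (intro mult_right_mono) auto
  qed
  also have "\<dots> = (\<rho> * C2 + (C0 + C1)) * h powr \<gamma> * d"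
    by (simp add: algebra_simps)
  also have "\<dots> \<le> (\<rho> * C2 + (1 - \<rho>) * C2) * h powr \<gamma> * d"
    using C(2) d0 by (intro mult_right_mono add_left_mono) auto
  finally show ?case
    using sup by (simp add: h_def d_def algebra_simps)
qed

text \<open>The constant is independent of \<open>n\<close> because the composition is compared with
  the single map \<open>m t s\<close> in the Lipschitz norm, instead of multiplying the constants of
  its factors.\<close>

lemma dyadic_lipschitz:
  assumes "0 \<le> s" "s \<le> t" "t \<le> T" "t - s \<le> \<delta>"
  shows "norm (dyadic m n t s x - dyadic m n t s y) \<le> (1 + \<kappa>) * norm (x - y)"
proof -
  have "norm (((dyadic m n t s x - m t s x) - (dyadic m n t s y - m t s y)) + ((m t s x - x) - (m t s y - y)) + (x - y))
     \<le> C2 * (t - s) powr \<gamma> * norm (x - y) + L * (t - s) powr \<theta> * norm (x - y) + norm (x - y)"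
    using dyadic_estimates[OF assms] by (intro norm_triangle_mono lip assms) auto
  also have "\<dots> \<le> C2 * \<delta> powr \<gamma> * norm (x - y) + L * \<delta> powr \<theta> * norm (x - y) + norm (x - y)"
    using pos assms by (intro add_mono mult_right_mono mult_left_mono powr_mono2) auto
  also have "\<dots> = (1 + (C2 * \<delta> powr \<gamma> + L * \<delta> powr \<theta>)) * norm (x - y)" by (simp add: algebra_simps)
  also have "\<dots> \<le> (1 + \<kappa>) * norm (x - y)"
  proof -
    have "0 \<le> L * \<delta> powr \<theta>" using pos by simp
    then show ?thesis using \<delta> by (intro mult_right_mono) auto
  qed
  finally show ?thesis by simp
qed

text \<open>The outer factor is exchanged first, at the point \<open>\<psi> u s x\<close>, so that
  the Lipschitz bound falls on the dyadic maps and not on \<open>\<psi>\<close>. The error of order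
  \<gamma> decays like \<open>\<rho> ^ n\<close>, while the perturbation \<eta> grows like
  \<open>(2 + \<kappa>) ^ n\<close>.\<close>

lemma flow_close_to_dyadic:
  assumes flow: "flow T \<psi>" and "0 \<le> C"
    and close: "\<And>s t x. 0 \<le> s \<Longrightarrow> s \<le> t \<Longrightarrow> t \<le> T \<Longrightarrow> t - s \<le> \<delta> \<Longrightarrow>
      norm (\<psi> t s x - m t s x) \<le> C * (t - s) powr \<gamma> + \<eta>"
    and st: "0 \<le> s" "s \<le> t" "t \<le> T" "t - s \<le> \<delta>"
  shows "norm (\<psi> t s x - dyadic m n t s x) \<le> C * \<rho> ^ n * (t - s) powr \<gamma> + (2 + \<kappa>) ^ n * \<eta>"
  using st
proof (induction n arbitrary: s t x)
  case 0
  then show ?case using close by simp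
next
  case (Suc n)
  define u where "u = (s + t) / 2"
  define h where "h = t - s"
  have h: "0 \<le> h" "h \<le> \<delta>" using Suc.prems by (auto simp: h_def)
  have u: "s \<le> u" "u \<le> t" "t - u = h / 2" "u - s = h / 2"
    using Suc.prems by (auto simp: u_def h_def field_simps)
  let ?M = "dyadic m n" and ?e = "C * \<rho> ^ n * (h / 2) powr \<gamma> + (2 + \<kappa>) ^ n * \<eta>"
  have 1: "norm (\<psi> t u (\<psi> u s x) - ?M t u (\<psi> u s x)) \<le> ?e"
    using Suc.IH[of u t "\<psi> u s x"] Suc.prems u h by simp
  have "norm (?M t u (\<psi> u s x) - ?M t u (?M u s x)) \<le> (1 + \<kappa>) * norm (\<psi> u s x - ?M u s x)"
    by (rule dyadic_lipschitz) (use Suc.prems u h in auto)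
  also have "\<dots> \<le> (1 + \<kappa>) * ?e"
    using Suc.IH[of s u x] Suc.prems u h \<kappa> by (intro mult_left_mono) auto
  finally have 2: "norm (?M t u (\<psi> u s x) - ?M t u (?M u s x)) \<le> (1 + \<kappa>) * ?e" .
  have "norm (\<psi> t s x - dyadic m (Suc n) t s x) \<le> ?e + (1 + \<kappa>) * ?e"
    using norm_triangle_mono[OF 1 2] flowD[OF flow, of s u t x] Suc.prems u by (simp add: u_def)
  also have "\<dots> = ((2 + \<kappa>) * 2 powr (- \<gamma>)) * (C * \<rho> ^ n * h powr \<gamma>) + (2 + \<kappa>) ^ Suc n * \<eta>"
    using h by (simp add: powr_half algebra_simps)
  also have "\<dots> \<le> \<rho> * (C * \<rho> ^ n * h powr \<gamma>) + (2 + \<kappa>) ^ Suc n * \<eta>"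
    using \<open>0 \<le> C\<close> \<rho> by (intro add_right_mono mult_right_mono) auto
  finally show ?case by (simp add: h_def mult.assoc mult.left_commute)
qed

lemma flow_lipschitz:
  assumes "flow T \<phi>" "0 \<le> C"
    and "\<And>s t x. 0 \<le> s \<Longrightarrow> s \<le> t \<Longrightarrow> t \<le> T \<Longrightarrow> t - s \<le> \<delta> \<Longrightarrow>
      norm (\<phi> t s x - m t s x) \<le> C * (t - s) powr \<gamma>"
    and st: "0 \<le> s" "s \<le> t" "t \<le> T" "t - s \<le> \<delta>"
  shows "norm (\<phi> t s x - \<phi> t s y) \<le> 2 * norm (x - y)"
proof -
  have "(\<lambda>n. 2 * (C * \<rho> ^ n * (t - s) powr \<gamma>) + (1 + \<kappa>) * norm (x - y)) \<longlonglongrightarrow>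
      2 * (C * 0 * (t - s) powr \<gamma>) + (1 + \<kappa>) * norm (x - y)"
    using \<rho> by (intro tendsto_intros LIMSEQ_power_zero) auto
  moreover have "norm (\<phi> t s x - \<phi> t s y) \<le> 2 * (C * \<rho> ^ n * (t - s) powr \<gamma>) + (1 + \<kappa>) * norm (x - y)" for n
  proof -
    have d: "norm (\<phi> t s z - dyadic m n t s z) \<le> C * \<rho> ^ n * (t - s) powr \<gamma>" for z
      using flow_close_to_dyadic[OF assms(1,2), of 0 s t z n] assms(3) st by simp
    have "norm ((\<phi> t s x - dyadic m n t s x) - (\<phi> t s y - dyadic m n t s y)
        + (dyadic m n t s x - dyadic m n t s y)) \<le>
        (C * \<rho> ^ n * (t - s) powr \<gamma> + C * \<rho> ^ n * (t - s) powr \<gamma>) + (1 + \<kappa>) * norm (x - y)"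
      by (intro norm_triangle_mono dyadic_lipschitz st norm_triangle_le_diff add_mono d)
    then show ?thesis by simp
  qed
  ultimately have "norm (\<phi> t s x - \<phi> t s y) \<le> (1 + \<kappa>) * norm (x - y)"
    using LIMSEQ_le_const by fastforce
  also have "\<dots> \<le> 2 * norm (x - y)" using \<kappa> by (intro mult_right_mono) auto
  finally show ?thesis .
qed

lemma flows_converge_locally:
  assumes flow: "flow T \<phi>" "\<And>l. flow T (\<phi>' l)" and "0 \<le> C"
    and close: "\<And>s t x. 0 \<le> s \<Longrightarrow> s \<le> t \<Longrightarrow> t \<le> T \<Longrightarrow> t - s \<le> \<delta> \<Longrightarrow>
      norm (\<phi> t s x - m t s x) \<le> C * (t - s) powr \<gamma>"
    and close': "\<And>\<eta>. 0 < \<eta> \<Longrightarrow> \<forall>\<^sub>F l in F. \<forall>s t x. 0 \<le> s \<longrightarrow> s \<le> t \<longrightarrow> t \<le> T \<longrightarrow> t - s \<le> \<delta> \<longrightarrow>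
      norm (\<phi>' l t s x - m t s x) \<le> C * (t - s) powr \<gamma> + \<eta>"
    and "0 < \<epsilon>"
  shows "\<forall>\<^sub>F l in F. \<forall>s t x. 0 \<le> s \<longrightarrow> s \<le> t \<longrightarrow> t \<le> T \<longrightarrow> t - s \<le> \<delta> \<longrightarrow> norm (\<phi>' l t s x - \<phi> t s x) \<le> \<epsilon>"
proof -
  have "(\<lambda>n. 2 * (C * \<rho> ^ n * \<delta> powr \<gamma>)) \<longlonglongrightarrow> 2 * (C * 0 * \<delta> powr \<gamma>)"
    using \<rho> by (intro tendsto_intros LIMSEQ_power_zero) auto
  from order_tendstoD(2)[OF this, of "\<epsilon> / 2"]
  have "\<forall>\<^sub>F n in sequentially. 2 * (C * \<rho> ^ n * \<delta> powr \<gamma>) < \<epsilon> / 2"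
    using \<open>0 < \<epsilon>\<close> by simp
  then obtain n where n: "2 * (C * \<rho> ^ n * \<delta> powr \<gamma>) < \<epsilon> / 2"
    by (auto simp: eventually_sequentially)
  \<comment> \<open>The number \<open>n\<close> is fixed by now, so the growth
    \<open>(2 + \<kappa>) ^ n\<close> is a constant that \<eta> can compensate.\<close>
  define \<eta> where "\<eta> = \<epsilon> / 2 / (2 + \<kappa>) ^ n"
  have \<eta>: "0 < \<eta>" "(2 + \<kappa>) ^ n * \<eta> = \<epsilon> / 2"
    using \<kappa> \<open>0 < \<epsilon>\<close> by (auto simp: \<eta>_def)
  show ?thesis
    using close'[OF \<eta>(1)]
  proof eventually_elim
    case (elim l)
    show ?case
    proof (intro allI impI)
      fix s t x assume st: "0 \<le> s" "s \<le> t" "t \<le> T" "t - s \<le> \<delta>"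
      have pw: "C * \<rho> ^ n * (t - s) powr \<gamma> \<le> C * \<rho> ^ n * \<delta> powr \<gamma>"
        using \<open>0 \<le> C\<close> \<rho> st pos by (intro mult_left_mono powr_mono2) auto
      have 1: "norm (\<phi> t s x - dyadic m n t s x) \<le> C * \<rho> ^ n * (t - s) powr \<gamma>"
        using flow_close_to_dyadic[OF flow(1) \<open>0 \<le> C\<close>, of 0 s t x n] close st by simp
      have 2: "norm (\<phi>' l t s x - dyadic m n t s x) \<le> C * \<rho> ^ n * (t - s) powr \<gamma> + \<epsilon> / 2"
        using flow_close_to_dyadic[OF flow(2) \<open>0 \<le> C\<close>, of l \<eta> s t x n] elim st \<eta> by simp
      have "norm ((\<phi>' l t s x - dyadic m n t s x) - (\<phi> t s x - dyadic m n t s x)) \<le>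
        (C * \<rho> ^ n * (t - s) powr \<gamma> + \<epsilon> / 2) + C * \<rho> ^ n * (t - s) powr \<gamma>"
        by (intro norm_triangle_le_diff add_mono 1 2)
      then show "norm (\<phi>' l t s x - \<phi> t s x) \<le> \<epsilon>" using n pw by simp
    qed
  qed
qed

end

text \<open>Pieces of length \<delta> are chained. The error of the earlier pieces is transported by
  the limit flow, and the number of pieces depends on \<open>T / \<delta>\<close> only, so the
  factors 2 do not accumulate without bound.\<close>

lemma flows_converge_globally:
  fixes \<phi> :: "real \<Rightarrow> real \<Rightarrow> 'a::real_normed_vector \<Rightarrow> 'a"
  assumes flow: "flow T \<phi>" "\<And>l. flow T (\<phi>' l)" and "0 < \<delta>"
    and lip: "\<And>s t x y. 0 \<le> s \<Longrightarrow> s \<le> t \<Longrightarrow> t \<le> T \<Longrightarrow> t - s \<le> \<delta> \<Longrightarrow> norm (\<phi> t s x - \<phi> t s y) \<le> 2 * norm (x - y)"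
    and loc: "\<And>\<epsilon>. 0 < \<epsilon> \<Longrightarrow> \<forall>\<^sub>F l in F. \<forall>s t x. 0 \<le> s \<longrightarrow> s \<le> t \<longrightarrow> t \<le> T \<longrightarrow> t - s \<le> \<delta> \<longrightarrow>
      norm (\<phi>' l t s x - \<phi> t s x) \<le> \<epsilon>"
  shows "uniform_limit {(s, t, x). 0 \<le> s \<and> s \<le> t \<and> t \<le> T} (\<lambda>l (s, t, x). \<phi>' l t s x) (\<lambda>(s, t, x). \<phi> t s x) F"
proof -
  have steps: "\<forall>\<^sub>F l in F. \<forall>s t x. 0 \<le> s \<longrightarrow> s \<le> t \<longrightarrow> t \<le> T \<longrightarrow> t - s \<le> \<delta> * Suc n \<longrightarrow>
      norm (\<phi>' l t s x - \<phi> t s x) \<le> \<epsilon>" if "0 < \<epsilon>" for n \<epsilon>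
    using that
  proof (induction n arbitrary: \<epsilon>)
    case 0
    then show ?case using loc by simp
  next
    case (Suc n)
    \<comment> \<open>One third for the fresh error on the last piece, two thirds for the earlier
      error after the Lipschitz factor 2.\<close>
    then have "0 < \<epsilon> / 3" by simp
    from loc[OF this] Suc.IH[OF this] show ?case
    proof eventually_elim
      case (elim l)
      show ?case
      proof (intro allI impI)
        fix s t x assume st: "0 \<le> s" "s \<le> t" "t \<le> T" "t - s \<le> \<delta> * Suc (Suc n)"
        define u where "u = max s (t - \<delta>)"
        have u: "s \<le> u" "u \<le> t" "t - u \<le> \<delta>" "u - s \<le> \<delta> * Suc n"
          using st \<open>0 < \<delta>\<close> by (auto simp: u_def algebra_simps)
        have "norm ((\<phi>' l t u (\<phi>' l u s x) - \<phi> t u (\<phi>' l u s x)) + (\<phi> t u (\<phi>' l u s x) - \<phi> t u (\<phi> u s x)))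
          \<le> \<epsilon> / 3 + 2 * norm (\<phi>' l u s x - \<phi> u s x)"
          using elim(1) st u by (intro norm_triangle_mono lip) auto
        also have "norm (\<phi>' l u s x - \<phi> u s x) \<le> \<epsilon> / 3"
          using elim(2) st u by auto
        finally show "norm (\<phi>' l t s x - \<phi> t s x) \<le> \<epsilon>"
          using flowD[OF flow(1), of s u t x] flowD[OF flow(2), of s u t l x] st u by simp
      qed
    qed
  qed
  obtain n :: nat where "T / \<delta> < n" using reals_Archimedean2 by blast
  then have n: "T \<le> \<delta> * Suc n" using \<open>0 < \<delta>\<close> by (simp add: field_simps)
  show ?thesis
  proof (rule uniform_limitI)
    fix e :: real assume "0 < e"
    then have "0 < e / 2" by simp
    from steps[OF this, of n]
    show "\<forall>\<^sub>F l in F. \<forall>x\<in>{(s, t, x). 0 \<le> s \<and> s \<le> t \<and> t \<le> T}.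
        dist (case x of (s, t, x) \<Rightarrow> \<phi>' l t s x) (case x of (s, t, x) \<Rightarrow> \<phi> t s x) < e"
    proof eventually_elim
      case (elim l)
      show ?case
      proof (clarsimp simp: dist_norm)
        fix s t x assume st: "0 \<le> s" "s \<le> t" "t \<le> T"
        then have "norm (\<phi>' l t s x - \<phi> t s x) \<le> e / 2" using elim n by auto
        then show "norm (\<phi>' l t s x - \<phi> t s x) < e" using \<open>0 < e\<close> by linarith
      qed
    qed
  qed
qed

subsection \<open>The local maps of a driven equation\<close>

lemma bdd_lip_precomp:
  assumes "bdd_lip K q" "\<And>x y. norm (g x - g y) \<le> norm (x - y)"
  shows "bdd_lip K (\<lambda>x. q (g x))"
  unfolding bdd_lip_def
  using bdd_lipD[OF assms(1)] assms(2) bdd_lip_nonneg[OF assms(1)] by (meson mult_left_mono order_trans)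

lemma bdd_lip_postcomp:
  assumes "bdd_lip K q" and g: "bounded_linear g" "\<And>x. norm (g x) \<le> norm x"
  shows "bdd_lip K (\<lambda>x. g (q x))"
  unfolding bdd_lip_def linear_diff[OF bounded_linear.linear[OF g(1)], symmetric]
  using bdd_lipD[OF assms(1)] g(2) by (meson order_trans)

lemma second_diff_precomp:
  assumes q: "second_diff K q" and g: "bounded_linear g" "\<And>x. norm (g x) \<le> norm x" and "0 \<le> K"
  shows "second_diff K (\<lambda>x. q (g x))"
  unfolding second_diff_def
proof (intro allI order_trans[OF second_diffD[OF q]])
  fix a b a' b'
  show "K * (norm (g a - g b - (g a' - g b')) + (norm (g a - g b) + norm (g a' - g b')) * (norm (g a - g a') + norm (g b - g b')))
    \<le> K * (norm (a - b - (a' - b')) + (norm (a - b) + norm (a' - b')) * (norm (a - a') + norm (b - b')))"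
    unfolding linear_diff[OF bounded_linear.linear[OF g(1)], symmetric]
    by (intro mult_left_mono add_mono mult_mono g(2) \<open>0 \<le> K\<close>) auto
qed

lemma second_diff_postcomp:
  assumes q: "second_diff K q" and g: "bounded_linear g" "\<And>x. norm (g x) \<le> norm x"
  shows "second_diff K (\<lambda>x. g (q x))"
  unfolding second_diff_def linear_diff[OF bounded_linear.linear[OF g(1)], symmetric]
  by (intro allI order_trans[OF g(2)] second_diffD[OF q])

lemma bdd_lip_linear_combination:
  fixes q :: "'l::finite \<Rightarrow> 'a::real_normed_vector \<Rightarrow> 'b::real_normed_vector" and K B :: real
  assumes "\<And>i. bdd_lip K (q i)" "\<And>i. \<bar>a i\<bar> \<le> B"
  shows "bdd_lip (CARD('l) * (B * K)) (\<lambda>x. \<Sum>i\<in>UNIV. a i *\<^sub>R q i x)"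
proof -
  have "bdd_lip (\<Sum>i\<in>(UNIV::'l set). B * K) (\<lambda>x. \<Sum>i\<in>UNIV. a i *\<^sub>R q i x)"
    using assms bdd_lip_nonneg[OF assms(1)]
    by (intro bdd_lip_sum bdd_lip_mono[OF bdd_lip_scaleR[OF assms(1)]] mult_right_mono) auto
  then show ?thesis by simp
qed

lemma second_diff_linear_combination:
  fixes q :: "'l::finite \<Rightarrow> 'a::real_normed_vector \<Rightarrow> 'b::real_normed_vector" and K B :: real
  assumes "\<And>i. second_diff K (q i)" "\<And>i. \<bar>a i\<bar> \<le> B" "0 \<le> K"
  shows "second_diff (CARD('l) * (B * K)) (\<lambda>x. \<Sum>i\<in>UNIV. a i *\<^sub>R q i x)"
proof -
  have "second_diff (\<Sum>i\<in>(UNIV::'l set). B * K) (\<lambda>x. \<Sum>i\<in>UNIV. a i *\<^sub>R q i x)"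
    using assms by (intro second_diff_sum second_diff_mono[OF second_diff_scaleR[OF assms(1)]] mult_right_mono) auto
  then show ?thesis by simp
qed

lemma bdd_lip_double_combination:
  fixes q :: "'l::finite \<Rightarrow> 'l \<Rightarrow> 'a::real_normed_vector \<Rightarrow> 'b::real_normed_vector" and K B :: real
  assumes "\<And>j k. bdd_lip K (q j k)" "\<And>j k. \<bar>a j k\<bar> \<le> B"
  shows "bdd_lip (CARD('l) * (CARD('l) * (B * K))) (\<lambda>x. \<Sum>j\<in>UNIV. \<Sum>k\<in>UNIV. a j k *\<^sub>R q j k x)"
  using bdd_lip_linear_combination[OF bdd_lip_linear_combination[OF assms], of "\<lambda>_. 1" 1] by simp

lemma second_diff_double_combination:
  fixes q :: "'l::finite \<Rightarrow> 'l \<Rightarrow> 'a::real_normed_vector \<Rightarrow> 'b::real_normed_vector" and K B :: real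
  assumes "\<And>j k. second_diff K (q j k)" "\<And>j k. \<bar>a j k\<bar> \<le> B" "0 \<le> K" "0 \<le> B"
  shows "second_diff (CARD('l) * (CARD('l) * (B * K))) (\<lambda>x. \<Sum>j\<in>UNIV. \<Sum>k\<in>UNIV. a j k *\<^sub>R q j k x)"
  using second_diff_linear_combination[OF second_diff_linear_combination[OF assms(1-3)], of "\<lambda>_. 1" 1] assms(3,4)
  by simp

abbreviation cst :: "real ^ 'd \<Rightarrow> 'd::finite curve" where "cst \<equiv> const_bcontfun"

definition first_order :: "(real \<Rightarrow> real \<Rightarrow> real ^ 'l::finite) \<Rightarrow> ('l \<Rightarrow> 'a \<Rightarrow> 'b::real_vector) \<Rightarrow> real \<Rightarrow> real \<Rightarrow> 'a \<Rightarrow> 'b"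
  where "first_order X F t s = (\<lambda>y. \<Sum>i\<in>UNIV. X t s $ i *\<^sub>R F i y)"

text \<open>The form that \<open>lie_bracket\<close> takes for differentiable fields, where the
  derivative is taken along a constant shift of the curve (\<open>lie_prod_eq\<close>).\<close>

definition bracket ::
  "('l \<Rightarrow> 'd::finite curve \<Rightarrow> real ^ 'd) \<Rightarrow> ('l \<Rightarrow> 'd curve \<Rightarrow> 'd curve \<Rightarrow>\<^sub>L (real ^ 'd)) \<Rightarrow> 'l \<Rightarrow> 'l \<Rightarrow> 'd curve \<Rightarrow> real ^ 'd"
  where "bracket F DF j k y = DF k y (cst (F j y)) - DF j y (cst (F k y))"

definition second_order where
  "second_order h XX V F DF t s = (\<lambda>y. (h t - h s) *\<^sub>R V y +
    (1/2) *\<^sub>R (\<Sum>j\<in>UNIV. \<Sum>k\<in>UNIV. (XX t s $ j $ k :: real) *\<^sub>R bracket F DF j k y))"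

text \<open>The term with \<open>mean_ramp\<close> is the increment along the ramp \<open>u \<mapsto> u w\<close> that the curve follows
  to first order. It depends on the past of the curve, and agrees with half the derivative along
  the constant curve \<open>w\<close> only for fields that do not see the starting point.\<close>

definition local_map where
  "local_map h X XX V F DF t s x = x + first_order X F t s (cst x) + second_order h XX V F DF t s (cst x)
    + first_order X DF t s (cst x) (mean_ramp (first_order X F t s (cst x)))"

text \<open>A single \<beta> serves for \<open>h\<close> and for \<open>XX\<close>. The bound
  \<open>\<beta> \<le> 2 * \<theta>\<close> lets products of two first-order increments count as
  second order, and \<open>1 < \<theta> + \<beta>\<close> makes what remains summable over
  partitions. Lengths are capped at 1 so that larger exponents give smaller powers.\<close>

locale driving_signal =
  fixes T \<theta> \<beta> Q :: real and h :: "real \<Rightarrow> real"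
    and X :: "real \<Rightarrow> real \<Rightarrow> real ^ 'l::finite" and XX :: "real \<Rightarrow> real \<Rightarrow> real ^ 'l ^ 'l"
  assumes exponents: "0 < \<theta>" "\<theta> \<le> \<beta>" "\<beta> \<le> 2 * \<theta>" "1 < \<theta> + \<beta>" and Q: "1 \<le> Q"
    and increments: "\<And>s t. 0 \<le> s \<Longrightarrow> s \<le> t \<Longrightarrow> t \<le> T \<Longrightarrow> t - s \<le> 1 \<Longrightarrow> \<bar>h t - h s\<bar> \<le> Q * (t - s) powr \<beta>"
      "\<And>s t. 0 \<le> s \<Longrightarrow> s \<le> t \<Longrightarrow> t \<le> T \<Longrightarrow> t - s \<le> 1 \<Longrightarrow> norm (X t s) \<le> Q * (t - s) powr \<theta>"
      "\<And>s t. 0 \<le> s \<Longrightarrow> s \<le> t \<Longrightarrow> t \<le> T \<Longrightarrow> t - s \<le> 1 \<Longrightarrow> norm (XX t s) \<le> Q * (t - s) powr \<beta>"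
    and chen: "\<And>s u t. 0 \<le> s \<Longrightarrow> s \<le> u \<Longrightarrow> u \<le> t \<Longrightarrow> t \<le> T \<Longrightarrow> X t s = X u s + X t u"
      "\<And>s u t. 0 \<le> s \<Longrightarrow> s \<le> u \<Longrightarrow> u \<le> t \<Longrightarrow> t \<le> T \<Longrightarrow> XX t s = XX u s + XX t u + tensor (X u s) (X t u)"
    and geometric: "\<And>s t j k. 0 \<le> s \<Longrightarrow> s \<le> t \<Longrightarrow> t \<le> T \<Longrightarrow>
      XX t s $ j $ k + XX t s $ k $ j = X t s $ j * X t s $ k"

locale driven_fields = driving_signal T \<theta> \<beta> Q h X XX
  for T \<theta> \<beta> Q :: real and h :: "real \<Rightarrow> real"
    and X :: "real \<Rightarrow> real \<Rightarrow> real ^ 'l::finite" and XX :: "real \<Rightarrow> real \<Rightarrow> real ^ 'l ^ 'l" +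
  fixes K :: real and V :: "'d::finite curve \<Rightarrow> real ^ 'd" and F :: "'l \<Rightarrow> 'd curve \<Rightarrow> real ^ 'd"
    and DF :: "'l \<Rightarrow> 'd curve \<Rightarrow> 'd curve \<Rightarrow>\<^sub>L (real ^ 'd)"
  assumes K: "1 \<le> K" and V: "bdd_lip K V" and F: "\<And>i. bdd_lip K (F i)"
    and DF: "\<And>i y. (F i has_derivative blinfun_apply (DF i y)) (at y)" "\<And>i. bdd_lip K (DF i)"
begin

text \<open>Dominates every monomial of degree at most 2 in each of \<open>CARD('l)\<close>,
  \<open>Q\<close> and \<open>K\<close> (\<open>A0_ge\<close>). The factor 10 in \<open>A\<close>
  leaves room for the numerical factors of the estimates below, at most 6.\<close>

definition A0 :: real where "A0 = (real CARD('l))\<^sup>2 * Q\<^sup>2 * K\<^sup>2"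
definition A :: real where "A = 10 * A0"

abbreviation P where "P \<equiv> first_order X F"
abbreviation DP where "DP \<equiv> first_order X DF"
abbreviation m where "m \<equiv> local_map h X XX V F DF"

definition cov :: "'l \<Rightarrow> 'l \<Rightarrow> real ^ 'd \<Rightarrow> real ^ 'd" where
  "cov j k x = DF k (cst x) (cst (F j (cst x)))"

text \<open>The obstruction to Davie's scheme: half of \<open>cov\<close> is what Chen's relation
  calls for, the ramp term is what the differential equation yields. It vanishes for Markovian
  fields by \<open>markovian_mean_ramp\<close>.\<close>

definition defect :: "'l \<Rightarrow> 'l \<Rightarrow> real ^ 'd \<Rightarrow> real ^ 'd" where
  "defect j k x = cov j k x - 2 *\<^sub>R DF k (cst x) (mean_ramp (F j (cst x)))"

definition R :: "real \<Rightarrow> real \<Rightarrow> real ^ 'd \<Rightarrow> real ^ 'd" where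
  "R t s x = (h t - h s) *\<^sub>R V (cst x) + (\<Sum>j\<in>UNIV. \<Sum>k\<in>UNIV. XX t s $ j $ k *\<^sub>R cov j k x)"

definition q :: "real \<Rightarrow> real \<Rightarrow> real ^ 'd \<Rightarrow> real ^ 'd" where
  "q t s x = (\<Sum>j\<in>UNIV. \<Sum>k\<in>UNIV. (X t s $ j * X t s $ k) *\<^sub>R defect j k x)"

lemma card_ge_1: "1 \<le> real CARD('l)" by (simp add: Suc_leI)

lemma A0_ge:
  assumes "i \<le> 2" "j \<le> 2" "k \<le> 2"
  shows "real CARD('l) ^ i * Q ^ j * K ^ k \<le> A0"
  unfolding A0_def using assms Q K
  by (intro mult_mono power_increasing card_ge_1) auto

lemma A_ge_1: "1 \<le> A" using A0_ge[of 0 0 0] by (simp add: A_def)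

lemma step_size:
  assumes "0 \<le> \<tau>" "\<tau> \<le> 1" shows "step_size A (\<tau> powr \<theta>) (\<tau> powr \<beta>)"
proof
  show "(\<tau> powr \<theta>)\<^sup>2 \<le> \<tau> powr \<beta>"
    using assms exponents powr_mono'[of \<beta> "2 * \<theta>" \<tau>] by (simp add: power2_eq_square flip: powr_add)
  show "\<tau> powr \<theta> \<le> 1" using assms exponents by (intro powr_le1) auto
  show "\<tau> powr \<beta> \<le> \<tau> powr \<theta>" using assms exponents by (intro powr_mono') auto
qed (use A_ge_1 in auto)

lemma cst_linear: "bounded_linear (cst :: real ^ 'd \<Rightarrow> _)" by (rule bounded_linear_const_bcontfun)

lemma bdd_lip_cst: "bdd_lip c f \<Longrightarrow> bdd_lip c (\<lambda>x. f (cst x))"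
  by (erule bdd_lip_precomp) (simp flip: const_bcontfun_diff)

text \<open>The interval may be shorter than \<tau>, so that both parts of a subdivided interval can
  be measured by powers of the length of the whole.\<close>

context
  fixes s t \<tau> :: real
  assumes st: "0 \<le> s" "s \<le> t" "t \<le> T" "t - s \<le> \<tau>" "\<tau> \<le> 1"
begin

lemma increments': "\<bar>h t - h s\<bar> \<le> Q * \<tau> powr \<beta>" "norm (X t s) \<le> Q * \<tau> powr \<theta>" "norm (XX t s) \<le> Q * \<tau> powr \<beta>"
proof -
  have "(t - s) powr \<beta> \<le> \<tau> powr \<beta>" "(t - s) powr \<theta> \<le> \<tau> powr \<theta>"
    using st exponents by (auto intro!: powr_mono2)
  then have "Q * (t - s) powr \<beta> \<le> Q * \<tau> powr \<beta>" "Q * (t - s) powr \<theta> \<le> Q * \<tau> powr \<theta>"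
    using Q by (auto intro!: mult_left_mono)
  with increments[of s t] st
  show "\<bar>h t - h s\<bar> \<le> Q * \<tau> powr \<beta>" "norm (X t s) \<le> Q * \<tau> powr \<theta>" "norm (XX t s) \<le> Q * \<tau> powr \<beta>"
    by linarith+
qed

lemma component_increments:
  "\<bar>X t s $ j\<bar> \<le> Q * \<tau> powr \<theta>" "\<bar>XX t s $ j $ k\<bar> \<le> Q * \<tau> powr \<beta>" "\<bar>X t s $ j * X t s $ k\<bar> \<le> Q\<^sup>2 * \<tau> powr \<beta>"
proof -
  show 1: "\<bar>X t s $ j\<bar> \<le> Q * \<tau> powr \<theta>" for j
    using component_le_norm_cart[of "X t s" j] increments'(2) by simp
  show "\<bar>XX t s $ j $ k\<bar> \<le> Q * \<tau> powr \<beta>"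
    by (rule order_trans[OF order_trans[OF component_le_norm_cart Finite_Cartesian_Product.norm_nth_le] increments'(3)])
  interpret step_size A "\<tau> powr \<theta>" "\<tau> powr \<beta>" by (rule step_size) (use st in auto)
  have "\<bar>X t s $ j\<bar> * \<bar>X t s $ k\<bar> \<le> (Q * \<tau> powr \<theta>) * (Q * \<tau> powr \<theta>)"
    using Q by (intro mult_mono 1) auto
  also have "\<dots> = Q\<^sup>2 * (\<tau> powr \<theta>)\<^sup>2" by (simp add: power2_eq_square)
  also have "\<dots> \<le> Q\<^sup>2 * \<tau> powr \<beta>" by (intro mult_left_mono b) auto
  finally show "\<bar>X t s $ j * X t s $ k\<bar> \<le> Q\<^sup>2 * \<tau> powr \<beta>" by (simp add: abs_mult)
qed

lemma P_bdd_lip: "bdd_lip (A * \<tau> powr \<theta>) (P t s)"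
  and DP_bdd_lip: "bdd_lip (A * \<tau> powr \<theta>) (DP t s)"
proof -
  have "CARD('l) * (Q * \<tau> powr \<theta> * K) \<le> A * \<tau> powr \<theta>"
    using mult_right_mono[of "real CARD('l) * Q * K" A "\<tau> powr \<theta>"] A0_ge[of 1 1 1] A_ge_1
    by (simp add: algebra_simps A_def)
  note * = bdd_lip_mono[OF bdd_lip_linear_combination this]
  show "bdd_lip (A * \<tau> powr \<theta>) (P t s)" "bdd_lip (A * \<tau> powr \<theta>) (DP t s)"
    unfolding first_order_def by (rule *, auto intro: F DF(2) component_increments(1))+
qed

end

lemma P_derivative: "(P t s has_derivative blinfun_apply (DP t s y)) (at y)"
proof -
  have "(P t s has_derivative (\<lambda>h. \<Sum>i\<in>UNIV. X t s $ i *\<^sub>R DF i y h)) (at y)"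
    unfolding first_order_def by (intro derivative_intros DF)
  moreover have "(\<lambda>h. \<Sum>i\<in>UNIV. X t s $ i *\<^sub>R DF i y h) = blinfun_apply (DP t s y)"
    by (rule ext) (simp add: first_order_def blinfun.sum_left blinfun.scaleR_left)
  ultimately show ?thesis by simp
qed

lemma bracket_bdd_lip: "bdd_lip (4 * K\<^sup>2) (bracket F DF j k)"
proof -
  have "bdd_lip (2 * K * K) (\<lambda>y. DF k y (cst (F j y)))" for j k
    by (intro bdd_lip_blinfun_apply DF bdd_lip_postcomp[OF F cst_linear]) simp
  from bdd_lip_add[OF this bdd_lip_scaleR[OF this, of "-1"], of k j]
  show ?thesis by (simp add: bracket_def[abs_def] power2_eq_square mult.assoc)
qed

lemma cov_bdd_lip: "bdd_lip (2 * K\<^sup>2) (cov j k)"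
proof -
  have "bdd_lip (2 * K * K) (\<lambda>x. DF k (cst x) (cst (F j (cst x))))"
    by (intro bdd_lip_blinfun_apply bdd_lip_cst[OF DF(2)] bdd_lip_cst[OF F]
        bdd_lip_postcomp[OF bdd_lip_cst[OF F] cst_linear]) simp
  then show ?thesis by (simp add: cov_def[abs_def] power2_eq_square mult.assoc)
qed

lemma defect_bdd_lip: "bdd_lip (6 * K\<^sup>2) (defect j k)"
proof -
  have "bdd_lip (2 * K * K) (\<lambda>x. DF k (cst x) (mean_ramp (F j (cst x))))"
    by (intro bdd_lip_blinfun_apply bdd_lip_cst[OF DF(2)]
        bdd_lip_postcomp[OF bdd_lip_cst[OF F] bounded_linear_mean_ramp] norm_mean_ramp_le)
  from bdd_lip_add[OF cov_bdd_lip bdd_lip_scaleR[OF this, of "-2"], of j k]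
  show ?thesis by (simp add: defect_def[abs_def] power2_eq_square mult.assoc)
qed

context
  fixes s t \<tau> :: real
  assumes st: "0 \<le> s" "s \<le> t" "t \<le> T" "t - s \<le> \<tau>" "\<tau> \<le> 1"
begin

lemma second_order_bdd_lip: "bdd_lip (A * \<tau> powr \<beta>) (second_order h XX V F DF t s)"
proof -
  have "bdd_lip (Q * \<tau> powr \<beta> * K + \<bar>1/2\<bar> * (CARD('l) * (CARD('l) * (Q * \<tau> powr \<beta> * (4 * K\<^sup>2)))))
    (second_order h XX V F DF t s)"
    unfolding second_order_def using increments'[OF st] bdd_lip_nonneg[OF V]
    by (intro bdd_lip_add bdd_lip_mono[OF bdd_lip_scaleR[OF V]] mult_right_mono bdd_lip_scaleR
        bdd_lip_double_combination bracket_bdd_lip component_increments[OF st])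
  moreover have "Q * \<tau> powr \<beta> * K + \<bar>1/2\<bar> * (CARD('l) * (CARD('l) * (Q * \<tau> powr \<beta> * (4 * K\<^sup>2))))
      = (Q * K + 2 * ((real CARD('l))\<^sup>2 * Q * K\<^sup>2)) * \<tau> powr \<beta>"
    by (simp add: algebra_simps power2_eq_square)
  moreover have "\<dots> \<le> A * \<tau> powr \<beta>"
    using A0_ge[of 0 0 0] A0_ge[of 0 1 1] A0_ge[of 2 1 2] by (intro mult_right_mono) (auto simp: A_def)
  ultimately show ?thesis by (metis bdd_lip_mono)
qed

lemma q_bdd_lip: "bdd_lip (6 * A0 * \<tau> powr \<beta>) (q t s)"
proof -
  have "bdd_lip (CARD('l) * (CARD('l) * (Q\<^sup>2 * \<tau> powr \<beta> * (6 * K\<^sup>2)))) (q t s)"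
    unfolding q_def by (intro bdd_lip_double_combination defect_bdd_lip component_increments[OF st])
  then show ?thesis by (simp add: A0_def power2_eq_square algebra_simps)
qed

lemma R_bdd_lip: "bdd_lip (3 * A0 * \<tau> powr \<beta>) (R t s)"
proof -
  have "bdd_lip (Q * \<tau> powr \<beta> * K + CARD('l) * (CARD('l) * (Q * \<tau> powr \<beta> * (2 * K\<^sup>2)))) (R t s)"
    unfolding R_def using increments'[OF st] bdd_lip_nonneg[OF V]
    by (intro bdd_lip_add bdd_lip_mono[OF bdd_lip_scaleR[OF bdd_lip_cst[OF V]]] mult_right_mono
        bdd_lip_double_combination cov_bdd_lip component_increments[OF st])
  moreover have "Q * \<tau> powr \<beta> * K + CARD('l) * (CARD('l) * (Q * \<tau> powr \<beta> * (2 * K\<^sup>2)))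
      = (Q * K + 2 * ((real CARD('l))\<^sup>2 * Q * K\<^sup>2)) * \<tau> powr \<beta>"
    by (simp add: algebra_simps power2_eq_square)
  moreover have "\<dots> \<le> 3 * A0 * \<tau> powr \<beta>"
    using A0_ge[of 0 0 0] A0_ge[of 0 1 1] A0_ge[of 2 1 2] by (intro mult_right_mono) auto
  ultimately show ?thesis by (metis bdd_lip_mono)
qed

lemma R_minus_q_bdd_lip: "bdd_lip (A * \<tau> powr \<beta>) (\<lambda>x. R t s x - (1/2) *\<^sub>R q t s x)"
proof -
  have "3 * A0 * \<tau> powr \<beta> + \<bar>-1/2\<bar> * (6 * A0 * \<tau> powr \<beta>) \<le> A * \<tau> powr \<beta>"
    using A0_ge[of 0 0 0] by (simp add: A_def)
  from bdd_lip_mono[OF bdd_lip_add[OF R_bdd_lip bdd_lip_scaleR[OF q_bdd_lip, of "-1/2"]] this]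
  show ?thesis by simp
qed

text \<open>The geometric property expresses the transposed entries of \<open>XX\<close> in the
  bracket term, which becomes the \<open>cov\<close> sum of \<open>R\<close> minus half the same sum
  with coefficients \<open>X t s $ j * X t s $ k\<close>. The ramp term offsets that half up to the
  contribution of \<open>defect\<close>.\<close>

lemma local_map_eq: "m t s x = x + P t s (cst x) + R t s x - (1/2) *\<^sub>R q t s x"
proof -
  let ?S = "\<lambda>f :: 'l \<Rightarrow> 'l \<Rightarrow> real ^ 'd. \<Sum>j\<in>UNIV. \<Sum>k\<in>UNIV. f j k"
  let ?g = "\<lambda>j k. DF k (cst x) (mean_ramp (F j (cst x)))"
  have mr: "mean_ramp (P t s (cst x)) = (\<Sum>j\<in>UNIV. X t s $ j *\<^sub>R mean_ramp (F j (cst x)))"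
  proof -
    have "linear (mean_ramp :: real ^ 'd \<Rightarrow> _)"
      by (rule bounded_linear.linear[OF bounded_linear_mean_ramp])
    then show ?thesis by (simp add: first_order_def linear_sum linear_scale)
  qed
  have 1: "DP t s (cst x) (mean_ramp (P t s (cst x))) = ?S (\<lambda>j k. (X t s $ j * X t s $ k) *\<^sub>R ?g j k)"
    unfolding mr
    by (simp add: first_order_def blinfun.sum_left blinfun.sum_right blinfun.scaleR_left blinfun.scaleR_right
        scaleR_sum_right)
  have "?S (\<lambda>j k. XX t s $ j $ k *\<^sub>R cov k j x) = ?S (\<lambda>j k. XX t s $ k $ j *\<^sub>R cov j k x)"
    by (rule sum.swap)
  also have "\<dots> = ?S (\<lambda>j k. (X t s $ j * X t s $ k - XX t s $ j $ k) *\<^sub>R cov j k x)"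
  proof (intro sum.cong refl)
    fix j k
    have "XX t s $ k $ j = X t s $ j * X t s $ k - XX t s $ j $ k"
      using geometric[OF st(1-3), of j k] by simp
    then show "XX t s $ k $ j *\<^sub>R cov j k x = (X t s $ j * X t s $ k - XX t s $ j $ k) *\<^sub>R cov j k x"
      by simp
  qed
  finally have 2: "?S (\<lambda>j k. XX t s $ j $ k *\<^sub>R bracket F DF j k (cst x)) =
      2 *\<^sub>R ?S (\<lambda>j k. XX t s $ j $ k *\<^sub>R cov j k x) - ?S (\<lambda>j k. (X t s $ j * X t s $ k) *\<^sub>R cov j k x)"
    by (simp add: bracket_def cov_def scaleR_diff_right scaleR_diff_left sum_subtractf scaleR_2)
  have 3: "q t s x = ?S (\<lambda>j k. (X t s $ j * X t s $ k) *\<^sub>R cov j k x)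
      - 2 *\<^sub>R ?S (\<lambda>j k. (X t s $ j * X t s $ k) *\<^sub>R ?g j k)"
    by (simp add: q_def defect_def scaleR_diff_right sum_subtractf scaleR_sum_right mult.left_commute mult.commute)
  show ?thesis
    unfolding local_map_def second_order_def 1 2 3 R_def by (simp add: scaleR_diff_right)
qed

lemma local_map_bdd_lip: "bdd_lip (2 * A * \<tau> powr \<theta>) (\<lambda>x. m t s x - x)"
proof -
  interpret step_size A "\<tau> powr \<theta>" "\<tau> powr \<beta>" by (rule step_size) (use st in auto)
  have "A * \<tau> powr \<theta> + A * \<tau> powr \<beta> \<le> 2 * A * \<tau> powr \<theta>"
    using mult_left_mono[OF b(2) A] by linarith
  from bdd_lip_mono[OF bdd_lip_add[OF bdd_lip_cst[OF P_bdd_lip[OF st]] R_minus_q_bdd_lip] this]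
  show ?thesis by (simp add: local_map_eq add_diff_eq)
qed

lemma time_one_map_close:
  assumes small: "4 * A * \<tau> powr \<theta> \<le> 1"
    and G: "\<And>u y. u \<in> {0..1} \<Longrightarrow> y \<in> curves u \<Longrightarrow> G (u, y) = P t s y + second_order h XX V F DF t s y"
  shows "norm (time_one_map G x - m t s x) \<le> (6 * A ^ 3 + 3 * A\<^sup>2) * \<tau> powr (\<theta> + \<beta>)"
proof -
  interpret step_size A "\<tau> powr \<theta>" "\<tau> powr \<beta>" by (rule step_size) (use st in auto)
  show ?thesis
    using time_one_map_expansion[OF P_bdd_lip[OF st] second_order_bdd_lip P_derivative DP_bdd_lip[OF st] small G]
    by (simp add: local_map_def powr_add)
qed

end

text \<open>The cross term of Chen's relation, contracted with \<open>cov\<close>, is the derivative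
  of \<open>P t u\<close> along the constant shift \<open>P u s (cst x)\<close>: exactly the
  second-order term that the Taylor expansion of \<open>P t u\<close> at the intermediate point
  produces.\<close>

lemma R_chen:
  assumes "0 \<le> s" "s \<le> u" "u \<le> t" "t \<le> T"
  shows "R t s x = R u s x + R t u x + DP t u (cst x) (cst (P u s (cst x)))"
proof -
  let ?S = "\<lambda>f :: 'l \<Rightarrow> 'l \<Rightarrow> real ^ 'd. \<Sum>j\<in>UNIV. \<Sum>k\<in>UNIV. f j k"
  have c: "cst (P u s (cst x)) = (\<Sum>j\<in>UNIV. X u s $ j *\<^sub>R cst (F j (cst x)))"
    using bounded_linear.linear[OF cst_linear] by (simp add: first_order_def linear_sum linear_scale)
  have "DP t u (cst x) (cst (P u s (cst x))) = ?S (\<lambda>j k. (X u s $ j * X t u $ k) *\<^sub>R cov j k x)"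
    unfolding c
    by (simp add: first_order_def blinfun.sum_left blinfun.sum_right blinfun.scaleR_left blinfun.scaleR_right
        scaleR_sum_right cov_def)
  then show ?thesis
    using chen(2)[OF assms] by (simp add: R_def tensor_def scaleR_add_left sum.distrib scaleR_diff_left)
qed

definition cst_blinfun :: "(real ^ 'd) \<Rightarrow>\<^sub>L 'd curve" where "cst_blinfun = Blinfun cst"

lemma cst_blinfun_apply [simp]: "cst_blinfun x = cst x"
  by (simp add: cst_blinfun_def bounded_linear_Blinfun_apply cst_linear)

lemma P_cst_derivative:
  "((\<lambda>x. P t s (cst x)) has_derivative blinfun_apply (DP t s (cst x) o\<^sub>L cst_blinfun)) (at x)"
proof -
  have "((\<lambda>x. P t s (cst x)) has_derivative (\<lambda>h. DP t s (cst x) (cst h))) (at x)"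
    by (rule has_derivative_compose[OF bounded_linear_imp_has_derivative[OF cst_linear] P_derivative])
  moreover have "(\<lambda>h. DP t s (cst x) (cst h)) = blinfun_apply (DP t s (cst x) o\<^sub>L cst_blinfun)"
    by (rule ext) simp
  ultimately show ?thesis by simp
qed

lemma bounded_linear_compose_cst: "bounded_linear (\<lambda>D :: 'd curve \<Rightarrow>\<^sub>L (real ^ 'd). D o\<^sub>L cst_blinfun)"
  by (rule bounded_bilinear.bounded_linear_left[OF bounded_bilinear_blinfun_compose])

lemma norm_compose_cst_le: "norm (D o\<^sub>L cst_blinfun) \<le> norm D" for D :: "'d curve \<Rightarrow>\<^sub>L (real ^ 'd)"
proof -
  have "norm cst_blinfun \<le> 1"
    by (rule norm_blinfun_bound) auto
  then show ?thesis
    using norm_blinfun_compose[of D cst_blinfun] mult_left_mono[of "norm cst_blinfun" 1 "norm D"] by simp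
qed

context
  fixes s u t :: real
  assumes sut: "0 \<le> s" "s \<le> u" "u \<le> t" "t \<le> T" "t - s \<le> 1"
begin

text \<open>By \<open>R_chen\<close> all second-order terms cancel but those of \<open>q\<close>.
  The change of \<open>q\<close> between \<open>x\<close> and the intermediate point
  \<open>Y\<close> is of order \<theta> + \<beta>; its failure to be additive in time at a fixed
  \<open>x\<close> is in general only of second order and is kept apart.\<close>

lemma composition_eq:
  fixes x
  defines "Y \<equiv> x + P u s (cst x) + (R u s x - (1/2) *\<^sub>R q u s x)"
  shows "m t u (m u s x) - m t s x = (P t u (cst Y) - P t u (cst x) - DP t u (cst x) (cst (P u s (cst x)))
      + (R t u Y - R t u x)) - (1/2) *\<^sub>R (q t u Y - q t u x)
      + (1/2) *\<^sub>R (q t s x - q u s x - q t u x)"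
proof -
  have Y: "m u s x = Y"
    using local_map_eq[of s u 1 x] sut by (simp add: Y_def)
  have P: "P t s (cst x) = P u s (cst x) + P t u (cst x)"
    using chen(1)[OF sut(1-4)] by (simp add: first_order_def scaleR_add_left sum.distrib)
  have mY: "m t u Y = Y + P t u (cst Y) + R t u Y - (1/2) *\<^sub>R q t u Y"
    using local_map_eq[of u t 1 Y] sut by simp
  have mx: "m t s x = x + P t s (cst x) + R t s x - (1/2) *\<^sub>R q t s x"
    using local_map_eq[of s t 1 x] sut by simp
  have cancel: "(Y' + p + r - (1/2) *\<^sub>R q1) - (x + (a + b) + (c + d + e) - (1/2) *\<^sub>R q2)
      = ((p - b - e) + (r - d)) - (1/2) *\<^sub>R (q1 - q3) + (1/2) *\<^sub>R (q2 - q0 - q3)"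
    if "Y' = x + a + (c - (1/2) *\<^sub>R q0)" for Y' x a b c d e p r q0 q1 q2 q3 :: "real ^ 'd"
    using that by (simp add: scaleR_diff_right)
  show ?thesis
    unfolding Y mY mx P R_chen[OF sut(1-4)] by (rule cancel) (simp add: Y_def)
qed

lemma almost_flow:
  "norm (m t u (m u s x) - m t s x - (1/2) *\<^sub>R (q t s x - q u s x - q t u x))
    \<le> (4 * A ^ 3 + 5 * A\<^sup>2) * (t - s) powr (\<theta> + \<beta>)"
proof -
  define \<tau> where "\<tau> = t - s"
  define a b where "a = \<tau> powr \<theta>" and "b = \<tau> powr \<beta>"
  interpret step_size A a b unfolding a_def b_def by (rule step_size) (use sut in \<open>auto simp: \<tau>_def\<close>)
  have us: "0 \<le> s" "s \<le> u" "u \<le> T" "u - s \<le> \<tau>" "\<tau> \<le> 1"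
    and tu: "0 \<le> u" "u \<le> t" "t \<le> T" "t - u \<le> \<tau>" "\<tau> \<le> 1"
    using sut by (auto simp: \<tau>_def)
  define Y where "Y = x + P u s (cst x) + (R u s x - (1/2) *\<^sub>R q u s x)"
  have Y: "norm (Y - x) \<le> 2 * A * a"
    using bdd_lipD(1)[OF local_map_bdd_lip[OF us], of x] local_map_eq[OF us, of x] by (simp add: Y_def a_def algebra_simps)
  have 1: "norm (P t u (cst Y) - P t u (cst x) - (DP t u (cst x) o\<^sub>L cst_blinfun) (P u s (cst x))
      + (R t u Y - R t u x)) \<le> (4 * A ^ 3 + 3 * A\<^sup>2) * (a * b)"
    unfolding Y_def
  proof (rule davie_remainder)
    show "norm (P u s (cst z)) \<le> A * a" for z
      using bdd_lipD(1)[OF P_bdd_lip[OF us]] by (simp add: a_def)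
    show "norm (R u s z - (1/2) *\<^sub>R q u s z) \<le> A * b" for z
      using bdd_lipD(1)[OF R_minus_q_bdd_lip[OF us]] by (simp add: b_def)
    show "bdd_lip (A * a) (\<lambda>x. DP t u (cst x) o\<^sub>L cst_blinfun)"
      unfolding a_def
      by (rule bdd_lip_postcomp[OF bdd_lip_cst[OF DP_bdd_lip[OF tu]] bounded_linear_compose_cst norm_compose_cst_le])
    show "bdd_lip (A * b) (R t u)"
      unfolding b_def by (rule bdd_lip_mono[OF R_bdd_lip[OF tu]]) (use A0_ge[of 0 0 0] in \<open>simp add: A_def\<close>)
  qed (rule P_cst_derivative)
  have "norm (q t u Y - q t u x) \<le> 6 * A0 * b * (2 * A * a)"
    by (rule order_trans[OF bdd_lipD(2)[OF q_bdd_lip[OF tu, folded b_def]] mult_left_mono[OF Y]])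
      (use A0_ge[of 0 0 0] b in simp)
  also have "\<dots> \<le> A * b * (2 * A * a)"
    using A a b A0_ge[of 0 0 0] by (intro mult_right_mono) (auto simp: A_def)
  finally have 2: "norm ((1/2) *\<^sub>R (q t u Y - q t u x)) \<le> A * b * (A * a)" by simp
  have "m t u (m u s x) - m t s x - (1/2) *\<^sub>R (q t s x - q u s x - q t u x) =
     (P t u (cst Y) - P t u (cst x) - (DP t u (cst x) o\<^sub>L cst_blinfun) (P u s (cst x))
      + (R t u Y - R t u x)) - (1/2) *\<^sub>R (q t u Y - q t u x)"
    unfolding composition_eq Y_def by simp
  also have "norm \<dots> \<le> (4 * A ^ 3 + 3 * A\<^sup>2) * (a * b) + A * b * (A * a)"
    by (intro norm_triangle_le_diff add_mono 1 2)
  also have "\<dots> \<le> (4 * A ^ 3 + 5 * A\<^sup>2) * (a * b)"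
    using A a b by (simp add: power2_eq_square algebra_simps)
  finally show ?thesis by (simp add: a_def b_def \<tau>_def powr_add)
qed

end

end

text \<open>Second differences are asked along constant curves, where the local maps evaluate the
  fields. They give the Lipschitz form of the almost-flow property, and \<open>defect_zero\<close>
  removes \<open>q\<close> from the composition formula.\<close>

locale markovian_fields = driven_fields T \<theta> \<beta> Q h X XX K V F DF
  for T \<theta> \<beta> Q :: real and h :: "real \<Rightarrow> real"
    and X :: "real \<Rightarrow> real \<Rightarrow> real ^ 'l::finite" and XX :: "real \<Rightarrow> real \<Rightarrow> real ^ 'l ^ 'l"
    and K :: real and V :: "'d::finite curve \<Rightarrow> real ^ 'd" and F :: "'l \<Rightarrow> 'd curve \<Rightarrow> real ^ 'd"
    and DF :: "'l \<Rightarrow> 'd curve \<Rightarrow> 'd curve \<Rightarrow>\<^sub>L (real ^ 'd)" +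
  assumes defect_zero: "\<And>j k x. defect j k x = 0"
    and V_sd: "second_diff K (\<lambda>x. V (cst x))"
    and DF_sd: "\<And>i. second_diff K (\<lambda>x. DF i (cst x))"
begin

lemma q_zero: "q t s x = 0" by (simp add: q_def defect_zero)

lemma F_sd: "second_diff K (\<lambda>x. F i (cst x))"
  by (rule second_diff_precomp[OF second_diff_derivative[OF DF]]) (use K cst_linear in auto)

lemma cov_sd: "second_diff (3 * K\<^sup>2) (cov j k)"
proof -
  have "second_diff (3 * K * K) (\<lambda>x. DF k (cst x) (cst (F j (cst x))))"
    by (intro second_diff_blinfun_apply bdd_lip_cst[OF DF(2)] DF_sd
      bdd_lip_postcomp[OF bdd_lip_cst[OF F] cst_linear] second_diff_postcomp[OF F_sd cst_linear]) simp_all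
  then show ?thesis by (simp add: cov_def[abs_def] power2_eq_square mult.assoc)
qed

context
  fixes s t \<tau> :: real
  assumes st: "0 \<le> s" "s \<le> t" "t \<le> T" "t - s \<le> \<tau>" "\<tau> \<le> 1"
begin

lemma P_sd: "second_diff (A * \<tau> powr \<theta>) (\<lambda>x. P t s (cst x))"
  and DP_sd: "second_diff (A * \<tau> powr \<theta>) (\<lambda>x. DP t s (cst x))"
proof -
  have "CARD('l) * (Q * \<tau> powr \<theta> * K) \<le> A * \<tau> powr \<theta>"
    using mult_right_mono[of "real CARD('l) * Q * K" A "\<tau> powr \<theta>"] A0_ge[of 1 1 1] A_ge_1
    by (simp add: algebra_simps A_def)
  note * = second_diff_mono[OF second_diff_linear_combination this]
  show "second_diff (A * \<tau> powr \<theta>) (\<lambda>x. P t s (cst x))" "second_diff (A * \<tau> powr \<theta>) (\<lambda>x. DP t s (cst x))"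
    unfolding first_order_def by (rule *, use K in \<open>auto intro: F_sd DF_sd component_increments(1)[OF st]\<close>)+
qed

lemma R_sd: "second_diff (A * \<tau> powr \<beta>) (R t s)"
proof -
  have "second_diff (Q * \<tau> powr \<beta> * K + CARD('l) * (CARD('l) * (Q * \<tau> powr \<beta> * (3 * K\<^sup>2)))) (R t s)"
    unfolding R_def using increments'[OF st] K Q
    by (intro second_diff_add second_diff_mono[OF second_diff_scaleR[OF V_sd]] mult_right_mono
        second_diff_double_combination cov_sd component_increments[OF st]) auto
  moreover have "Q * \<tau> powr \<beta> * K + CARD('l) * (CARD('l) * (Q * \<tau> powr \<beta> * (3 * K\<^sup>2)))
      = (Q * K + 3 * ((real CARD('l))\<^sup>2 * Q * K\<^sup>2)) * \<tau> powr \<beta>"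
    by (simp add: algebra_simps power2_eq_square)
  moreover have "\<dots> \<le> A * \<tau> powr \<beta>"
    using A0_ge[of 0 0 0] A0_ge[of 0 1 1] A0_ge[of 2 1 2] by (intro mult_right_mono) (auto simp: A_def)
  ultimately show ?thesis by (metis second_diff_mono)
qed

lemma local_map_sd: "second_diff (2 * A * \<tau> powr \<theta>) (\<lambda>x. m t s x - x)"
proof -
  interpret step_size A "\<tau> powr \<theta>" "\<tau> powr \<beta>" by (rule step_size) (use st in auto)
  have "A * \<tau> powr \<theta> + A * \<tau> powr \<beta> \<le> 2 * A * \<tau> powr \<theta>"
    using mult_left_mono[OF b(2) A] by linarith
  from second_diff_mono[OF second_diff_add[OF P_sd R_sd] this]
  show ?thesis by (simp add: local_map_eq[OF st] q_zero add_diff_eq)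
qed

end

lemma almost_flow_lipschitz:
  assumes sut: "0 \<le> s" "s \<le> u" "u \<le> t" "t \<le> T" "t - s \<le> 1"
  shows "norm ((m t u (m u s x) - m t s x) - (m t u (m u s y) - m t s y))
    \<le> (28 * A ^ 3 + 12 * A\<^sup>2) * (t - s) powr (\<theta> + \<beta>) * norm (x - y)"
proof -
  define \<tau> where "\<tau> = t - s"
  define a b where "a = \<tau> powr \<theta>" and "b = \<tau> powr \<beta>"
  interpret step_size A a b unfolding a_def b_def by (rule step_size) (use sut in \<open>auto simp: \<tau>_def\<close>)
  have us: "0 \<le> s" "s \<le> u" "u \<le> T" "u - s \<le> \<tau>" "\<tau> \<le> 1"
    and tu: "0 \<le> u" "u \<le> t" "t \<le> T" "t - u \<le> \<tau>" "\<tau> \<le> 1"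
    using sut by (auto simp: \<tau>_def)
  have R: "bdd_lip (A * b) (R u s)"
    unfolding b_def by (rule bdd_lip_mono[OF R_bdd_lip[OF us]]) (use A0_ge[of 0 0 0] in \<open>simp add: A_def\<close>)
  note * = davie_remainder_lipschitz[OF bdd_lip_cst[OF P_bdd_lip[OF us, folded a_def]] R P_cst_derivative
      bdd_lip_postcomp[OF bdd_lip_cst[OF DP_bdd_lip[OF tu, folded a_def]] bounded_linear_compose_cst norm_compose_cst_le]
      second_diff_postcomp[OF DP_sd[OF tu, folded a_def] bounded_linear_compose_cst norm_compose_cst_le]
      R_sd[OF tu, folded b_def], of x y]
  show ?thesis
    unfolding composition_eq[OF sut] q_zero
    using * by (simp add: a_def b_def \<tau>_def powr_add add_diff_eq)
qed

end

subsection \<open>Fields on the space of all curves\<close>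

text \<open>Stopping at \<open>T\<close> first makes the field a total map on a Banach space, with
  ordinary derivatives at a point in place of derivatives within \<open>curves a\<close>.\<close>

definition full :: "real \<Rightarrow> (real \<times> 'd::finite curve \<Rightarrow> 'e) \<Rightarrow> 'd curve \<Rightarrow> 'e" where
  "full T F = (\<lambda>y. F (T, stop T y))"

text \<open>The strong Lipschitz condition compares the same curve at the times \<open>a\<close> and
  \<open>T\<close>, where its right-hand side is zero.\<close>

lemma full_eq:
  assumes V: "strongly_lipschitz T V" and y: "0 \<le> a" "a \<le> T" "y \<in> curves a"
  shows "V (a, y) = full T V y"
proof -
  have T: "y \<in> curves T" using curves_mono y by blast
  then have "(a, y) \<in> paths T" "(T, y) \<in> paths T" using y by (auto simp: paths_def)
  then obtain \<kappa> where "norm (V (a, y) - V (T, y)) \<le> \<kappa> * norm (y - y)"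
    using V unfolding strongly_lipschitz_def by blast
  then show ?thesis using T by (simp add: full_def curves_def)
qed

lemma full_derivative:
  assumes "frechet_deriv T F D" "0 \<le> T"
  shows "(full T F has_derivative blinfun_apply (full T D y)) (at y)"
proof -
  have c: "stop T y \<in> curves T" using assms by simp
  have T: "T \<in> {0..T}" using assms(2) by simp
  note D = bspec[OF conjunct1[OF bspec[OF assms(1)[unfolded frechet_deriv_def] T]] c]
  have "((\<lambda>z. F (T, z)) has_derivative blinfun_apply (D (T, stop T y))) (at (stop T y) within range (stop T))"
    using assms(2) by (intro has_derivative_subset[OF conjunct1[OF D]]) auto
  from has_derivative_in_compose[OF bounded_linear_imp_has_derivative[OF bounded_linear_stop] this]
  have "((\<lambda>y. F (T, stop T y)) has_derivative (\<lambda>z. D (T, stop T y) (stop T z))) (at y)" .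
  then show ?thesis
    unfolding full_def conjunct2[OF D, rule_format, symmetric] .
qed

lemma full_bound:
  assumes "unorm T F \<le> ennreal K" "0 \<le> K" "0 \<le> T" shows "norm (full T F y) \<le> K"
proof -
  have "(T, stop T y) \<in> paths T" using assms by (auto simp: paths_def)
  then have "ennreal (norm (F (T, stop T y))) \<le> unorm T F"
    unfolding unorm_def by (rule SUP_upper)
  then show ?thesis using assms by (simp add: full_def order_trans flip: ennreal_le_iff[OF assms(2)])
qed

lemma bdd_lip_of_derivative:
  assumes "\<And>y. (G has_derivative blinfun_apply (D y)) (at y)" "\<And>y. norm (G y) \<le> K" "\<And>y. norm (D y) \<le> K"
  shows "bdd_lip K G"
  unfolding bdd_lip_def
proof (intro conjI allI assms(2))
  fix x y
  show "norm (G x - G y) \<le> K * norm (x - y)"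
    by (rule differentiable_bound[of UNIV G "\<lambda>y. blinfun_apply (D y)"])
      (use assms in \<open>auto simp: norm_blinfun.rep_eq[symmetric]\<close>)
qed

lemma full_bdd_lip:
  assumes "frechet_deriv T F D" "unorm T F \<le> ennreal K" "unorm T D \<le> ennreal K" "0 \<le> K" "0 \<le> T"
  shows "bdd_lip K (full T F)"
  by (rule bdd_lip_of_derivative[of _ "full T D"]) (use assms full_derivative full_bound in auto)

lemma full_extend [simp]: "full T (extend T D) = full T D"
  by (simp add: full_def extend_def)

lemma unorm_le_fine_norms:
  "unorm T F \<le> fine3_norm T F" "unorm T F \<le> fine2_norm T F" "unorm T F \<le> fine1_norm T F"
  "C1_norm T F \<le> fine1_norm T F"
proof -
  show "unorm T F \<le> fine3_norm T F"
    unfolding fine3_norm_def by (rule INF_greatest, clarify, (rule add_increasing2[OF zero_le])+, rule order_refl)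
  show "unorm T F \<le> fine2_norm T F"
    unfolding fine2_norm_def by (rule INF_greatest, clarify, (rule add_increasing2[OF zero_le])+, rule order_refl)
  show "unorm T F \<le> fine1_norm T F"
    unfolding fine1_norm_def by (rule INF_greatest, (rule add_increasing2[OF zero_le])+, rule order_refl)
  show "C1_norm T F \<le> fine1_norm T F"
    unfolding fine1_norm_def by (rule INF_greatest, rule add_increasing[OF zero_le], rule order_refl)
qed

lemma ennreal_summand_less:
  fixes x y z :: ennreal
  assumes "x + y < z" shows "x < z" "y < z"
  by (rule le_less_trans[OF _ assms], rule add_increasing2[OF zero_le order_refl] add_increasing[OF zero_le order_refl])+

text \<open>An infimum strictly below \<open>K\<close> supplies a concrete choice of derivatives
  with norms below \<open>K\<close>; the mean value inequality turns the bound on each derivative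
  into a Lipschitz bound one order lower.\<close>

lemma C2_norm_lessE:
  assumes "C2_norm T V < ennreal K" "0 \<le> T" "0 \<le> K"
  obtains D where "bdd_lip K (full T V)" "bdd_lip K D"
    "\<And>y. (full T V has_derivative blinfun_apply (D y)) (at y)"
proof -
  obtain D1 D2 where D: "frechet_deriv T V D1" "frechet_deriv T D1 D2"
    and u: "unorm T V + unorm T D1 + unorm T D2 < ennreal K"
    using assms(1) unfolding C2_norm_def INF_less_iff by auto
  have n: "unorm T V \<le> ennreal K" "unorm T D1 \<le> ennreal K" "unorm T D2 \<le> ennreal K"
    using ennreal_summand_less[OF u] ennreal_summand_less[OF ennreal_summand_less(1)[OF u]]
    by (blast intro: less_imp_le)+
  show ?thesis
    by (rule that[OF full_bdd_lip[OF D(1) n(1,2) assms(3,2)] full_bdd_lip[OF D(2) n(2,3) assms(3,2)]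
        full_derivative[OF D(1) assms(2)]])
qed

text \<open>The \<open>fine1_norm\<close> of the second derivative contains its Frechet
  \<open>C1_norm\<close>, hence a bounded third derivative, and this makes \<open>D'\<close>
  Lipschitz.\<close>

lemma rough_norm_lessE:
  assumes "rough_norm T F < ennreal K" "0 \<le> T" "0 \<le> K"
  obtains D D' where "bdd_lip K (full T F)" "bdd_lip K D" "bdd_lip K D'"
    "\<And>y. (full T F has_derivative blinfun_apply (D y)) (at y)" "\<And>y. (D has_derivative blinfun_apply (D' y)) (at y)"
proof -
  obtain D1 D2 where D: "frechet_deriv T F D1" "frechet_deriv T D1 D2"
    and u: "fine3_norm T F + fine2_norm T (extend T D1) + fine1_norm T (extend T D2) < ennreal K"
    using assms(1) unfolding rough_norm_def INF_less_iff by auto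
  have f: "fine3_norm T F < ennreal K" "fine2_norm T (extend T D1) < ennreal K" "fine1_norm T (extend T D2) < ennreal K"
    using ennreal_summand_less[OF u] ennreal_summand_less[OF ennreal_summand_less(1)[OF u]] by blast+
  have "C1_norm T (extend T D2) < ennreal K"
    by (rule le_less_trans[OF unorm_le_fine_norms(4) f(3)])
  then obtain D3 where D3: "frechet_deriv T (extend T D2) D3" and u3: "unorm T (extend T D2) + unorm T D3 < ennreal K"
    unfolding C1_norm_def INF_less_iff by auto
  have n: "unorm T F \<le> ennreal K" "unorm T (extend T D1) \<le> ennreal K" "unorm T (extend T D2) \<le> ennreal K"
    "unorm T D3 \<le> ennreal K"
    using order_trans[OF unorm_le_fine_norms(1) less_imp_le[OF f(1)]]
      order_trans[OF unorm_le_fine_norms(2) less_imp_le[OF f(2)]]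
      order_trans[OF unorm_le_fine_norms(3) less_imp_le[OF f(3)]] ennreal_summand_less(2)[OF u3]
    by (blast intro: less_imp_le)+
  note b = full_bound[OF n(1) assms(3,2)] full_bound[OF n(2) assms(3,2), unfolded full_extend]
    full_bound[OF n(3) assms(3,2), unfolded full_extend] full_bound[OF n(4) assms(3,2)]
  note d = full_derivative[OF D(1) assms(2)] full_derivative[OF D(2) assms(2)]
    full_derivative[OF D3 assms(2), unfolded full_extend]
  show ?thesis
    by (rule that[of "full T D1" "full T D2"])
      (rule bdd_lip_of_derivative[OF d(1) b(1,2)] bdd_lip_of_derivative[OF d(2) b(2,3)]
        bdd_lip_of_derivative[OF d(3) b(3,4)] d(1) d(2))+
qed

lemma lie_prod_eq:
  assumes W: "strongly_lipschitz T W" "\<And>y. (full T W has_derivative blinfun_apply (D y)) (at y)"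
    and y: "0 \<le> a" "a \<le> T" "y \<in> curves a"
  shows "lie_prod V W (a, y) = D y (cst (V (a, y)))"
proof -
  let ?v = "cst (V (a, y))"
  have "W (a, y + \<epsilon> *\<^sub>R ?v) = full T W (y + \<epsilon> *\<^sub>R ?v)" for \<epsilon>
    by (intro full_eq W y curves_add curves_scaleR const_in_curves)
  moreover have "((\<lambda>\<epsilon>. full T W (y + \<epsilon> *\<^sub>R ?v)) has_vector_derivative D y ?v) (at 0)"
  proof -
    have "((\<lambda>\<epsilon>. full T W (y + \<epsilon> *\<^sub>R ?v)) has_derivative (\<lambda>h. D (y + 0 *\<^sub>R ?v) (0 + h *\<^sub>R ?v))) (at 0)"
      by (intro has_derivative_compose[OF _ W(2)] derivative_intros)
    then show ?thesis by (simp add: has_vector_derivative_def blinfun.scaleR_right)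
  qed
  ultimately show ?thesis by (simp add: lie_prod_def vector_derivative_at)
qed

lemma driving_field_eq:
  assumes V: "strongly_lipschitz T V" and F: "\<And>i. strongly_lipschitz T (F i)"
    "\<And>i y. (full T (F i) has_derivative blinfun_apply (DF i y)) (at y)"
    and y: "0 \<le> a" "a \<le> T" "y \<in> curves a"
  shows "driving_field h X XX V F t s (a, y) = first_order X (\<lambda>i. full T (F i)) t s y
    + second_order h XX (full T V) (\<lambda>i. full T (F i)) DF t s y"
  by (simp add: driving_field_def first_order_def second_order_def lie_bracket_def bracket_def
      full_eq[OF V y] full_eq[OF F(1) y] lie_prod_eq[OF F y])

subsection \<open>Negligible quadratic variations\<close>

text \<open>When \<open>X t s = X u s + X t u\<close>, this is the symmetrised product of
  \<open>X u s\<close> and \<open>X t u\<close>, the failure of squared increments to be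
  additive.\<close>

definition cross :: "(real \<Rightarrow> real \<Rightarrow> real ^ 'l::finite) \<Rightarrow> real \<Rightarrow> real \<Rightarrow> real \<Rightarrow> real ^ 'l ^ 'l" where
  "cross X t u s = tensor (X t s) (X t s) - tensor (X u s) (X u s) - tensor (X t u) (X t u)"

definition cross_bound :: "real \<Rightarrow> (real \<Rightarrow> real \<Rightarrow> real ^ 'l::finite) \<Rightarrow> real \<Rightarrow> real \<Rightarrow> real \<Rightarrow> real ^ 'l ^ 'l \<Rightarrow> bool" where
  "cross_bound T X \<gamma> \<delta> C S \<longleftrightarrow> (\<forall>s u t. 0 \<le> s \<longrightarrow> s \<le> u \<longrightarrow> u \<le> t \<longrightarrow> t \<le> T \<longrightarrow> t - s \<le> \<delta> \<longrightarrow>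
     \<bar>cross X t u s \<bullet> S\<bar> \<le> C * (t - s) powr \<gamma>)"

text \<open>Determined by the signal and not by the fields: the existence of flows for different
  fields gives information on one and the same subspace.\<close>

definition negligible_tensors :: "real \<Rightarrow> (real \<Rightarrow> real \<Rightarrow> real ^ 'l::finite) \<Rightarrow> (real ^ 'l ^ 'l) set" where
  "negligible_tensors T X = {S. \<exists>\<gamma>>1. \<exists>\<delta>>0. \<exists>C\<ge>0. cross_bound T X \<gamma> \<delta> C S}"

lemma negligibleI:
  "1 < \<gamma> \<Longrightarrow> 0 < \<delta> \<Longrightarrow> 0 \<le> C \<Longrightarrow> cross_bound T X \<gamma> \<delta> C S \<Longrightarrow> S \<in> negligible_tensors T X"
  unfolding negligible_tensors_def by blast

lemma cross_bound_mono:
  assumes "cross_bound T X \<gamma> \<delta> C S" "\<gamma>' \<le> \<gamma>" "\<delta>' \<le> \<delta>" "\<delta>' \<le> 1" "C \<le> C'" "0 \<le> C"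
  shows "cross_bound T X \<gamma>' \<delta>' C' S"
  unfolding cross_bound_def
proof (intro allI impI)
  fix s u t :: real assume st: "0 \<le> s" "s \<le> u" "u \<le> t" "t \<le> T" "t - s \<le> \<delta>'"
  have "\<bar>cross X t u s \<bullet> S\<bar> \<le> C * (t - s) powr \<gamma>"
    using assms(1,3) st unfolding cross_bound_def by auto
  also have "\<dots> \<le> C' * (t - s) powr \<gamma>'"
    using assms st by (intro mult_mono powr_mono') auto
  finally show "\<bar>cross X t u s \<bullet> S\<bar> \<le> C' * (t - s) powr \<gamma>'" .
qed

lemma subspace_negligible: "subspace (negligible_tensors T X)"
  unfolding subspace_def
proof (intro conjI ballI allI)
  show "0 \<in> negligible_tensors T X"
    by (rule negligibleI[of 2 1 0]) (simp_all add: cross_bound_def)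
next
  fix x y assume "x \<in> negligible_tensors T X" "y \<in> negligible_tensors T X"
  then obtain g1 d1 C1 g2 d2 C2 where 1: "1 < g1" "0 < d1" "0 \<le> C1" "cross_bound T X g1 d1 C1 x"
    and 2: "1 < g2" "0 < d2" "0 \<le> C2" "cross_bound T X g2 d2 C2 y"
    unfolding negligible_tensors_def by auto
  define g d where "g = min g1 g2" and "d = min 1 (min d1 d2)"
  have "cross_bound T X g d C1 x" "cross_bound T X g d C2 y"
    by (rule cross_bound_mono[OF 1(4)] cross_bound_mono[OF 2(4)]; use 1 2 in \<open>auto simp: g_def d_def\<close>)+
  then have "cross_bound T X g d (C1 + C2) (x + y)"
    unfolding cross_bound_def inner_add_right distrib_right
    by (blast intro: order_trans[OF abs_triangle_ineq add_mono])
  then show "x + y \<in> negligible_tensors T X"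
    by (rule negligibleI[rotated 3]) (use 1 2 in \<open>auto simp: g_def d_def\<close>)
next
  fix c :: real and x assume "x \<in> negligible_tensors T X"
  then obtain g d C where 1: "1 < g" "0 < d" "0 \<le> C" "cross_bound T X g d C x"
    unfolding negligible_tensors_def by auto
  then have "cross_bound T X g d (\<bar>c\<bar> * C) (c *\<^sub>R x)"
    unfolding cross_bound_def by (simp add: abs_mult mult.assoc mult_left_mono)
  then show "c *\<^sub>R x \<in> negligible_tensors T X"
    by (rule negligibleI[rotated 3]) (use 1 in auto)
qed

text \<open>The exponent and the constant can be chosen uniformly because the space of tensors is
  finite-dimensional. This is what makes the bounds for the approximating flows uniform although
  their definition only provides constants that depend on the flow.\<close>

lemma negligible_uniform:
  obtains \<gamma> \<delta> C where "1 < \<gamma>" "0 < \<delta>" "\<delta> \<le> 1" "0 \<le> C"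
    "\<And>S. S \<in> negligible_tensors T X \<Longrightarrow> cross_bound T X \<gamma> \<delta> (C * norm S) S"
proof -
  \<comment> \<open>Orthonormality bounds the coefficients of \<open>S\<close> by
    \<open>norm S\<close>, which gives the constant \<open>card B * C\<close> per unit of
    norm.\<close>
  obtain B where B: "B \<subseteq> negligible_tensors T X" "pairwise orthogonal B" "\<And>x. x \<in> B \<Longrightarrow> norm x = 1"
    "independent B" "span B = negligible_tensors T X"
    by (rule orthonormal_basis_subspace[OF subspace_negligible]) blast
  have fin: "finite B" using B(4) by (rule independent_imp_finite)
  have "\<exists>\<gamma> \<delta> C. 1 < \<gamma> \<and> 0 < \<delta> \<and> \<delta> \<le> 1 \<and> 0 \<le> C \<and> (\<forall>b\<in>B. cross_bound T X \<gamma> \<delta> C b)"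
    using fin B(1)
  proof (induction B)
    case empty
    show ?case by (rule exI[of _ 2], rule exI[of _ 1], rule exI[of _ 0]) simp
  next
    case (insert b B)
    then obtain \<gamma> \<delta> C where 1: "1 < \<gamma>" "0 < \<delta>" "\<delta> \<le> 1" "0 \<le> C" "\<forall>b\<in>B. cross_bound T X \<gamma> \<delta> C b"
      by auto
    from insert.prems obtain g d c where 2: "1 < g" "0 < d" "0 \<le> c" "cross_bound T X g d c b"
      unfolding negligible_tensors_def by auto
    have "cross_bound T X (min \<gamma> g) (min \<delta> d) (max C c) b'" if "b' \<in> insert b B" for b'
      using that
    proof (elim insertE)
      show ?thesis if "b' = b" using 1 2 that by (auto intro: cross_bound_mono[OF 2(4)])
      show ?thesis if "b' \<in> B" using 1 2 that by (auto intro: cross_bound_mono[of T X \<gamma> \<delta> C b'])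
    qed
    then show ?case using 1 2
      by (intro exI[of _ "min \<gamma> g"] exI[of _ "min \<delta> d"] exI[of _ "max C c"]) auto
  qed
  then obtain \<gamma> \<delta> C where 1: "1 < \<gamma>" "0 < \<delta>" "\<delta> \<le> 1" "0 \<le> C" and b: "\<And>b. b \<in> B \<Longrightarrow> cross_bound T X \<gamma> \<delta> C b"
    by auto
  show ?thesis
  proof (rule that[of \<gamma> \<delta> "card B * C"])
    fix S assume "S \<in> negligible_tensors T X"
    then have S: "S = (\<Sum>b\<in>B. (S \<bullet> b) *\<^sub>R b)"
      using orthonormal_basis_expand[OF B(2,3) _ fin] B(5) by simp
    show "cross_bound T X \<gamma> \<delta> (card B * C * norm S) S"
      unfolding cross_bound_def
    proof (intro allI impI)
      fix s u t :: real assume st: "0 \<le> s" "s \<le> u" "u \<le> t" "t \<le> T" "t - s \<le> \<delta>"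
      have "cross X t u s \<bullet> S = (\<Sum>b\<in>B. (S \<bullet> b) * (cross X t u s \<bullet> b))"
        by (subst (1) S) (simp add: inner_sum_right)
      also have "\<bar>\<dots>\<bar> \<le> (\<Sum>b\<in>B. norm S * (C * (t - s) powr \<gamma>))"
      proof (rule order_trans[OF sum_abs sum_mono])
        fix b' assume b': "b' \<in> B"
        have "\<bar>S \<bullet> b'\<bar> \<le> norm S"
          using Cauchy_Schwarz_ineq2[of S b'] B(3)[OF b'] by simp
        moreover have "\<bar>cross X t u s \<bullet> b'\<bar> \<le> C * (t - s) powr \<gamma>"
          using b[OF b'] st unfolding cross_bound_def by blast
        ultimately show "\<bar>(S \<bullet> b') * (cross X t u s \<bullet> b')\<bar> \<le> norm S * (C * (t - s) powr \<gamma>)"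
          unfolding abs_mult by (intro mult_mono) auto
      qed
      finally show "\<bar>cross X t u s \<bullet> S\<bar> \<le> card B * C * norm S * (t - s) powr \<gamma>"
        by (simp add: algebra_simps)
    qed
  qed (use 1 in auto)
qed

subsection \<open>Solution flows and their local maps\<close>

context driven_fields
begin

text \<open>The coefficients of one coordinate of \<open>q\<close>. Pairing them with
  \<open>cross\<close> gives the non-additivity of \<open>q\<close> in time (\<open>q_cross\<close>)
  and separates the signal from the fields.\<close>

definition defect_tensor :: "'d \<Rightarrow> real ^ 'd \<Rightarrow> real ^ 'l ^ 'l" where
  "defect_tensor i x = (\<chi> j k. defect j k x $ i)"

lemma q_cross: "(q t s x - q u s x - q t u x) $ i = cross X t u s \<bullet> defect_tensor i x"
  by (simp add: q_def cross_def defect_tensor_def tensor_def inner_vec_def sum_component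
      left_diff_distrib flip: sum_subtractf)

lemma norm_defect_tensor_le: "norm (defect_tensor i x) \<le> 6 * A0"
proof -
  have "norm (defect_tensor i x) \<le> (\<Sum>j\<in>UNIV. norm (defect_tensor i x $ j))"
    unfolding norm_vec_def[of "defect_tensor i x"] by (rule L2_set_le_sum) simp
  also have "\<dots> \<le> (\<Sum>j\<in>(UNIV::'l set). \<Sum>k\<in>(UNIV::'l set). 6 * K\<^sup>2)"
  proof (rule sum_mono)
    fix j
    have "norm (defect_tensor i x $ j) \<le> (\<Sum>k\<in>UNIV. \<bar>defect_tensor i x $ j $ k\<bar>)"
      by (rule norm_le_l1_cart)
    also have "\<dots> \<le> (\<Sum>k\<in>(UNIV::'l set). 6 * K\<^sup>2)"
      using order_trans[OF component_le_norm_cart bdd_lipD(1)[OF defect_bdd_lip]]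
      by (intro sum_mono) (simp add: defect_tensor_def)
    finally show "norm (defect_tensor i x $ j) \<le> (\<Sum>k\<in>(UNIV::'l set). 6 * K\<^sup>2)" .
  qed
  also have "\<dots> = 6 * ((real CARD('l))\<^sup>2 * Q ^ 0 * K\<^sup>2)" by (simp add: power2_eq_square)
  also have "\<dots> \<le> 6 * A0" by (intro mult_left_mono A0_ge) auto
  finally show ?thesis .
qed

lemma local_map_lipschitz:
  assumes "0 \<le> s" "s \<le> t" "t \<le> T" "t - s \<le> 1"
  shows "norm (m t s x - m t s y) \<le> (1 + 2 * A * (t - s) powr \<theta>) * norm (x - y)"
proof -
  have "norm ((m t s x - x) - (m t s y - y) + (x - y)) \<le> 2 * A * (t - s) powr \<theta> * norm (x - y) + norm (x - y)"
    by (intro norm_triangle_mono order_refl bdd_lipD(2)[OF local_map_bdd_lip]) (use assms in auto)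
  then show ?thesis by (simp add: algebra_simps)
qed

text \<open>The composition defect of the local maps is \<open>O(\<bar>t - s\<bar>\<^sup>\<gamma>)\<close> with \<open>\<gamma> > 1\<close> only up to the quadratic
  expression \<open>q\<close>, which comes from the dependence of the fields on the starting point. The
  existence of a solution flow forces that expression to be negligible.\<close>

lemma defect_tensor_negligible:
  assumes flow: "flow T \<phi>"
    and close: "\<And>s t x. 0 \<le> s \<Longrightarrow> s \<le> t \<Longrightarrow> t \<le> T \<Longrightarrow> t - s \<le> \<delta> \<Longrightarrow> norm (\<phi> t s x - m t s x) \<le> c * (t - s) powr \<gamma>"
    and pos: "1 < \<gamma>" "0 < \<delta>" "\<delta> \<le> 1" "0 \<le> c"
  shows "defect_tensor i x \<in> negligible_tensors T X"
proof (rule negligibleI)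
  define g where "g = min \<gamma> (\<theta> + \<beta>)"
  \<comment> \<open>The term \<open>(1 + 2 * A) * c\<close> comes from exchanging the flow for
    \<open>m\<close> in the inner factor, \<open>2 * c\<close> from the outer factor and the whole
    interval, the rest from \<open>almost_flow\<close>; the leading 2 undoes the factor 1/2 before
    \<open>q\<close>.\<close>
  define C where "C = 2 * ((1 + 2 * A) * c + 2 * c + (4 * A ^ 3 + 5 * A\<^sup>2))"
  note A1 = A_ge_1
  show "1 < g" using pos exponents by (simp add: g_def)
  show "0 \<le> C" using pos A1 by (simp add: C_def)
  show "cross_bound T X g \<delta> C (defect_tensor i x)"
    unfolding cross_bound_def
  proof (intro allI impI)
    fix s u t assume st: "0 \<le> s" "s \<le> u" "u \<le> t" "t \<le> T" "t - s \<le> \<delta>"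
    define \<tau> where "\<tau> = t - s"
    have \<tau>: "0 \<le> \<tau>" "\<tau> \<le> 1" using st pos by (auto simp: \<tau>_def)
    have pw: "\<tau> powr \<gamma> \<le> \<tau> powr g" "\<tau> powr (\<theta> + \<beta>) \<le> \<tau> powr g"
      using \<tau> by (auto intro!: powr_mono' simp: g_def)
    have e: "norm (\<phi> t' s' z - m t' s' z) \<le> c * \<tau> powr g" if "s \<le> s'" "s' \<le> t'" "t' \<le> t" for s' t' z
    proof -
      have "norm (\<phi> t' s' z - m t' s' z) \<le> c * (t' - s') powr \<gamma>"
        by (rule close) (use st that in auto)
      also have "\<dots> \<le> c * \<tau> powr \<gamma>"
        using that st pos by (intro mult_left_mono powr_mono2) (auto simp: \<tau>_def)
      also have "\<dots> \<le> c * \<tau> powr g" using pw pos by (intro mult_left_mono)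
      finally show ?thesis .
    qed
    have "norm (m t u (m u s x) - m t u (\<phi> u s x)) \<le> (1 + 2 * A * (t - u) powr \<theta>) * norm (m u s x - \<phi> u s x)"
      by (rule local_map_lipschitz) (use st pos in auto)
    also have "\<dots> \<le> (1 + 2 * A * 1) * (c * \<tau> powr g)"
      using st pos A1 exponents e[of s u x]
      by (intro mult_mono add_left_mono mult_left_mono powr_le1) (auto simp: norm_minus_commute)
    finally have 1: "norm (m t u (m u s x) - m t u (\<phi> u s x)) \<le> (1 + 2 * A) * (c * \<tau> powr g)" by simp
    have 2: "norm (m t u (\<phi> u s x) - \<phi> t u (\<phi> u s x)) \<le> c * \<tau> powr g"
      using e[of u t "\<phi> u s x"] st by (simp add: norm_minus_commute)
    have 3: "norm (\<phi> t s x - m t s x) \<le> c * \<tau> powr g" using e[of s t x] st by simp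
    have 4: "norm (m t u (m u s x) - m t s x) \<le> (1 + 2 * A) * (c * \<tau> powr g) + c * \<tau> powr g + c * \<tau> powr g"
      using norm_triangle_mono[OF norm_triangle_mono[OF 1 2] 3] flowD[OF flow st(1-4), of x] by simp
    have 5: "norm (m t u (m u s x) - m t s x - (1/2) *\<^sub>R (q t s x - q u s x - q t u x))
        \<le> (4 * A ^ 3 + 5 * A\<^sup>2) * \<tau> powr g"
    proof (rule order_trans[OF almost_flow])
      show "(4 * A ^ 3 + 5 * A\<^sup>2) * (t - s) powr (\<theta> + \<beta>) \<le> (4 * A ^ 3 + 5 * A\<^sup>2) * \<tau> powr g"
        using pw A1 by (intro mult_left_mono) (auto simp: \<tau>_def)
    qed (use st pos in auto)
    have "norm ((m t u (m u s x) - m t s x)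
        - (m t u (m u s x) - m t s x - (1/2) *\<^sub>R (q t s x - q u s x - q t u x))) \<le>
        ((1 + 2 * A) * (c * \<tau> powr g) + c * \<tau> powr g + c * \<tau> powr g) + (4 * A ^ 3 + 5 * A\<^sup>2) * \<tau> powr g"
      by (rule order_trans[OF norm_triangle_ineq4 add_mono[OF 4 5]])
    also have "\<dots> = 1/2 * (C * \<tau> powr g)" by (simp add: C_def algebra_simps)
    finally have "norm (q t s x - q u s x - q t u x) \<le> C * \<tau> powr g" by simp
    then show "\<bar>cross X t u s \<bullet> defect_tensor i x\<bar> \<le> C * (t - s) powr g"
      unfolding q_cross[symmetric] \<tau>_def by (rule order_trans[OF component_le_norm_cart])
  qed
qed (use pos in simp)

text \<open>The fields enter through \<open>K\<close> alone, so the constant is common to all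
  systems with that bound. Here \<open>6 * A0\<close> bounds \<open>norm (defect_tensor i x)\<close>
  and \<open>CARD('d)\<close> comes from summing coordinates.\<close>

definition defect_const :: "real \<Rightarrow> real" where
  "defect_const C = 4 * A ^ 3 + 5 * A\<^sup>2 + CARD('d) * (C * (6 * A0))"

lemma almost_flow_uniform:
  assumes cross: "\<And>i. cross_bound T X \<gamma>0 \<delta> (C * norm (defect_tensor i x)) (defect_tensor i x)"
    and "0 \<le> C" "\<delta> \<le> 1" "\<gamma> \<le> \<gamma>0" "\<gamma> \<le> \<theta> + \<beta>"
    and st: "0 \<le> s" "s \<le> u" "u \<le> t" "t \<le> T" "t - s \<le> \<delta>"
  shows "norm (m t u (m u s x) - m t s x) \<le> defect_const C * (t - s) powr \<gamma>"
proof -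
  let ?q = "q t s x - q u s x - q t u x"
  have pw: "(t - s) powr \<gamma>0 \<le> (t - s) powr \<gamma>" "(t - s) powr (\<theta> + \<beta>) \<le> (t - s) powr \<gamma>"
    using assms by (auto intro!: powr_mono')
  have "norm ?q \<le> (\<Sum>i\<in>UNIV. \<bar>?q $ i\<bar>)" by (rule norm_le_l1_cart)
  also have "\<dots> \<le> (\<Sum>i\<in>(UNIV::'d set). C * (6 * A0) * (t - s) powr \<gamma>)"
  proof (rule sum_mono)
    fix i
    have "\<bar>?q $ i\<bar> \<le> C * norm (defect_tensor i x) * (t - s) powr \<gamma>0"
      using cross[of i] st unfolding q_cross cross_bound_def by blast
    also have "\<dots> \<le> C * (6 * A0) * (t - s) powr \<gamma>"
      using \<open>0 \<le> C\<close> A0_ge[of 0 0 0] by (intro mult_mono mult_left_mono norm_defect_tensor_le pw) auto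
    finally show "\<bar>?q $ i\<bar> \<le> C * (6 * A0) * (t - s) powr \<gamma>" .
  qed
  also have "\<dots> = CARD('d) * (C * (6 * A0)) * (t - s) powr \<gamma>" by simp
  finally have "norm ?q \<le> CARD('d) * (C * (6 * A0)) * (t - s) powr \<gamma>" .
  moreover have "norm ((1/2) *\<^sub>R ?q) \<le> norm ?q" by simp
  ultimately have 1: "norm ((1/2) *\<^sub>R ?q) \<le> CARD('d) * (C * (6 * A0)) * (t - s) powr \<gamma>"
    by linarith
  have 2: "norm (m t u (m u s x) - m t s x - (1/2) *\<^sub>R ?q) \<le> (4 * A ^ 3 + 5 * A\<^sup>2) * (t - s) powr \<gamma>"
  proof (rule order_trans[OF almost_flow])
    show "(4 * A ^ 3 + 5 * A\<^sup>2) * (t - s) powr (\<theta> + \<beta>) \<le> (4 * A ^ 3 + 5 * A\<^sup>2) * (t - s) powr \<gamma>"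
      using pw A_ge_1 by (intro mult_left_mono) auto
  qed (use st \<open>\<delta> \<le> 1\<close> in auto)
  show ?thesis
    using norm_triangle_mono[OF 2 1] by (simp add: defect_const_def algebra_simps)
qed

text \<open>The exponent, range and constant that the definition provides for \<open>\<phi>\<close>
  serve to show its defect tensors negligible and as the a priori bound of the halving argument; the
  resulting bound involves none of them.\<close>

lemma solution_flow_close:
  assumes T: "1 \<le> T" and sl: "strongly_lipschitz T V0" "\<And>i. strongly_lipschitz T (F0 i)"
    and full: "V = full T V0" "F = (\<lambda>i. full T (F0 i))"
    and sol: "solution_flow T h X XX V0 F0 \<phi>"
    and negl: "\<And>S. S \<in> negligible_tensors T X \<Longrightarrow> cross_bound T X \<gamma>0 \<delta>0 (C * norm S) S"
    and const: "0 \<le> C" "\<delta>0 \<le> 1" "\<gamma> \<le> \<gamma>0" "\<gamma> \<le> \<theta> + \<beta>" "0 < \<delta>" "\<delta> \<le> \<delta>0" "0 \<le> C1"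
    and \<delta>: "2 * A * \<delta> powr \<theta> \<le> \<kappa>" and \<rho>: "(2 + \<kappa>) * 2 powr (- \<gamma>) \<le> \<rho>" and C1: "defect_const C \<le> (1 - \<rho>) * C1"
    and st: "0 \<le> s" "s \<le> t" "t \<le> T" "t - s \<le> \<delta>"
  shows "norm (\<phi> t s x - m t s x) \<le> C1 * (t - s) powr \<gamma>"
proof -
  obtain \<gamma>1 \<delta>1 c1 where flow: "flow T \<phi>" and 1: "1 < \<gamma>1" "0 < \<delta>1" "0 < c1"
    and sol1: "\<And>s t x. 0 \<le> s \<Longrightarrow> s \<le> t \<Longrightarrow> t \<le> T \<Longrightarrow> t - s \<le> \<delta>1 \<Longrightarrow>
      norm (\<phi> t s x - time_one_map (driving_field h X XX V0 F0 t s) x) \<le> c1 * (t - s) powr \<gamma>1"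
    using sol unfolding solution_flow_def by auto
  have A1: "1 \<le> A" by (rule A_ge_1)
  \<comment> \<open>Makes the field of the differential equation a 1/2-contraction, as its expansion
    requires.\<close>
  obtain \<delta>2 where \<delta>2: "0 < \<delta>2" "\<delta>2 \<le> min 1 \<delta>1" "4 * A * \<delta>2 powr \<theta> \<le> 1"
    using small_step[OF exponents(1), of 1 "min 1 \<delta>1" "4 * A"] 1 by auto
  define \<gamma>2 where "\<gamma>2 = min \<gamma>1 (\<theta> + \<beta>)"
  define c where "c = c1 + (6 * A ^ 3 + 3 * A\<^sup>2)"
  have apriori: "norm (\<phi> t s x - m t s x) \<le> c * (t - s) powr \<gamma>2"
    if st: "0 \<le> s" "s \<le> t" "t \<le> T" "t - s \<le> \<delta>2" for s t x
  proof -
    have pw: "(t - s) powr \<gamma>1 \<le> (t - s) powr \<gamma>2" "(t - s) powr (\<theta> + \<beta>) \<le> (t - s) powr \<gamma>2"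
      using st \<delta>2 by (auto intro!: powr_mono' simp: \<gamma>2_def)
    let ?G = "driving_field h X XX V0 F0 t s"
    have "norm (\<phi> t s x - time_one_map ?G x) \<le> c1 * (t - s) powr \<gamma>1"
      by (rule sol1) (use st \<delta>2 in auto)
    also have "\<dots> \<le> c1 * (t - s) powr \<gamma>2" using pw 1 by (intro mult_left_mono) auto
    finally have 2: "norm (\<phi> t s x - time_one_map ?G x) \<le> c1 * (t - s) powr \<gamma>2" .
    have "norm (time_one_map ?G x - m t s x) \<le> (6 * A ^ 3 + 3 * A\<^sup>2) * (t - s) powr (\<theta> + \<beta>)"
    proof (rule time_one_map_close)
      have "4 * A * (t - s) powr \<theta> \<le> 4 * A * \<delta>2 powr \<theta>"
        using st exponents A1 by (intro mult_left_mono powr_mono2) auto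
      then show "4 * A * (t - s) powr \<theta> \<le> 1" using \<delta>2 by linarith
      show "?G (u, y) = P t s y + second_order h XX V F DF t s y" if "u \<in> {0..1}" "y \<in> curves u" for u y
        unfolding full by (rule driving_field_eq) (use sl DF(1) that T full in auto)
    qed (use st \<delta>2 in auto)
    also have "\<dots> \<le> (6 * A ^ 3 + 3 * A\<^sup>2) * (t - s) powr \<gamma>2"
      using pw A1 by (intro mult_left_mono) auto
    finally have 3: "norm (time_one_map ?G x - m t s x) \<le> (6 * A ^ 3 + 3 * A\<^sup>2) * (t - s) powr \<gamma>2" .
    show ?thesis using norm_triangle_mono[OF 2 3] by (simp add: c_def algebra_simps)
  qed
  have pos: "1 < \<gamma>2" "0 \<le> c" using 1 exponents A1 by (auto simp: \<gamma>2_def c_def)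
  have cross: "cross_bound T X \<gamma>0 \<delta>0 (C * norm (defect_tensor i x)) (defect_tensor i x)" for i x
    by (rule negl, rule defect_tensor_negligible[OF flow apriori pos(1) \<delta>2(1) _ pos(2)]) (use \<delta>2 in auto)
  have lip: "norm (m t s x - m t s y) \<le> (1 + 2 * A * (t - s) powr \<theta>) * norm (x - y)"
    if "0 \<le> s" "s \<le> t" "t \<le> T" "t - s \<le> \<delta>" for s t x y
    by (rule local_map_lipschitz) (use that const in auto)
  have almost: "norm (m t u (m u s x) - m t s x) \<le> defect_const C * (t - s) powr \<gamma>"
    if "0 \<le> s" "s \<le> u" "u \<le> t" "t \<le> T" "t - s \<le> \<delta>" for s u t x
    by (rule almost_flow_uniform[OF cross]) (use that const in auto)
  show ?thesis
    by (rule flow_close_to_almost_flow[OF flow lip almost apriori exponents(1) pos(1) \<delta>2(1) const(5) pos(2) _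
          const(7) \<delta> \<rho> C1 st]) (use A1 in auto)
qed

end

section \<open>Dependence of the local maps on the fields\<close>

lemma norm_linear_combination_le:
  fixes v :: "'l::finite \<Rightarrow> 'a::real_normed_vector" and B e :: real
  assumes "\<And>i. \<bar>a i\<bar> \<le> B" "\<And>i. norm (v i) \<le> e"
  shows "norm (\<Sum>i\<in>UNIV. a i *\<^sub>R v i) \<le> CARD('l) * (B * e)"
proof -
  have "0 \<le> B" using assms(1)[of undefined] by linarith
  have "norm (\<Sum>i\<in>UNIV. a i *\<^sub>R v i) \<le> (\<Sum>i\<in>(UNIV::'l set). B * e)"
    using assms \<open>0 \<le> B\<close> by (intro sum_norm_le) (auto intro: mult_mono)
  then show ?thesis by simp
qed

lemma norm_blinfun_apply_diff_le:
  assumes "norm (M - N) \<le> e" "norm u \<le> k" "norm N \<le> k" "norm (u - v) \<le> e"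
  shows "norm (blinfun_apply M u - blinfun_apply N v) \<le> 2 * k * e"
proof -
  have nn: "0 \<le> e" "0 \<le> k" using assms norm_ge_zero order_trans by blast+
  have "M u - N v = (M - N) u + N (u - v)" by (simp add: blinfun.bilinear_simps)
  also have "norm \<dots> \<le> e * k + k * e"
    by (intro norm_triangle_le add_mono order_trans[OF norm_blinfun mult_mono] assms) (use nn in auto)
  finally show ?thesis by (simp add: algebra_simps)
qed

text \<open>No power of \<open>t - s\<close> appears, so the bound could not be summed over ever
  finer partitions; it is used for a number of factors fixed beforehand.\<close>

lemma local_map_diff_le:
  fixes h X XX K and V V' :: "'d::finite curve \<Rightarrow> real ^ 'd" and F F' :: "'l::finite \<Rightarrow> 'd curve \<Rightarrow> real ^ 'd"
  assumes "driven_fields T \<theta> \<beta> Q h X XX K V F DF" "driven_fields T \<theta> \<beta> Q h X XX K V' F' DF'"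
    and d: "\<And>y. norm (V' y - V y) \<le> \<epsilon>" "\<And>i y. norm (F' i y - F i y) \<le> \<epsilon>" "\<And>i y. norm (DF' i y - DF i y) \<le> \<epsilon>"
    and st: "0 \<le> s" "s \<le> t" "t \<le> T" "t - s \<le> 1"
  shows "norm (local_map h X XX V' F' DF' t s x - local_map h X XX V F DF t s x)
    \<le> 6 * ((real CARD('l))\<^sup>2 * Q\<^sup>2 * K\<^sup>2) * \<epsilon>"
proof -
  interpret a: driven_fields T \<theta> \<beta> Q h X XX K V F DF by fact
  interpret b: driven_fields T \<theta> \<beta> Q h X XX K V' F' DF' by fact
  let ?n = "real CARD('l)" and ?c = "cst x"
  have \<epsilon>: "0 \<le> \<epsilon>" using d(1)[of ?c] norm_ge_zero order_trans by blast
  have inc: "\<bar>h t - h s\<bar> \<le> Q" "\<And>j. \<bar>X t s $ j\<bar> \<le> Q" "\<And>j k. \<bar>XX t s $ j $ k\<bar> \<le> Q"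
    using a.increments'(1)[OF st order_refl] a.component_increments(1,2)[OF st order_refl] by simp_all
  have lin: "norm (first_order X G' t s ?c - first_order X G t s ?c) \<le> ?n * (Q * \<epsilon>)"
    if "\<And>i y. norm (G' i y - G i y) \<le> \<epsilon>" for G G' :: "'l \<Rightarrow> 'd curve \<Rightarrow> 'e::real_normed_vector"
  proof -
    have "first_order X G' t s ?c - first_order X G t s ?c = (\<Sum>i\<in>UNIV. X t s $ i *\<^sub>R (G' i ?c - G i ?c))"
      by (simp add: first_order_def scaleR_diff_right sum_subtractf)
    then show ?thesis using norm_linear_combination_le[OF inc(2) that] by simp
  qed
  have bd: "norm (first_order X G t s ?c) \<le> ?n * (Q * K)"
    if "\<And>i. bdd_lip K (G i)" for G :: "'l \<Rightarrow> 'd curve \<Rightarrow> 'e::real_normed_vector"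
    unfolding first_order_def by (rule norm_linear_combination_le[OF inc(2) bdd_lipD(1)[OF that]])
  have 1: "norm (first_order X F' t s ?c - first_order X F t s ?c) \<le> ?n * (Q * \<epsilon>)"
    by (rule lin[OF d(2)])
  have 2: "norm (first_order X DF' t s ?c (mean_ramp (first_order X F' t s ?c))
      - first_order X DF t s ?c (mean_ramp (first_order X F t s ?c))) \<le> 2 * (?n * (Q * K)) * (?n * (Q * \<epsilon>))"
  proof (rule norm_blinfun_apply_diff_le)
    show "norm (mean_ramp (first_order X F' t s ?c)) \<le> ?n * (Q * K)"
      by (rule order_trans[OF norm_mean_ramp_le bd[OF b.F]])
    show "norm (mean_ramp (first_order X F' t s ?c) - mean_ramp (first_order X F t s ?c)) \<le> ?n * (Q * \<epsilon>)"
      unfolding linear_diff[OF bounded_linear.linear[OF bounded_linear_mean_ramp], symmetric]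
      by (rule order_trans[OF norm_mean_ramp_le 1])
  qed (rule lin[OF d(3)] bd[OF a.DF(2)])+
  have br: "norm (bracket F' DF' j k ?c - bracket F DF j k ?c) \<le> 4 * K * \<epsilon>" for j k
  proof -
    have *: "norm (DF' k ?c (cst (F' j ?c)) - DF k ?c (cst (F j ?c))) \<le> 2 * K * \<epsilon>" for j k
      by (rule norm_blinfun_apply_diff_le)
        (simp_all add: d bdd_lipD(1)[OF b.F] bdd_lipD(1)[OF a.DF(2)] flip: const_bcontfun_diff)
    have "norm ((DF' k ?c (cst (F' j ?c)) - DF k ?c (cst (F j ?c)))
        - (DF' j ?c (cst (F' k ?c)) - DF j ?c (cst (F k ?c)))) \<le> 2 * K * \<epsilon> + 2 * K * \<epsilon>"
      by (intro norm_triangle_le_diff add_mono *)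
    then show ?thesis by (simp add: bracket_def algebra_simps)
  qed
  have 3: "norm (second_order h XX V' F' DF' t s ?c - second_order h XX V F DF t s ?c)
      \<le> Q * \<epsilon> + 1/2 * (?n * (1 * (?n * (Q * (4 * K * \<epsilon>)))))"
  proof -
    have eq: "second_order h XX V' F' DF' t s ?c - second_order h XX V F DF t s ?c = (h t - h s) *\<^sub>R (V' ?c - V ?c)
      + (1/2) *\<^sub>R (\<Sum>j\<in>UNIV. 1 *\<^sub>R (\<Sum>k\<in>UNIV. XX t s $ j $ k *\<^sub>R (bracket F' DF' j k ?c - bracket F DF j k ?c)))"
      by (simp add: second_order_def scaleR_diff_right sum_subtractf)
    have n1: "norm ((h t - h s) *\<^sub>R (V' ?c - V ?c)) \<le> Q * \<epsilon>"
      using inc(1) d(1) a.Q by (auto intro!: mult_mono)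
    have n2: "norm ((1/2) *\<^sub>R (\<Sum>j\<in>(UNIV::'l set). (1::real) *\<^sub>R (\<Sum>k\<in>UNIV. XX t s $ j $ k *\<^sub>R (bracket F' DF' j k ?c - bracket F DF j k ?c))))
        \<le> 1/2 * (?n * (1 * (?n * (Q * (4 * K * \<epsilon>)))))"
      unfolding norm_scaleR
      by (intro mult_mono norm_linear_combination_le inc br) auto
    show ?thesis unfolding eq by (rule norm_triangle_mono[OF n1 n2])
  qed
  have "norm (local_map h X XX V' F' DF' t s x - local_map h X XX V F DF t s x) \<le>
     ?n * (Q * \<epsilon>) + (Q * \<epsilon> + 1/2 * (?n * (1 * (?n * (Q * (4 * K * \<epsilon>))))))
     + 2 * (?n * (Q * K)) * (?n * (Q * \<epsilon>))"
  proof -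
    have "local_map h X XX V' F' DF' t s x - local_map h X XX V F DF t s x =
      (first_order X F' t s ?c - first_order X F t s ?c)
      + (second_order h XX V' F' DF' t s ?c - second_order h XX V F DF t s ?c)
      + (first_order X DF' t s ?c (mean_ramp (first_order X F' t s ?c))
        - first_order X DF t s ?c (mean_ramp (first_order X F t s ?c)))"
      by (simp add: local_map_def)
    then show ?thesis
      by (simp only:) (rule norm_triangle_mono[OF norm_triangle_mono[OF 1 3] 2])
  qed
  also have "\<dots> = (?n * Q + Q + 2 * (?n\<^sup>2 * Q * K) + 2 * (?n\<^sup>2 * Q\<^sup>2 * K)) * \<epsilon>"
    by (simp add: algebra_simps power2_eq_square)
  also have "\<dots> \<le> 6 * a.A0 * \<epsilon>"
    using a.A0_ge[of 1 1 0] a.A0_ge[of 0 1 0] a.A0_ge[of 2 1 1] a.A0_ge[of 2 2 1] \<epsilon>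
    by (intro mult_right_mono) auto
  finally show ?thesis by (simp add: a.A0_def)
qed

text \<open>For \<beta> = min (2/p) \<alpha>: \<open>p < 3\<close> gives 1/p + 2/p > 1, and the
  other case of the minimum is the assumption on \<alpha>. From \<open>2 \<le> p\<close> follows
  \<alpha> > 1 - 1/p \<ge> 1/2 \<ge> 1/p, so \<beta> is at least 1/p.\<close>

lemma driving_signal_of_rough_path:
  fixes X :: "real \<Rightarrow> real \<Rightarrow> real ^ 'l::finite"
  assumes p: "2 \<le> p" "p < 3" and X: "rough_path T p X XX" and h: "holder T \<alpha> h" "\<alpha> + 1 / p > 1"
  obtains Q where "driving_signal T (1 / p) (min (2 / p) \<alpha>) Q h X XX"
proof -
  from X obtain C where C: "\<And>s t. 0 \<le> s \<Longrightarrow> s \<le> t \<Longrightarrow> t \<le> T \<Longrightarrow>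
      norm (X t s) \<le> C * \<bar>t - s\<bar> powr (1 / p) \<and> norm (XX t s) \<le> C * \<bar>t - s\<bar> powr (2 / p)"
    unfolding rough_path_def by blast
  from h(1) obtain C' where C': "\<And>s t. s \<in> {0..T} \<Longrightarrow> t \<in> {0..T} \<Longrightarrow> \<bar>h t - h s\<bar> \<le> C' * \<bar>t - s\<bar> powr \<alpha>"
    unfolding holder_def by blast
  define \<beta> where "\<beta> = min (2 / p) \<alpha>"
  define Q where "Q = max 1 (max C C')"
  have le: "c * (t - s) powr \<gamma> \<le> Q * (t - s) powr \<gamma>'" if "c \<le> Q" "\<gamma>' \<le> \<gamma>" "s \<le> t" "t - s \<le> 1" for c s t \<gamma> \<gamma>'
    using that by (intro mult_mono powr_mono') (auto simp: Q_def)
  have "driving_signal T (1 / p) \<beta> Q h X XX"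
  proof
    show "0 < 1 / p" using p by simp
    show "1 / p \<le> \<beta>"
    proof -
      have "1 / p \<le> 1 / 2" using p by (simp add: field_simps)
      moreover have "1 / p \<le> 2 / p" using p by (simp add: field_simps)
      ultimately show ?thesis using h(2) by (simp add: \<beta>_def)
    qed
    show "\<beta> \<le> 2 * (1 / p)" by (simp add: \<beta>_def)
    show "1 < 1 / p + \<beta>" using p h(2) by (auto simp: \<beta>_def min_def field_simps)
    show "1 \<le> Q" by (simp add: Q_def)
    show "XX t s $ j $ k + XX t s $ k $ j = X t s $ j * X t s $ k"
      if "0 \<le> s" "s \<le> t" "t \<le> T" for s t j k
    proof -
      have "(1/2) *\<^sub>R (XX t s + transpose (XX t s)) = (1/2) *\<^sub>R tensor (X t s) (X t s)"
        using X that unfolding rough_path_def by blast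
      then have "(XX t s + transpose (XX t s)) $ j $ k = tensor (X t s) (X t s) $ j $ k" by simp
      then show ?thesis by (simp add: transpose_def tensor_def)
    qed
  next
    fix s t assume st: "0 \<le> s" "s \<le> t" "t \<le> T" "t - s \<le> 1"
    have "\<bar>h t - h s\<bar> \<le> C' * (t - s) powr \<alpha>" using C'[of s t] st by simp
    also have "\<dots> \<le> Q * (t - s) powr \<beta>" by (rule le) (use st in \<open>auto simp: Q_def \<beta>_def\<close>)
    finally show "\<bar>h t - h s\<bar> \<le> Q * (t - s) powr \<beta>" .
    have "norm (X t s) \<le> C * (t - s) powr (1 / p)" using C[of s t] st by simp
    also have "\<dots> \<le> Q * (t - s) powr (1 / p)" by (rule le) (use st in \<open>auto simp: Q_def\<close>)
    finally show "norm (X t s) \<le> Q * (t - s) powr (1 / p)" .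
    have "norm (XX t s) \<le> C * (t - s) powr (2 / p)" using C[of s t] st by simp
    also have "\<dots> \<le> Q * (t - s) powr \<beta>" by (rule le) (use st in \<open>auto simp: Q_def \<beta>_def\<close>)
    finally show "norm (XX t s) \<le> Q * (t - s) powr \<beta>" .
  next
    fix s u t assume "0 \<le> s" "s \<le> u" "u \<le> t" "t \<le> T"
    then show "X t s = X u s + X t u" "XX t s = XX u s + XX t u + tensor (X u s) (X t u)"
      using X unfolding rough_path_def by blast+
  qed
  then show ?thesis using that by (simp add: \<beta>_def)
qed

text \<open>The curves \<open>cst x + \<epsilon> *\<^sub>R z\<close> and
  \<open>cst x + \<epsilon> *\<^sub>R cst (z T)\<close> have the same value at \<open>T\<close>, so
  a Markovian field agrees on them for every \<epsilon> and the derivatives at 0 are equal.\<close>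

lemma markovian_derivative:
  assumes "markovian T V" "0 \<le> T" and d: "\<And>y. (full T V has_derivative blinfun_apply (D y)) (at y)"
  shows "D (cst x) z = D (cst x) (cst (z T))"
proof -
  have eq: "full T V (cst x + \<epsilon> *\<^sub>R z) = full T V (cst x + \<epsilon> *\<^sub>R cst (z T))" for \<epsilon>
  proof -
    have "V (T, stop T (cst x + \<epsilon> *\<^sub>R z)) = V (T, stop T (cst x + \<epsilon> *\<^sub>R cst (z T)))"
    proof (rule assms(1)[unfolded markovian_def, rule_format])
      show "stop T (cst x + \<epsilon> *\<^sub>R z) T = stop T (cst x + \<epsilon> *\<^sub>R cst (z T)) T"
        using assms(2) by (simp add: const_bcontfun.rep_eq)
    qed (use assms(2) in auto)
    then show ?thesis by (simp add: full_def)
  qed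
  have "((\<lambda>\<epsilon>. full T V (cst x + \<epsilon> *\<^sub>R w)) has_vector_derivative D (cst x) w) (at 0)" for w
  proof -
    have "((\<lambda>\<epsilon>. full T V (cst x + \<epsilon> *\<^sub>R w)) has_derivative (\<lambda>h. D (cst x + 0 *\<^sub>R w) (0 + h *\<^sub>R w))) (at 0)"
      by (intro has_derivative_compose[OF _ d] derivative_intros)
    then show ?thesis by (simp add: has_vector_derivative_def blinfun.scaleR_right)
  qed
  from vector_derivative_unique_at[OF this[of z] this[of "cst (z T)", folded eq]] show ?thesis .
qed

text \<open>As \<open>1 \<le> T\<close>, the averaged ramp has half of \<open>w\<close> as its value
  at \<open>T\<close>, the only value that counts. This is what makes \<open>defect\<close>
  vanish.\<close>

lemma markovian_mean_ramp:
  assumes "markovian T V" "1 \<le> T" "\<And>y. (full T V has_derivative blinfun_apply (D y)) (at y)"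
  shows "2 *\<^sub>R D (cst x) (mean_ramp w) = D (cst x) (cst w)"
  using markovian_derivative[OF assms(1) _ assms(3), of x "mean_ramp w"] assms(2)
  by (simp add: mean_ramp_apply_end const_bcontfun_scaleR blinfun.scaleR_right)

text \<open>The differences are treated as fields in their own right. The derivative of
  \<open>F' i\<close> is built as \<open>DF i\<close> plus that of the difference, so its closeness
  to \<open>DF i\<close> is the smallness of the norm. Since \<epsilon> \<le> 1 the bound grows to
  \<open>K + 1\<close> at most.\<close>

lemma perturbed_fields:
  fixes F F' :: "'l::finite \<Rightarrow> 'd::finite vfield"
  assumes base: "driven_fields T \<theta> \<beta> Q h X XX K (full T V) (\<lambda>i. full T (F i)) DF" and T: "0 \<le> T"
    and V': "C2_norm T (\<lambda>x. V' x - V x) < ennreal \<epsilon>"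
    and F': "\<And>i. rough_norm T (\<lambda>x. F' i x - F i x) < ennreal \<epsilon>" and \<epsilon>: "0 < \<epsilon>" "\<epsilon> \<le> 1"
  obtains DF' where "driven_fields T \<theta> \<beta> Q h X XX (K + 1) (full T V') (\<lambda>i. full T (F' i)) DF'"
    "\<And>y. norm (full T V' y - full T V y) \<le> \<epsilon>" "\<And>i y. norm (full T (F' i) y - full T (F i) y) \<le> \<epsilon>"
    "\<And>i y. norm (DF' i y - DF i y) \<le> \<epsilon>"
proof -
  interpret a: driven_fields T \<theta> \<beta> Q h X XX K "full T V" "\<lambda>i. full T (F i)" DF by fact
  let ?dV = "full T (\<lambda>x. V' x - V x)" and ?dF = "\<lambda>i. full T (\<lambda>x. F' i x - F i x)"
  have V_eq: "full T V' = (\<lambda>y. full T V y + ?dV y)" and F_eq: "full T (F' i) = (\<lambda>y. full T (F i) y + ?dF i y)" for i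
    by (simp_all add: full_def)
  have dV: "bdd_lip \<epsilon> ?dV"
    by (rule C2_norm_lessE[OF V' T]) (use \<epsilon> in auto)
  have "\<forall>i. \<exists>E. bdd_lip \<epsilon> (?dF i) \<and> bdd_lip \<epsilon> E \<and> (\<forall>y. (?dF i has_derivative blinfun_apply (E y)) (at y))"
  proof
    fix i
    show "\<exists>E. bdd_lip \<epsilon> (?dF i) \<and> bdd_lip \<epsilon> E \<and> (\<forall>y. (?dF i has_derivative blinfun_apply (E y)) (at y))"
      by (rule rough_norm_lessE[OF F'[of i] T]) (use \<epsilon> in auto)
  qed
  from choice[OF this] obtain E where E: "\<And>i. bdd_lip \<epsilon> (?dF i)" "\<And>i. bdd_lip \<epsilon> (E i)"
    "\<And>i y. (?dF i has_derivative blinfun_apply (E i y)) (at y)"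
    by blast
  show ?thesis
  proof (rule that[of "\<lambda>i y. DF i y + E i y"])
    show "driven_fields T \<theta> \<beta> Q h X XX (K + 1) (full T V') (\<lambda>i. full T (F' i)) (\<lambda>i y. DF i y + E i y)"
    proof
      show "1 \<le> K + 1" using a.K by simp
      show "bdd_lip (K + 1) (full T V')"
        unfolding V_eq by (rule bdd_lip_mono[OF bdd_lip_add[OF a.V dV]]) (use \<epsilon> in simp)
      show "bdd_lip (K + 1) (full T (F' i))" for i
        unfolding F_eq by (rule bdd_lip_mono[OF bdd_lip_add[OF a.F E(1)]]) (use \<epsilon> in simp)
      show "bdd_lip (K + 1) (\<lambda>y. DF i y + E i y)" for i
        by (rule bdd_lip_mono[OF bdd_lip_add[OF a.DF(2) E(2)]]) (use \<epsilon> in simp)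
      show "(full T (F' i) has_derivative blinfun_apply (DF i y + E i y)) (at y)" for i y
        unfolding F_eq plus_blinfun.rep_eq by (rule has_derivative_add[OF a.DF(1) E(3)])
    qed
  qed (use bdd_lipD(1)[OF dV] bdd_lipD(1)[OF E(1)] bdd_lipD(1)[OF E(2)] in \<open>simp_all add: V_eq F_eq\<close>)
qed

text \<open>Brings limit and approximating fields to the same \<open>K\<close>, hence to the same
  constants \<open>A\<close> and \<open>defect_const\<close>.\<close>

lemma driven_fields_mono:
  assumes "driven_fields T \<theta> \<beta> Q h X XX K V F DF" "K \<le> K'"
  shows "driven_fields T \<theta> \<beta> Q h X XX K' V F DF"
proof -
  interpret a: driven_fields T \<theta> \<beta> Q h X XX K V F DF by fact
  show ?thesis
    by unfold_locales
      (use a.K assms(2) bdd_lip_mono[OF a.V assms(2)] bdd_lip_mono[OF a.F assms(2)]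
        bdd_lip_mono[OF a.DF(2) assms(2)] a.DF(1) in auto)
qed

section \<open>Convergence of the solution flows\<close>

theorem corollary9:
  fixes T p \<alpha> :: real
    and h :: "real \<Rightarrow> real"
    and X :: "real \<Rightarrow> real \<Rightarrow> real ^ 'l::finite"
    and XX :: "real \<Rightarrow> real \<Rightarrow> real ^ 'l ^ 'l"
    and V :: "'d::finite vfield"
    and F :: "'l \<Rightarrow> 'd vfield"
    and V' :: "real \<Rightarrow> 'd vfield"
    and F' :: "real \<Rightarrow> 'l \<Rightarrow> 'd vfield"
    and \<phi> :: "real \<Rightarrow> real \<Rightarrow> real ^ 'd \<Rightarrow> real ^ 'd"
    and \<phi>' :: "real \<Rightarrow> real \<Rightarrow> real \<Rightarrow> real ^ 'd \<Rightarrow> real ^ 'd"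
  assumes "1 \<le> T" and "2 \<le> p" and "p < 3"
    and "rough_path T p X XX"
    and "holder T \<alpha> h" and "\<alpha> + 1 / p > 1"
    and "H1 T V F"
    and "\<And>l. H1 T (V' l) (F' l)"
    and "((\<lambda>l. C2_norm T (\<lambda>x. V' l x - V x)) \<longlongrightarrow> 0) at_top"
    and "\<And>i. ((\<lambda>l. rough_norm T (\<lambda>x. F' l i x - F i x)) \<longlongrightarrow> 0) at_top"
    and "markovian T V" and "\<And>i. markovian T (F i)"
    and "\<And>l. solution_flow T h X XX (V' l) (F' l) (\<phi>' l)"
    and "solution_flow T h X XX V F \<phi>"
  shows "uniform_limit {(s, t, x). 0 \<le> s \<and> s \<le> t \<and> t \<le> T}
           (\<lambda>l (s, t, x). \<phi>' l t s x) (\<lambda>(s, t, x). \<phi> t s x) at_top"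
proof -
  define \<theta> \<beta> where "\<theta> = 1 / p" and "\<beta> = min (2 / p) \<alpha>"
  obtain Q where "driving_signal T \<theta> \<beta> Q h X XX"
    unfolding \<theta>_def \<beta>_def by (rule driving_signal_of_rough_path[OF assms(2-6)])
  then interpret driving_signal T \<theta> \<beta> Q h X XX .
  have T0: "0 \<le> T" using assms(1) by simp
  \<comment> \<open>The leading 1 makes \<open>K\<close> strictly larger than each norm, as the
    extraction of derivatives from the infima requires.\<close>
  define K where "K = 1 + enn2real (C2_norm T V) + (\<Sum>i\<in>UNIV. enn2real (rough_norm T (F i)))"
  have K1: "1 \<le> K" by (simp add: K_def sum_nonneg)
  have less: "c < ennreal K" if "c < \<infinity>" "enn2real c < K" for c
    using that by (metis ennreal_enn2real ennreal_lessI infinity_ennreal_def enn2real_nonneg less_le_trans le_less_trans)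
  have "C2_norm T V < ennreal K"
    using assms(7) by (intro less) (auto simp: H1_def K_def sum_nonneg add_pos_nonneg)
  then obtain DV where V: "bdd_lip K (full T V)" "bdd_lip K DV" "\<And>y. (full T V has_derivative blinfun_apply (DV y)) (at y)"
    by (rule C2_norm_lessE) (use T0 K1 in auto)
  have "rough_norm T (F i) < ennreal K" for i
  proof (rule less)
    show "rough_norm T (F i) < \<infinity>" using assms(7) by (simp add: H1_def)
    have "enn2real (rough_norm T (F i)) \<le> (\<Sum>i\<in>UNIV. enn2real (rough_norm T (F i)))"
      by (rule member_le_sum) auto
    then show "enn2real (rough_norm T (F i)) < K"
      using enn2real_nonneg[of "C2_norm T V"] unfolding K_def by linarith
  qed
  then have "\<exists>D D'. bdd_lip K (full T (F i)) \<and> bdd_lip K D \<and> bdd_lip K D' \<and>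
      (\<forall>y. (full T (F i) has_derivative blinfun_apply (D y)) (at y)) \<and> (\<forall>y. (D has_derivative blinfun_apply (D' y)) (at y))" for i
    by (rule rough_norm_lessE) (use T0 K1 in auto)
  then obtain DF D2F where F: "\<And>i. bdd_lip K (full T (F i))" "\<And>i. bdd_lip K (DF i)" "\<And>i. bdd_lip K (D2F i)"
    "\<And>i y. (full T (F i) has_derivative blinfun_apply (DF i y)) (at y)"
    "\<And>i y. (DF i has_derivative blinfun_apply (D2F i y)) (at y)"
    by metis
  define K' where "K' = K + 1"
  have base: "driven_fields T \<theta> \<beta> Q h X XX K (full T V) (\<lambda>i. full T (F i)) DF"
    by unfold_locales (use K1 V F in auto)
  then have base': "driven_fields T \<theta> \<beta> Q h X XX K' (full T V) (\<lambda>i. full T (F i)) DF"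
    by (rule driven_fields_mono) (simp add: K'_def)
  interpret lim: driven_fields T \<theta> \<beta> Q h X XX K' "full T V" "\<lambda>i. full T (F i)" DF by (rule base')
  have cst_sd: "second_diff K' (\<lambda>x. q (cst x))" if "second_diff K q" for q :: "'d curve \<Rightarrow> 'e::real_normed_vector"
    by (rule second_diff_precomp[OF second_diff_mono[OF that]])
      (use K1 lim.cst_linear in \<open>auto simp: K'_def\<close>)
  interpret lim: markovian_fields T \<theta> \<beta> Q h X XX K' "full T V" "\<lambda>i. full T (F i)" DF
  proof
    show "lim.defect j k x = 0" for j k x
      unfolding lim.defect_def lim.cov_def markovian_mean_ramp[OF assms(12) assms(1) F(4)] by simp
    show "second_diff K' (\<lambda>x. full T V (cst x))"
      by (rule cst_sd[OF second_diff_derivative[OF V(3,2)]])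
    show "second_diff K' (\<lambda>x. DF i (cst x))" for i
      by (rule cst_sd[OF second_diff_derivative[OF F(5,3)]])
  qed
  \<comment> \<open>Obtained from \<open>T\<close> and \<open>X\<close> alone, hence valid for the
    limit and for all approximations at once.\<close>
  obtain \<gamma>0 \<delta>0 C where \<gamma>0: "1 < \<gamma>0" "0 < \<delta>0" "\<delta>0 \<le> 1" "0 \<le> C"
    and negl: "\<And>S. S \<in> negligible_tensors T X \<Longrightarrow> cross_bound T X \<gamma>0 \<delta>0 (C * norm S) S"
    using negligible_uniform[of T X] by blast
  define \<gamma> where "\<gamma> = min \<gamma>0 (\<theta> + \<beta>)"
  have \<gamma>: "1 < \<gamma>" "\<gamma> \<le> \<gamma>0" "\<gamma> \<le> \<theta> + \<beta>" using \<gamma>0 exponents by (auto simp: \<gamma>_def)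
  obtain \<kappa> \<rho> where \<kappa>: "0 < \<kappa>" "\<kappa> \<le> 1" and \<rho>: "(2 + \<kappa>) * 2 powr (- \<gamma>) \<le> \<rho>" "0 < \<rho>" "\<rho> < 1"
    by (rule contraction_ratio[OF \<gamma>(1)])
  let ?A = "lim.A"
  have A1: "1 \<le> ?A" by (rule lim.A_ge_1)
  \<comment> \<open>The supremum and the Lipschitz defect of the limit maps share one constant; the
    first entry also bounds the defect of the approximating maps.\<close>
  define C0 where "C0 = max (lim.defect_const C) (28 * ?A ^ 3 + 12 * ?A\<^sup>2)"
  define C1 where "C1 = C0 / (1 - \<rho>)"
  define C2 where "C2 = (C0 + C1) / (1 - \<rho>)"
  have C0: "0 \<le> C0" "lim.defect_const C \<le> C0" "28 * ?A ^ 3 + 12 * ?A\<^sup>2 \<le> C0"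
    using A1 by (auto simp: C0_def le_max_iff_disj)
  have C1: "0 \<le> C1" "C0 \<le> (1 - \<rho>) * C1" using C0 \<rho> by (auto simp: C1_def)
  have C2: "0 \<le> C2" "C0 + C1 \<le> (1 - \<rho>) * C2" using C0 C1 \<rho> by (auto simp: C2_def)
  \<comment> \<open>The budget \<kappa> is split in halves between the two summands in the condition
    on \<delta> of \<open>stable_almost_flow\<close>; this works because \<open>C2\<close> was fixed
    before \<delta>.\<close>
  obtain \<delta>1 where \<delta>1: "0 < \<delta>1" "\<delta>1 \<le> \<delta>0" "4 * ?A * \<delta>1 powr \<theta> \<le> \<kappa> / 2"
    using small_step[OF exponents(1), of "\<kappa> / 2" \<delta>0 "4 * ?A"] \<kappa> \<gamma>0 by auto
  obtain \<delta> where \<delta>: "0 < \<delta>" "\<delta> \<le> \<delta>1" "C2 * \<delta> powr \<gamma> \<le> \<kappa> / 2"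
    using small_step[of \<gamma> "\<kappa> / 2" \<delta>1 C2] \<kappa> \<gamma> \<delta>1 by auto
  have \<delta>_le: "\<delta> \<le> \<delta>0" "\<delta> \<le> 1" using \<delta> \<delta>1 \<gamma>0 by auto
  have "4 * ?A * \<delta> powr \<theta> \<le> 4 * ?A * \<delta>1 powr \<theta>"
    using \<delta> A1 exponents by (intro mult_left_mono powr_mono2) auto
  with \<delta>1(3) have A\<delta>: "4 * ?A * \<delta> powr \<theta> \<le> \<kappa> / 2" by linarith
  have A\<delta>': "2 * ?A * \<delta> powr \<theta> \<le> \<kappa>" using A\<delta> \<kappa> A1 by (simp add: mult.assoc)
  let ?m = "local_map h X XX (full T V) (\<lambda>i. full T (F i)) DF"
  interpret saf: stable_almost_flow T \<delta> \<kappa> \<rho> "2 * ?A" \<theta> \<gamma> C0 C1 C2 ?m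
  proof
    show "2 * (2 * ?A) * \<delta> powr \<theta> + C2 * \<delta> powr \<gamma> \<le> \<kappa>" using A\<delta> \<delta>(3) by simp
  next
    fix s t :: real and x y :: "real ^ 'd" assume st: "0 \<le> s" "s \<le> t" "t \<le> T" "t - s \<le> \<delta>"
    show "norm ((?m t s x - x) - (?m t s y - y)) \<le> 2 * ?A * (t - s) powr \<theta> * norm (x - y)"
      by (rule bdd_lipD(2)[OF lim.local_map_bdd_lip]) (use st \<delta>_le in auto)
    show "second_diff (2 * ?A * (t - s) powr \<theta>) (\<lambda>x. ?m t s x - x)"
      by (rule lim.local_map_sd) (use st \<delta>_le in auto)
  next
    fix s u t :: real and x y :: "real ^ 'd" assume st: "0 \<le> s" "s \<le> u" "u \<le> t" "t \<le> T" "t - s \<le> \<delta>"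
    have "lim.defect_tensor i x = 0" for i x
      by (simp add: lim.defect_tensor_def lim.defect_zero vec_eq_iff)
    then have "norm (?m t u (?m u s x) - ?m t s x) \<le> lim.defect_const C * (t - s) powr \<gamma>"
      by (intro lim.almost_flow_uniform[of \<gamma>0 \<delta>0]) (use st \<gamma>0 \<gamma> \<delta>_le in \<open>auto simp: cross_bound_def\<close>)
    also have "\<dots> \<le> C0 * (t - s) powr \<gamma>" using C0 by (intro mult_right_mono) auto
    finally show "norm (?m t u (?m u s x) - ?m t s x) \<le> C0 * (t - s) powr \<gamma>" .
    have "norm ((?m t u (?m u s x) - ?m t s x) - (?m t u (?m u s y) - ?m t s y))
        \<le> (28 * ?A ^ 3 + 12 * ?A\<^sup>2) * (t - s) powr (\<theta> + \<beta>) * norm (x - y)"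
      by (rule lim.almost_flow_lipschitz) (use st \<delta>_le in auto)
    also have "\<dots> \<le> C0 * (t - s) powr \<gamma> * norm (x - y)"
      using C0 st \<gamma> \<delta>_le by (intro mult_right_mono mult_mono powr_mono') auto
    finally show "norm ((?m t u (?m u s x) - ?m t s x) - (?m t u (?m u s y) - ?m t s y))
        \<le> C0 * (t - s) powr \<gamma> * norm (x - y)" .
  qed (use \<delta> exponents \<gamma> A1 C0 C1 C2 \<kappa> \<rho> in auto)
  have D: "lim.defect_const C \<le> (1 - \<rho>) * C1" using C0 C1 by linarith
  have flows: "flow T \<phi>" "\<And>l. flow T (\<phi>' l)"
    using assms(13,14) by (auto simp: solution_flow_def)
  have close: "norm (\<phi> t s x - ?m t s x) \<le> C1 * (t - s) powr \<gamma>"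
    if "0 \<le> s" "s \<le> t" "t \<le> T" "t - s \<le> \<delta>" for s t x
    by (rule lim.solution_flow_close[OF assms(1) _ _ refl refl assms(14) negl \<gamma>0(4,3) \<gamma>(2,3) \<delta>(1) \<delta>_le(1) C1(1) A\<delta>' \<rho>(1) D that])
      (use assms(7) in \<open>auto simp: H1_def\<close>)
  have close': "\<forall>\<^sub>F l in at_top. \<forall>s t x. 0 \<le> s \<longrightarrow> s \<le> t \<longrightarrow> t \<le> T \<longrightarrow> t - s \<le> \<delta> \<longrightarrow>
      norm (\<phi>' l t s x - ?m t s x) \<le> C1 * (t - s) powr \<gamma> + \<eta>" if "0 < \<eta>" for \<eta>
  proof -
    \<comment> \<open>The cap 1 keeps the approximating fields within the bound \<open>K'\<close>;
      the quotient makes the distance of the local maps, at most \<open>?A * \<epsilon>\<close>, at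
      most \<eta>.\<close>
    define \<epsilon> where "\<epsilon> = min 1 (\<eta> / ?A)"
    have \<epsilon>: "0 < \<epsilon>" "\<epsilon> \<le> 1" "?A * \<epsilon> \<le> \<eta>"
      using that A1 by (auto simp: \<epsilon>_def min_def field_simps)
    have "\<forall>\<^sub>F l in at_top. C2_norm T (\<lambda>x. V' l x - V x) < ennreal \<epsilon>"
      by (rule order_tendstoD(2)[OF assms(9)]) (use \<epsilon> in simp)
    moreover have "\<forall>\<^sub>F l in at_top. \<forall>i. rough_norm T (\<lambda>x. F' l i x - F i x) < ennreal \<epsilon>"
      by (intro eventually_all_finite order_tendstoD(2)[OF assms(10)]) (use \<epsilon> in simp)
    ultimately show ?thesis
    proof eventually_elim
      case (elim l)
      obtain DF' where df: "driven_fields T \<theta> \<beta> Q h X XX K' (full T (V' l)) (\<lambda>i. full T (F' l i)) DF'"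
        and diff: "\<And>y. norm (full T (V' l) y - full T V y) \<le> \<epsilon>" "\<And>i y. norm (full T (F' l i) y - full T (F i) y) \<le> \<epsilon>"
          "\<And>i y. norm (DF' i y - DF i y) \<le> \<epsilon>"
        unfolding K'_def by (rule perturbed_fields[OF base T0 elim(1) elim(2)[rule_format] \<epsilon>(1,2)]) auto
      interpret b: driven_fields T \<theta> \<beta> Q h X XX K' "full T (V' l)" "\<lambda>i. full T (F' l i)" DF' by (rule df)
      show ?case
      proof (intro allI impI)
        fix s t x assume st: "0 \<le> s" "s \<le> t" "t \<le> T" "t - s \<le> \<delta>"
        have 1: "norm (\<phi>' l t s x - b.m t s x) \<le> C1 * (t - s) powr \<gamma>"
          by (rule b.solution_flow_close[OF assms(1) _ _ refl refl assms(13) negl \<gamma>0(4,3) \<gamma>(2,3) \<delta>(1) \<delta>_le(1) C1(1) A\<delta>' \<rho>(1) D st])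
            (use assms(8) in \<open>auto simp: H1_def\<close>)
        have "norm (b.m t s x - ?m t s x) \<le> 6 * lim.A0 * \<epsilon>"
          unfolding lim.A0_def by (rule local_map_diff_le[OF base' df diff]) (use st \<delta>_le in auto)
        also have "\<dots> \<le> ?A * \<epsilon>"
          using lim.A0_ge[of 0 0 0] \<epsilon> by (intro mult_right_mono) (auto simp: lim.A_def)
        finally have 2: "norm (b.m t s x - ?m t s x) \<le> \<eta>" using \<epsilon>(3) by linarith
        show "norm (\<phi>' l t s x - ?m t s x) \<le> C1 * (t - s) powr \<gamma> + \<eta>"
          using norm_triangle_mono[OF 1 2] by simp
      qed
    qed
  qed
  show ?thesis
  proof (rule flows_converge_globally[OF flows \<delta>(1)])
    show "norm (\<phi> t s x - \<phi> t s y) \<le> 2 * norm (x - y)"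
      if "0 \<le> s" "s \<le> t" "t \<le> T" "t - s \<le> \<delta>" for s t x y
      by (rule saf.flow_lipschitz[OF flows(1) C1(1) close that])
    show "\<forall>\<^sub>F l in at_top. \<forall>s t x. 0 \<le> s \<longrightarrow> s \<le> t \<longrightarrow> t \<le> T \<longrightarrow> t - s \<le> \<delta> \<longrightarrow> norm (\<phi>' l t s x - \<phi> t s x) \<le> \<epsilon>"
      if "0 < \<epsilon>" for \<epsilon>
      by (rule saf.flows_converge_locally[OF flows C1(1) close close' that])
  qed
qed

end
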